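(* Let $\mu$ be an absolutely continuous invariant measure of $(\mathsf P^t)_{t\ge0}$ with invariant densities $(\rho_i)_{i\in S}$. Assume that $u_1(0)=0$, that $u_i(0)\ne0$ for all $i\in S\setminus\{1\}$, and that there is a constant $a\neq 0$ with $u_1(\eta)=-a\eta+O(\eta^2)$ as $\eta\downarrow0$ (no analyticity of the vector fields is assumed). Let $\bar\rho(\eta)=\sum_{i>1}\lambda_{i,1}\rho_i(\eta)$. Then the following hold, where cases B and C (the position of $0$ relative to the support of $(\mu_i)_{i\in S}$) are as defined in the context. (1) Let $\lambda_1<a$. In cases B and C, there is a constant $c>0$ such that $\rho_1(\eta)=c\,\eta^{\frac{\lambda_1}{a}-1}+o(\eta^{\frac{\lambda_1}{a}-1})$ as $\eta\downarrow 0$. (2) Let $\lambda_1>a>0$. In case B, $\lim_{\eta\downarrow0}\rho_1(\eta)=\frac{\bar\rho(0)}{\lambda_1-a}>0$. In case C, $\lim_{\eta\downarrow0}\rho_1(\eta)=\frac{\bar\rho(0)}{\lambda_1-a}=0$. (3) Let $\lambda_1=a$. In case B, there exist constants $c',c>0$ such that $-c'\ln(\eta)\le\rho_1(\eta)\le -c\ln(\eta)$ for all sufficiently small $\eta>0$. In case C, there is a constant $c>0$ such that $\rho_1(\eta)\le -c\ln(\eta)$ for all sufficiently small $\eta>0$. (4) Let $a<0$. In case B, $\lim_{\eta\downarrow0}\rho_1(\eta)=\frac{\bar\rho(0)}{\lambda_1-a}>0$. Case C is not possible.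
   Context: Setting. Let $S=\{1,\dots,N\}$ with $N\ge 2$, and let $D=\{u_i: i\in S\}$ be a finite collection of continuously differentiable vector fields on $\mathbb R$ that are forward-complete (for every $\xi\in\mathbb R$ the problem $\dot x=u_i(x)$, $x(0)=\xi$ has a unique solution $\Phi_i^t(\xi)$ for all $t\ge 0$). For $i\ne j$ in $S$ let $\lambda_{i,j}>0$ be the (constant) rate of switching from $i$ to $j$, and put $\lambda_i=\sum_{j\neq i}\lambda_{i,j}$. The switching process $(X,A)=(X_t,A_t)_{t\ge0}$ is the Markov process on $\mathbb R\times S$ in which $A$ is the continuous-time Markov chain on $S$ with jump rates $\lambda_{i,j}$, and $X$ is continuous and follows $\dot X_t=u_{A_t}(X_t)$ between the jumps of $A$. Its Markov semigroup is $(\mathsf P^t)_{t\ge0}$ with transition probabilities $\mathsf P^t_{\xi,i}$. A probability measure $\mu$ on $\mathbb R\times S$ is invariant if $\mu(E\times\{i\})=\sum_{j\in S}\int_{\mathbb R}\mathsf P^t_{\xi,j}(E\times\{i\})\,\mu(d\xi\times\{j\})$ for all Borel $E\subset\mathbb R$, $i\in S$, $t\ge0$. Put $\mu_i=\mu(\cdot\times\{i\})$. If $\mu$ is absolutely continuous (with respect to Lebesgue measure times counting measure), $\rho_i\in L^1(\mathbb R)$ denotes the Lebesgue density of $\mu_i$ (invariant density). A regularity property of $\rho_i$ means that the class $\rho_i$ has a representative with that property. A point is a critical point of $u_i$ if $u_i$ vanishes there. Standing assumption: the set of critical points of the vector fields in $D$ has no accumulation points. Representatives: on any open interval containing no critical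 point of $u_i$, the density $\rho_i$ has a continuous representative; these are used for $\rho_1$ on a right neighbourhood $(0,\delta)$ of $0$ and for $\rho_i$, $i>1$, on a neighbourhood of $0$, so that $\bar\rho(0)$ is well defined. Cases. A nonempty set $J\subset\mathbb R$ is invariant if every finite composition of flow maps $\Phi_{i_m}^{t_m}\circ\dots\circ\Phi_{i_1}^{t_1}$ with $i_k\in S$, $t_k\ge0$ maps $J$ into $J$; it is minimal invariant if no nonempty strict subset of it is invariant. For absolutely continuous invariant $\mu$, all measures $\mu_i$, $i\in S$, have the same support, called the support of $(\mu_i)_{i\in S}$; it is the union of a collection $\mathscr I$ of closed intervals of positive length, namely the closures of the minimal invariant sets $J$ with $\mu(J\times S)>0$. Exactly one of the following holds: (A) $0$ is the left endpoint of an open interval that contains no points of the support of $(\mu_i)_{i\in S}$; (B) $0$ is contained in the interior of an interval $I\in\mathscr I$; (C) $0$ is the left endpoint of an interval $I\in\mathscr I$. (Since $0$ is critical only for $u_1$, in case C the point $0$ is also the right endpoint of an open interval containing no points of the support.) *)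

theory Defs
  imports "HOL-Probability.Probability" "HOL-Library.Landau_Symbols"
begin

definition ode_solution :: "(real \<Rightarrow> real) \<Rightarrow> real \<Rightarrow> (real \<Rightarrow> real) \<Rightarrow> bool" where
  "ode_solution v \<xi> x \<longleftrightarrow>
     x 0 = \<xi> \<and> (\<forall>t\<ge>0. (x has_real_derivative v (x t)) (at t within {0..}))"

definition forward_complete :: "(real \<Rightarrow> real) \<Rightarrow> bool" where
  "forward_complete v \<longleftrightarrow>
     (\<forall>\<xi>. \<exists>x. ode_solution v \<xi> x \<and> (\<forall>y. ode_solution v \<xi> y \<longrightarrow> (\<forall>t\<ge>0. y t = x t)))"

text \<open>Only meaningful for \<open>t \<ge> 0\<close>; for \<open>t < 0\<close> the value is a constant not depending on
  \<open>\<xi>\<close>.\<close>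

definition flow :: "(real \<Rightarrow> real) \<Rightarrow> real \<Rightarrow> real \<Rightarrow> real" where
  "flow v t \<xi> = (THE y. \<exists>x. ode_solution v \<xi> x \<and> y = x t)"

definition exit_rate :: "nat \<Rightarrow> (nat \<Rightarrow> nat \<Rightarrow> real) \<Rightarrow> nat \<Rightarrow> real" where
  "exit_rate N lam i = (\<Sum>j\<in>{1..N} - {i}. lam i j)"

text \<open>
  The process is built on a canonical probability space from the jump chain and the holding
  times of the Markov chain: the \<open>k\<close>-th visited state \<open>i\<close> is held for an exponential time with
  parameter \<open>exit_rate N lam i\<close>, and then left for \<open>j \<noteq> i\<close> with probability
  \<open>lam i j / exit_rate N lam i\<close>. A sample point \<open>\<omega>\<close> provides, for every step \<open>k\<close> and every state
  \<open>i\<close>, independently, the pair \<open>\<omega> k i\<close> consisting of the holding time and the next state to be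
  used if the \<open>k\<close>-th visited state is \<open>i\<close>.
\<close>

definition jump_law :: "nat \<Rightarrow> (nat \<Rightarrow> nat \<Rightarrow> real) \<Rightarrow> nat \<Rightarrow> (real \<times> nat) measure" where
  "jump_law N lam i =
     density lborel (\<lambda>s. ennreal (exponential_density (exit_rate N lam i) s)) \<Otimes>\<^sub>M
     density (count_space {1..N}) (\<lambda>j. ennreal (if j = i then 0 else lam i j / exit_rate N lam i))"

type_synonym sample = "nat \<Rightarrow> nat \<Rightarrow> real \<times> nat"

definition sample_space :: "nat \<Rightarrow> (nat \<Rightarrow> nat \<Rightarrow> real) \<Rightarrow> sample measure" where
  "sample_space N lam = PiM (UNIV :: nat set) (\<lambda>k. PiM {1..N} (jump_law N lam))"

primrec jump_state :: "sample \<Rightarrow> nat \<Rightarrow> nat \<Rightarrow> nat" where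
  "jump_state \<omega> i 0 = i"
| "jump_state \<omega> i (Suc k) = snd (\<omega> k (jump_state \<omega> i k))"

definition holding_time :: "sample \<Rightarrow> nat \<Rightarrow> nat \<Rightarrow> real" where
  "holding_time \<omega> i k = fst (\<omega> k (jump_state \<omega> i k))"

definition jump_time :: "sample \<Rightarrow> nat \<Rightarrow> nat \<Rightarrow> real" where
  "jump_time \<omega> i k = (\<Sum>m<k. holding_time \<omega> i m)"

primrec jump_position :: "(nat \<Rightarrow> real \<Rightarrow> real) \<Rightarrow> sample \<Rightarrow> real \<Rightarrow> nat \<Rightarrow> nat \<Rightarrow> real" where
  "jump_position u \<omega> \<xi> i 0 = \<xi>"
| "jump_position u \<omega> \<xi> i (Suc k) =
     flow (u (jump_state \<omega> i k)) (holding_time \<omega> i k) (jump_position u \<omega> \<xi> i k)"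

text \<open>The number of jumps up to time \<open>t\<close>; almost surely, the jump times increase strictly to
  infinity, so that the minimum exists for all \<open>t\<close>.\<close>

definition num_jumps :: "sample \<Rightarrow> nat \<Rightarrow> real \<Rightarrow> nat" where
  "num_jumps \<omega> i t = (LEAST k. t < jump_time \<omega> i (Suc k))"

definition switch_A :: "sample \<Rightarrow> nat \<Rightarrow> real \<Rightarrow> nat" where
  "switch_A \<omega> i t = jump_state \<omega> i (num_jumps \<omega> i t)"

definition switch_X :: "(nat \<Rightarrow> real \<Rightarrow> real) \<Rightarrow> sample \<Rightarrow> real \<Rightarrow> nat \<Rightarrow> real \<Rightarrow> real" where
  "switch_X u \<omega> \<xi> i t =
     (let n = num_jumps \<omega> i t in
        flow (u (jump_state \<omega> i n)) (t - jump_time \<omega> i n) (jump_position u \<omega> \<xi> i n))"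

definition transition ::
  "nat \<Rightarrow> (nat \<Rightarrow> real \<Rightarrow> real) \<Rightarrow> (nat \<Rightarrow> nat \<Rightarrow> real) \<Rightarrow> real \<Rightarrow> real \<Rightarrow> nat \<Rightarrow> (real \<times> nat) measure"
where
  "transition N u lam t \<xi> i =
     distr (sample_space N lam) (borel \<Otimes>\<^sub>M count_space {1..N})
       (\<lambda>\<omega>. (switch_X u \<omega> \<xi> i t, switch_A \<omega> i t))"

text \<open>The measure \<open>E \<mapsto> \<mu> (E \<times> {i})\<close> on the real line.\<close>

definition component :: "(real \<times> nat) measure \<Rightarrow> nat \<Rightarrow> real measure" where
  "component \<mu> i = distr (restrict_space \<mu> (UNIV \<times> {i})) borel fst"

definition invariant_measure ::
  "nat \<Rightarrow> (nat \<Rightarrow> real \<Rightarrow> real) \<Rightarrow> (nat \<Rightarrow> nat \<Rightarrow> real) \<Rightarrow> (real \<times> nat) measure \<Rightarrow> bool"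
where
  "invariant_measure N u lam \<mu> \<longleftrightarrow>
     prob_space \<mu> \<and> sets \<mu> = sets (borel \<Otimes>\<^sub>M count_space {1..N}) \<and>
     (\<forall>t\<ge>0. \<forall>E\<in>sets borel. \<forall>i\<in>{1..N}.
        emeasure \<mu> (E \<times> {i}) =
          (\<Sum>j\<in>{1..N}. \<integral>\<^sup>+\<xi>. emeasure (transition N u lam t \<xi> j) (E \<times> {i}) \<partial>(component \<mu> j)))"

definition invariant_density :: "(real \<times> nat) measure \<Rightarrow> nat \<Rightarrow> (real \<Rightarrow> real) \<Rightarrow> bool" where
  "invariant_density \<mu> i r \<longleftrightarrow>
     r \<in> borel_measurable borel \<and> (AE x in lborel. 0 \<le> r x) \<and>
     component \<mu> i = density lborel (\<lambda>x. ennreal (r x))"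

definition rho_bar :: "nat \<Rightarrow> (nat \<Rightarrow> nat \<Rightarrow> real) \<Rightarrow> (nat \<Rightarrow> real \<Rightarrow> real) \<Rightarrow> real \<Rightarrow> real" where
  "rho_bar N lam r \<eta> = (\<Sum>i\<in>{2..N}. lam i 1 * r i \<eta>)"

definition invariant_set :: "nat \<Rightarrow> (nat \<Rightarrow> real \<Rightarrow> real) \<Rightarrow> real set \<Rightarrow> bool" where
  "invariant_set N u J \<longleftrightarrow> J \<noteq> {} \<and>
     (\<forall>ps. (\<forall>(i, t)\<in>set ps. i \<in> {1..N} \<and> 0 \<le> t) \<longrightarrow>
        (\<forall>x\<in>J. fold (\<lambda>(i, t). flow (u i) t) ps x \<in> J))"

definition minimal_invariant_set :: "nat \<Rightarrow> (nat \<Rightarrow> real \<Rightarrow> real) \<Rightarrow> real set \<Rightarrow> bool" where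
  "minimal_invariant_set N u J \<longleftrightarrow>
     invariant_set N u J \<and> (\<forall>K. K \<noteq> {} \<and> K \<subset> J \<longrightarrow> \<not> invariant_set N u K)"

text \<open>The family of intervals whose union is the support of the components of \<open>\<mu>\<close>.\<close>

definition support_intervals ::
  "nat \<Rightarrow> (nat \<Rightarrow> real \<Rightarrow> real) \<Rightarrow> (real \<times> nat) measure \<Rightarrow> real set set"
where
  "support_intervals N u \<mu> =
     {closure J | J. minimal_invariant_set N u J \<and> measure \<mu> (J \<times> {1..N}) > 0}"

definition case_B :: "nat \<Rightarrow> (nat \<Rightarrow> real \<Rightarrow> real) \<Rightarrow> (real \<times> nat) measure \<Rightarrow> bool" where
  "case_B N u \<mu> \<longleftrightarrow> (\<exists>I\<in>support_intervals N u \<mu>. 0 \<in> interior I)"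

definition case_C :: "nat \<Rightarrow> (nat \<Rightarrow> real \<Rightarrow> real) \<Rightarrow> (real \<times> nat) measure \<Rightarrow> bool" where
  "case_C N u \<mu> \<longleftrightarrow> (\<exists>I\<in>support_intervals N u \<mu>. 0 \<in> I \<and> (\<forall>x\<in>I. 0 \<le> x))"

end

theory Submission
  imports Defs
begin

text \<open>
The theorem rests on the stationary form of the Kolmogorov forward equation. Put
\<open>h i = (\<Sum>j\<noteq>i. lam j i * \<rho> j) - exit_rate i * \<rho> i\<close>, the net rate at which the switching creates mass in state
\<open>i\<close>. Stationarity says that the derivative of \<open>u i * \<rho> i\<close> is \<open>h i\<close>, and, in integrated form, that
\<open>u i * \<rho> i\<close> agrees almost everywhere with \<open>flux i x\<close>, the integral of \<open>h i\<close> over \<open>{..x}\<close>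
(\<open>u_rho_eq_flux\<close>). This is derived from the invariance of \<open>\<mu>\<close> by expanding the semigroup over a short
time: up to an error of order \<open>t\<^sup>2\<close>, uniform in the starting point, at most one jump occurs
(\<open>short_time_expansion\<close>, \<open>weak_stationarity\<close>). As \<open>flux i\<close> is continuous, \<open>flux i / u i\<close> is the
representative of \<open>\<rho> i\<close> that is continuous away from the critical points of \<open>u i\<close>. Since the functions
\<open>h i\<close> add up to \<open>0\<close>, so do the fluxes: there is no net transport through any point (\<open>sum_flux\<close>).

To the right of \<open>0\<close> the flux \<open>w\<close> of state \<open>1\<close> solves the linear equation
\<open>w' = inflow - rate * w / u 1\<close>, with \<open>w\<close> tending to \<open>0\<close> because \<open>\<rho> 1\<close> is integrable (\<open>flux_1_0\<close>). The
integrating factor of this equation is \<open>x powr (- rate / a)\<close> up to a factor that tends to \<open>1\<close>, and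
the four regimes of \<open>\<rho> 1 = w / u 1\<close> are those of a scalar equation with a singular point: the
rule of l'Hopital gives the finite limit and the logarithm (\<open>finite_limit\<close>, \<open>logarithmic_limit\<close>), and
for \<open>rate < a\<close> the product of \<open>w\<close> and the integrating factor is monotone and bounded, with a limit
that is nonzero unless all densities vanish to the right of \<open>0\<close> (\<open>power_law\<close>).

It remains to find out where the densities are positive. If \<open>flux i\<close> vanishes at a point where
\<open>u i\<close> does not, then all densities vanish upstream of that point: mass there would be carried
through the point in state \<open>i\<close>. This is a Gronwall argument (\<open>vanishing_upstream\<close>). Consequently the
complement of the support is closed under going back along the flows. A minimal invariant set can be
reached from each of its points, so one that is charged by \<open>\<mu>\<close> lies inside the support
(\<open>not_silent_in_support\<close>). When \<open>0\<close> is interior to such a set, some fields point to the left at \<open>0\<close> and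
some to the right, and if the inflow vanished at \<open>0\<close>, then so would all densities on both sides
(\<open>inflow_positive_inside\<close>). When \<open>0\<close> is its left endpoint, all fields except \<open>u 1\<close> point to the right at
\<open>0\<close>; the fluxes at \<open>0\<close> are then nonnegative with sum \<open>0\<close>, so the inflow vanishes
(\<open>left_endpoint_inflow\<close>), and \<open>a < 0\<close> is excluded, since near \<open>0\<close> nothing would ever move to the left
(\<open>left_endpoint_attracting\<close>).
\<close>
section \<open>Flows of forward-complete vector fields on the line\<close>
text \<open>
The derivative within \<open>{0..}\<close> does not see negative times, where solutions are arbitrary.
\<close>
lemma has_real_derivative_within_nonneg_cong:
  assumes "\<And>s. s \<ge> 0 \<Longrightarrow> x s = y s" "t \<ge> (0::real)"
  shows "(x has_real_derivative d) (at t within {0..}) \<longleftrightarrow> (y has_real_derivative d) (at t within {0..})"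
proof -
  have *: "(p has_real_derivative d) (at t within {0..})"
    if "(q has_real_derivative d) (at t within {0..})" "\<And>s. s \<ge> 0 \<Longrightarrow> p s = q s" for p q
    using has_field_derivative_transform_within[OF that(1), of 1 p] that(2) assms(2) by auto
  show ?thesis
    using *[of x y] *[of y x] assms(1) by auto
qed

lemma flow_eqI:
  assumes fc: "forward_complete v" and x: "ode_solution v \<xi> x" and t: "t \<ge> 0"
  shows "flow v t \<xi> = x t"
proof -
  obtain x0 where x0: "\<And>y. ode_solution v \<xi> y \<Longrightarrow> \<forall>t\<ge>0. y t = x0 t"
    using fc unfolding forward_complete_def by blast
  show ?thesis
    unfolding flow_def
  proof (rule the_equality)
    show "\<exists>xa. ode_solution v \<xi> xa \<and> x t = xa t" using x by blast
    fix y assume "\<exists>xa. ode_solution v \<xi> xa \<and> y = xa t"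
    then obtain z where "ode_solution v \<xi> z" "y = z t" by blast
    then show "y = x t" using x0[of z] x0[OF x] t by simp
  qed
qed

lemma flow_solution:
  assumes fc: "forward_complete v"
  shows "ode_solution v \<xi> (\<lambda>t. flow v t \<xi>)"
proof -
  obtain x where x: "ode_solution v \<xi> x" using fc unfolding forward_complete_def by blast
  have eq: "flow v t \<xi> = x t" if "t \<ge> 0" for t using flow_eqI[OF fc x that] .
  show ?thesis
    unfolding ode_solution_def
  proof (intro conjI allI impI)
    show "flow v 0 \<xi> = \<xi>" using eq[of 0] x by (simp add: ode_solution_def)
    fix t :: real assume t: "t \<ge> 0"
    have "(x has_real_derivative v (x t)) (at t within {0..})"
      using x t by (simp add: ode_solution_def)
    then show "((\<lambda>t. flow v t \<xi>) has_real_derivative v (flow v t \<xi>)) (at t within {0..})"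
      using has_real_derivative_within_nonneg_cong[of "\<lambda>t. flow v t \<xi>" x t] eq t by simp
  qed
qed

lemma flow_0: "forward_complete v \<Longrightarrow> flow v 0 \<xi> = \<xi>"
  using flow_solution[of v \<xi>] by (simp add: ode_solution_def)

lemma flow_has_derivative:
  "forward_complete v \<Longrightarrow> t \<ge> 0 \<Longrightarrow>
    ((\<lambda>t. flow v t \<xi>) has_real_derivative v (flow v t \<xi>)) (at t within {0..})"
  using flow_solution[of v \<xi>] by (simp add: ode_solution_def)

lemma continuous_on_flow: "forward_complete v \<Longrightarrow> continuous_on {0..} (\<lambda>t. flow v t \<xi>)"
  by (rule DERIV_continuous_on) (auto intro: flow_has_derivative)

text \<open>
A solution can be changed freely at a negative time, so the description defining the flow is
satisfied by every number. Knowing that the flow is constant there yields its measurability on the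
whole time axis.
\<close>
lemma flow_negative_time:
  assumes fc: "forward_complete v" and t: "t < 0"
  shows "flow v t \<xi> = (THE y. True)"
proof -
  have "(\<exists>x. ode_solution v \<xi> x \<and> y = x t) \<longleftrightarrow> True" for y
  proof -
    let ?x = "(\<lambda>s. flow v s \<xi>)(t := y)"
    have "ode_solution v \<xi> ?x"
      unfolding ode_solution_def
    proof (intro conjI allI impI)
      show "?x 0 = \<xi>" using t flow_0[OF fc] by simp
      fix s :: real assume s: "s \<ge> 0"
      show "(?x has_real_derivative v (?x s)) (at s within {0..})"
        using has_real_derivative_within_nonneg_cong[of ?x "\<lambda>s. flow v s \<xi>" s] s t
          flow_has_derivative[OF fc s, of \<xi>] by simp
    qed
    then show ?thesis by (intro iffI exI[of _ ?x] TrueI) auto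
  qed
  then show ?thesis unfolding flow_def by simp
qed

lemma flow_add:
  assumes fc: "forward_complete v" and s: "s \<ge> 0" and t: "t \<ge> 0"
  shows "flow v (s + t) \<xi> = flow v t (flow v s \<xi>)"
proof -
  have "ode_solution v (flow v s \<xi>) (\<lambda>t. flow v (s + t) \<xi>)"
    unfolding ode_solution_def
  proof (intro conjI allI impI)
    show "flow v (s + 0) \<xi> = flow v s \<xi>" by simp
    fix t :: real assume t: "t \<ge> 0"
    have "((\<lambda>t. flow v t \<xi>) has_real_derivative v (flow v (s+t) \<xi>)) (at (s+t) within (+) s ` {0..})"
      by (rule DERIV_subset[OF flow_has_derivative[OF fc]]) (use s t in auto)
    moreover have "((\<lambda>t. s + t) has_real_derivative 1) (at t within {0..})"
      by (auto intro!: derivative_eq_intros)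
    ultimately have "((\<lambda>t. flow v t \<xi>) \<circ> (\<lambda>t. s + t) has_real_derivative v (flow v (s+t) \<xi>) * 1) (at t within {0..})"
      by (rule DERIV_image_chain)
    then show "((\<lambda>t. flow v (s+t) \<xi>) has_real_derivative v (flow v (s+t) \<xi>)) (at t within {0..})"
      by (simp add: o_def)
  qed
  from flow_eqI[OF fc this t] show ?thesis by simp
qed

text \<open>
Two trajectories that meet coincide from then on, so on the line they cannot cross.
\<close>
lemma flow_mono:
  assumes fc: "forward_complete v" and t: "t \<ge> 0" and le: "\<xi> \<le> \<eta>"
  shows "flow v t \<xi> \<le> flow v t \<eta>"
proof (rule ccontr)
  assume "\<not> ?thesis"
  then have less: "flow v t \<eta> - flow v t \<xi> < 0" by simp
  have "\<exists>s\<ge>0. s \<le> t \<and> flow v s \<eta> - flow v s \<xi> = 0"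
  proof (rule IVT2')
    show "flow v t \<eta> - flow v t \<xi> \<le> 0" using less by simp
    show "0 \<le> flow v 0 \<eta> - flow v 0 \<xi>" using le flow_0[OF fc] by simp
    show "continuous_on {0..t} (\<lambda>s. flow v s \<eta> - flow v s \<xi>)"
      by (intro continuous_intros continuous_on_subset[OF continuous_on_flow[OF fc]]) auto
  qed (use t in auto)
  then obtain s where s: "0 \<le> s" "s \<le> t" "flow v s \<eta> = flow v s \<xi>" by auto
  then have "flow v t \<eta> = flow v t \<xi>"
    using flow_add[OF fc, of s "t - s"] by simp
  then show False using less by simp
qed

lemma flow_critical:
  assumes fc: "forward_complete v" and "v p = 0" "t \<ge> 0"
  shows "flow v t p = p"
  by (rule flow_eqI[OF fc _ \<open>t \<ge> 0\<close>]) (simp add: ode_solution_def \<open>v p = 0\<close>)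

text \<open>
Trajectories cannot pass a point leftwards if the field does not point to the left there.
\<close>
lemma flow_ge:
  assumes fc: "forward_complete v" and vp: "v p \<ge> 0" and t: "t \<ge> 0" and p: "p \<le> \<xi>"
  shows "p \<le> flow v t \<xi>"
proof -
  have "p \<le> flow v t p"
  proof (cases "v p = 0")
    case True
    then show ?thesis using flow_critical[OF fc True t] by simp
  next
    case False
    show ?thesis
    proof (rule ccontr)
      assume less: "\<not> ?thesis"
      let ?x = "\<lambda>s. flow v s p"
      have cont: "continuous_on {0..t} ?x"
        by (rule continuous_on_subset[OF continuous_on_flow[OF fc]]) auto
      define S where "S = {s \<in> {0..t}. ?x s = p}"
      have "closed S" unfolding S_def by (rule continuous_closed_preimage_constant[OF cont]) simp
      moreover have "bounded S" by (rule bounded_subset[of "{0..t}"]) (auto simp: S_def)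
      ultimately have "compact S" by (simp add: compact_eq_bounded_closed)
      moreover have "0 \<in> S" using t flow_0[OF fc] by (simp add: S_def)
      \<comment> \<open>The last time up to \<open>t\<close> at which the trajectory is at \<open>p\<close>: there its derivative \<open>v p\<close> is
        positive, so it would have to return to \<open>p\<close> once more before ending below \<open>p\<close>.\<close>
      ultimately obtain s where s: "s \<in> S" "\<And>s'. s' \<in> S \<Longrightarrow> s' \<le> s"
        using compact_attains_sup[of S] by blast
      have st: "0 \<le> s" "s < t" "?x s = p"
        using s(1) less by (auto simp: S_def less_le)
      have "(?x has_real_derivative v p) (at s within {0..})"
        using flow_has_derivative[OF fc st(1), of p] st(3) by simp
      moreover have "v p > 0" using vp False by simp
      ultimately obtain d where d: "d > 0" "\<And>h. h > 0 \<Longrightarrow> s + h \<in> {0..} \<Longrightarrow> h < d \<Longrightarrow> ?x s < ?x (s + h)"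
        using has_real_derivative_pos_inc_right by blast
      define h where "h = min (d/2) (t - s)"
      have h: "h > 0" "h < d" "s + h \<le> t" using d(1) st by (auto simp: h_def)
      have "p < ?x (s + h)" using d(2)[of h] h st by simp
      have "\<exists>s'\<ge>s+h. s' \<le> t \<and> ?x s' = p"
      proof (rule IVT2')
        show "?x t \<le> p" using less by simp
        show "p \<le> ?x (s + h)" using \<open>p < _\<close> by simp
        show "continuous_on {s+h..t} ?x" by (rule continuous_on_subset[OF cont]) (use st h in auto)
      qed (use h in auto)
      then obtain s' where "s' \<ge> s + h" "s' \<le> t" "?x s' = p" by blast
      then have "s' \<in> S" using st h by (simp add: S_def)
      then show False using s(2)[of s'] \<open>s' \<ge> s + h\<close> h by simp
    qed
  qed
  also have "\<dots> \<le> flow v t \<xi>" by (rule flow_mono[OF fc t p])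
  finally show ?thesis .
qed

text \<open>
The reflection of the line turns statements about motion to the right into statements about motion
to the left.
\<close>
lemma ode_solution_reflect:
  assumes "ode_solution v \<xi> x"
  shows "ode_solution (\<lambda>y. - v (- y)) (- \<xi>) (\<lambda>t. - x t)"
  using assms by (auto simp: ode_solution_def intro!: DERIV_minus)

lemma forward_complete_reflect:
  assumes fc: "forward_complete v"
  shows "forward_complete (\<lambda>y. - v (- y))"
  unfolding forward_complete_def
proof
  fix \<xi> :: real
  have "ode_solution (\<lambda>y. - v (- y)) \<xi> (\<lambda>t. - flow v t (- \<xi>))"
    using ode_solution_reflect[OF flow_solution[OF fc, of "- \<xi>"]] by simp
  moreover have "y t = - flow v t (- \<xi>)" if "ode_solution (\<lambda>y. - v (- y)) \<xi> y" "t \<ge> 0" for y t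
  proof -
    have "ode_solution v (- \<xi>) (\<lambda>t. - y t)" using ode_solution_reflect[OF that(1)] by simp
    from flow_eqI[OF fc this that(2)] show ?thesis by simp
  qed
  ultimately show "\<exists>x. ode_solution (\<lambda>y. - v (- y)) \<xi> x \<and>
      (\<forall>y. ode_solution (\<lambda>y. - v (- y)) \<xi> y \<longrightarrow> (\<forall>t\<ge>0. y t = x t))"
    by blast
qed

lemma flow_reflect:
  assumes fc: "forward_complete v" and t: "t \<ge> 0"
  shows "flow (\<lambda>y. - v (- y)) t (- \<xi>) = - flow v t \<xi>"
  by (rule flow_eqI[OF forward_complete_reflect[OF fc] ode_solution_reflect[OF flow_solution[OF fc]] t])

lemma flow_le:
  assumes fc: "forward_complete v" and vp: "v p \<le> 0" and t: "t \<ge> 0" and p: "\<xi> \<le> p"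
  shows "flow v t \<xi> \<le> p"
  using flow_ge[OF forward_complete_reflect[OF fc], of "- p" t "- \<xi>"] vp p t
    flow_reflect[OF fc t, of \<xi>] by simp

text \<open>
The flow is monotone, hence Borel, in the starting point, and continuous in time; a function with
these properties is the limit of its discretisations in time.
\<close>
lemma borel_measurable_flow:
  assumes fc: "forward_complete v"
  shows "(\<lambda>(t, \<xi>). flow v t \<xi>) \<in> borel_measurable (borel \<Otimes>\<^sub>M borel)"
proof -
  define g where "g = (\<lambda>p::real\<times>real. flow v (max 0 (fst p)) (snd p))"
  \<comment> \<open>The flow at the last multiple of \<open>1 / (n + 1)\<close> before \<open>t\<close>: only countably many times occur.\<close>
  define gn where "gn n = (\<lambda>p::real\<times>real. flow v (real (nat \<lfloor>real (Suc n) * max 0 (fst p)\<rfloor>) / real (Suc n)) (snd p))" for n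
  have mono: "(\<lambda>\<xi>. flow v t \<xi>) \<in> borel_measurable borel" if "t \<ge> 0" for t
    by (rule borel_measurable_mono) (auto simp: mono_def intro: flow_mono[OF fc that])
  have gn: "gn n \<in> borel_measurable (borel \<Otimes>\<^sub>M borel)" for n
    unfolding gn_def
    apply (rule measurable_compose_countable[where f="\<lambda>k p. flow v (real k / real (Suc n)) (snd p)"
          and g="\<lambda>p. nat \<lfloor>real (Suc n) * max 0 (fst p)\<rfloor>"])
    subgoal for k by (rule measurable_compose[OF measurable_snd mono]) simp
    subgoal by measurable
    done
  have lim: "(\<lambda>n. gn n p) \<longlonglongrightarrow> g p" for p
  proof -
    define t where "t = max 0 (fst p)"
    have t: "t \<ge> 0" by (simp add: t_def)
    define tn where "tn n = real (nat \<lfloor>real (Suc n) * t\<rfloor>) / real (Suc n)" for n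
    have "tn \<longlonglongrightarrow> t"
    proof (rule tendsto_sandwich)
      show "(\<lambda>n. t - 1 / real (Suc n)) \<longlonglongrightarrow> t"
        using tendsto_diff[OF tendsto_const LIMSEQ_Suc[OF lim_1_over_n[where 'a=real]], of t] by simp
      have fl: "real (nat \<lfloor>real (Suc n) * t\<rfloor>) = of_int \<lfloor>real (Suc n) * t\<rfloor>" for n
        using t by simp
      have tn_upper: "of_int \<lfloor>real (Suc n) * t\<rfloor> / real (Suc n) \<le> t" for n
        using of_int_floor_le[of "real (Suc n) * t"] by (simp add: pos_divide_le_eq mult.commute del: of_nat_Suc)
      have tn_lower: "t - 1 / real (Suc n) \<le> of_int \<lfloor>real (Suc n) * t\<rfloor> / real (Suc n)" for n
      proof -
        have "(real (Suc n) * t - 1) / real (Suc n) \<le> of_int \<lfloor>real (Suc n) * t\<rfloor> / real (Suc n)"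
          by (intro divide_right_mono) linarith+
        then show ?thesis by (simp add: diff_divide_distrib del: of_nat_Suc)
      qed
      show "\<forall>\<^sub>F n in sequentially. t - 1 / real (Suc n) \<le> tn n"
        unfolding tn_def fl
        by (intro always_eventually allI tn_lower)
      show "\<forall>\<^sub>F n in sequentially. tn n \<le> t"
        unfolding tn_def fl
        by (intro always_eventually allI tn_upper)
    qed auto
    moreover have "eventually (\<lambda>n. tn n \<in> {0..}) sequentially" by (simp add: tn_def)
    ultimately have "(\<lambda>n. flow v (tn n) (snd p)) \<longlonglongrightarrow> flow v t (snd p)"
      using continuous_on_tendsto_compose[OF continuous_on_flow[OF fc]] t by auto
    then show ?thesis by (simp add: gn_def g_def tn_def t_def)
  qed
  have g: "g \<in> borel_measurable (borel \<Otimes>\<^sub>M borel)"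
    by (rule borel_measurable_LIMSEQ_real[OF lim gn])
  have "(\<lambda>(t, \<xi>). flow v t \<xi>) = (\<lambda>p. if fst p < 0 then (THE y. True) else g p)"
    using flow_negative_time[OF fc] by (auto simp: g_def fun_eq_iff)
  also have "\<dots> \<in> borel_measurable (borel \<Otimes>\<^sub>M borel)"
    using g by measurable
  finally show ?thesis .
qed

section \<open>Measurability of the switching process\<close>
\<comment> \<open>Keeps the state space \<open>{1..N}\<close> in the form in which it is stated.\<close>
declare One_nat_def [simp del]

locale switching =
  fixes N :: nat and u :: "nat \<Rightarrow> real \<Rightarrow> real" and lam :: "nat \<Rightarrow> nat \<Rightarrow> real"
  assumes N_ge_2: "N \<ge> 2"
    and forward_complete_u: "\<And>i. i \<in> {1..N} \<Longrightarrow> forward_complete (u i)"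
    and lam_pos: "\<And>i j. i \<in> {1..N} \<Longrightarrow> j \<in> {1..N} \<Longrightarrow> i \<noteq> j \<Longrightarrow> lam i j > 0"
begin

abbreviation states :: "nat set" where "states \<equiv> {1..N}"
abbreviation rate :: "nat \<Rightarrow> real" where "rate i \<equiv> exit_rate N lam i"
abbreviation Q :: "sample measure" where "Q \<equiv> sample_space N lam"
abbreviation phase :: "(real \<times> nat) measure" where "phase \<equiv> borel \<Otimes>\<^sub>M count_space states"

lemma rate_pos: "i \<in> states \<Longrightarrow> rate i > 0"
proof -
  assume i: "i \<in> states"
  \<comment> \<open>Since \<open>N \<ge> 2\<close>, some state different from \<open>i\<close> contributes to the sum.\<close>
  have "(if i = 1 then 2 else 1) \<in> states - {i}" using N_ge_2 i by auto
  then show ?thesis unfolding exit_rate_def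
    by (intro sum_pos) (use i lam_pos in auto)
qed

abbreviation holding_law :: "nat \<Rightarrow> real measure" where
  "holding_law i \<equiv> density lborel (\<lambda>s. ennreal (exponential_density (rate i) s))"
abbreviation target_law :: "nat \<Rightarrow> nat measure" where
  "target_law i \<equiv> density (count_space states) (\<lambda>j. ennreal (if j = i then 0 else lam i j / rate i))"

lemma prob_space_holding_law: "i \<in> states \<Longrightarrow> prob_space (holding_law i)"
  by (rule prob_space_exponential_density[OF rate_pos])

lemma prob_space_target_law:
  assumes i: "i \<in> states"
  shows "prob_space (target_law i)"
proof
  have nn: "0 \<le> (if j = i then 0 else lam i j / rate i)" if "j \<in> states" for j
    using that rate_pos[OF i] lam_pos[OF i that] by (auto intro!: divide_nonneg_pos less_imp_le)
  have "emeasure (target_law i) (space (target_law i)) =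
      (\<Sum>j\<in>states. ennreal (if j = i then 0 else lam i j / rate i))"
    by (simp add: emeasure_density nn_integral_count_space_finite cong: nn_integral_cong)
  also have "\<dots> = ennreal (\<Sum>j\<in>states. if j = i then 0 else lam i j / rate i)"
    by (rule sum_ennreal) (use nn in auto)
  also have "(\<Sum>j\<in>states. if j = i then 0 else lam i j / rate i) = (\<Sum>j\<in>states - {i}. lam i j / rate i)"
    by (rule sum.mono_neutral_cong_right) auto
  also have "\<dots> = 1"
    using rate_pos[OF i] by (simp add: sum_divide_distrib[symmetric] exit_rate_def)
  finally show "emeasure (target_law i) (space (target_law i)) = 1" by simp
qed

lemma sets_jump_law: "sets (jump_law N lam i) = sets (borel \<Otimes>\<^sub>M count_space states)"
  unfolding jump_law_def by (intro sets_pair_measure_cong) auto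

lemma emeasure_jump_law:
  assumes i: "i \<in> states" and A: "A \<in> sets borel" and B: "B \<subseteq> states"
  shows "emeasure (jump_law N lam i) (A \<times> B) = emeasure (holding_law i) A * emeasure (target_law i) B"
proof -
  interpret T: prob_space "target_law i" by (rule prob_space_target_law[OF i])
  show ?thesis unfolding jump_law_def
    by (rule T.emeasure_pair_measure_Times) (use A B in auto)
qed

lemma prob_space_jump_law:
  assumes i: "i \<in> states"
  shows "prob_space (jump_law N lam i)"
proof -
  interpret H: prob_space "holding_law i" by (rule prob_space_holding_law[OF i])
  interpret T: prob_space "target_law i" by (rule prob_space_target_law[OF i])
  interpret pair_prob_space "holding_law i" "target_law i" ..
  show ?thesis unfolding jump_law_def by (rule prob_space_axioms)
qed

lemma prob_space_step: "prob_space (PiM states (jump_law N lam))"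
  by (rule prob_space_PiM) (rule prob_space_jump_law)

lemma prob_space_Q: "prob_space Q"
  unfolding sample_space_def by (rule prob_space_PiM) (rule prob_space_step)

sublocale Q: prob_space Q by (rule prob_space_Q)

lemma measurable_jump:
  assumes "j \<in> states"
  shows "(\<lambda>\<omega>. \<omega> k j) \<in> Q \<rightarrow>\<^sub>M jump_law N lam j"
  unfolding sample_space_def
  by (rule measurable_compose[where N="PiM states (jump_law N lam)"],
      rule measurable_component_singleton, simp, rule measurable_component_singleton, rule assms)

lemma measurable_jump_phase:
  assumes "j \<in> states"
  shows "(\<lambda>\<omega>. \<omega> k j) \<in> Q \<rightarrow>\<^sub>M phase"
  using measurable_jump[OF assms] by (simp add: sets_jump_law cong: measurable_cong_sets)

lemma measurable_fst_jump [measurable]: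
  "j \<in> states \<Longrightarrow> (\<lambda>\<omega>. fst (\<omega> k j)) \<in> borel_measurable Q"
  using measurable_compose[OF measurable_jump_phase measurable_fst] by simp

lemma measurable_snd_jump [measurable]:
  "j \<in> states \<Longrightarrow> (\<lambda>\<omega>. snd (\<omega> k j)) \<in> Q \<rightarrow>\<^sub>M count_space states"
  using measurable_compose[OF measurable_jump_phase measurable_snd] by simp

lemma distr_jump:
  assumes j: "j \<in> states"
  shows "distr Q (jump_law N lam j) (\<lambda>\<omega>. \<omega> k j) = jump_law N lam j"
proof -
  have "distr Q (jump_law N lam j) (\<lambda>\<omega>. \<omega> k j) =
      distr (distr Q (PiM states (jump_law N lam)) (\<lambda>\<omega>. \<omega> k)) (jump_law N lam j) (\<lambda>\<omega>. \<omega> j)"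
    using j by (subst distr_distr) (auto simp: sample_space_def o_def)
  also have "distr Q (PiM states (jump_law N lam)) (\<lambda>\<omega>. \<omega> k) = PiM states (jump_law N lam)"
    unfolding sample_space_def by (rule distr_PiM_component, rule prob_space_step, rule UNIV_I)
  also have "distr (PiM states (jump_law N lam)) (jump_law N lam j) (\<lambda>\<omega>. \<omega> j) = jump_law N lam j"
    by (rule distr_PiM_component) (use j prob_space_jump_law in auto)
  finally show ?thesis .
qed

text \<open>
Holding time and next state are independent, so an event about a single jump splits into two factors.
\<close>
lemma emeasure_jump_rectangle:
  assumes j: "j \<in> states" and A: "A \<in> sets borel" and B: "B \<subseteq> states"
  shows "emeasure Q {\<omega> \<in> space Q. fst (\<omega> k j) \<in> A \<and> snd (\<omega> k j) \<in> B}
    = emeasure (holding_law j) A * emeasure (target_law j) B"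
proof -
  have AB: "A \<times> B \<in> sets (jump_law N lam j)" using A B by (auto simp: sets_jump_law)
  have "emeasure Q {\<omega> \<in> space Q. fst (\<omega> k j) \<in> A \<and> snd (\<omega> k j) \<in> B}
      = emeasure (distr Q (jump_law N lam j) (\<lambda>\<omega>. \<omega> k j)) (A \<times> B)"
    using AB measurable_jump[OF j] by (subst emeasure_distr) (auto intro!: arg_cong[where f="emeasure Q"] simp: mem_Times_iff)
  then show ?thesis by (simp add: distr_jump[OF j] emeasure_jump_law[OF j A B])
qed

lemma snd_jump_in_states: "\<omega> \<in> space Q \<Longrightarrow> j \<in> states \<Longrightarrow> snd (\<omega> k j) \<in> states"
  using measurable_space[OF measurable_snd_jump, of j \<omega> k] by simp

lemma emeasure_holding_le:
  assumes "j \<in> states" "t \<ge> 0"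
  shows "emeasure (holding_law j) {..t} = ennreal (1 - exp (- rate j * t))"
  using emeasure_erlang_density[of "rate j" 0 t] rate_pos[OF assms(1)] assms(2)
  by (simp add: erlang_CDF_0)

text \<open>
The flow is only meaningful for nonnegative times, and along almost every sample point it is only
evaluated there.
\<close>
lemma AE_holding_time_nonneg: "AE \<omega> in Q. \<forall>k. \<forall>j\<in>states. 0 \<le> fst (\<omega> k j)"
  unfolding AE_all_countable
proof (intro allI AE_ball_countable')
  fix k j assume j: "j \<in> states"
  have "AE x in holding_law j. 0 \<le> x"
    by (subst AE_density) (auto simp: exponential_density_def)
  then have *: "emeasure (holding_law j) {..<0} = 0"
    by (subst (asm) AE_iff_measurable[of "{..<0}"]) auto
  have "emeasure Q {\<omega> \<in> space Q. fst (\<omega> k j) \<in> {..<0} \<and> snd (\<omega> k j) \<in> states} = 0"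
    by (subst emeasure_jump_rectangle[OF j]) (simp_all add: *)
  also have "{\<omega> \<in> space Q. fst (\<omega> k j) \<in> {..<0} \<and> snd (\<omega> k j) \<in> states} =
      {\<omega> \<in> space Q. \<not> 0 \<le> fst (\<omega> k j)}"
    using snd_jump_in_states[OF _ j] by auto
  finally have "emeasure Q {\<omega> \<in> space Q. \<not> 0 \<le> fst (\<omega> k j)} = 0" .
  moreover have "{\<omega> \<in> space Q. \<not> 0 \<le> fst (\<omega> k j)} \<in> sets Q"
    using j by measurable
  ultimately show "AE \<omega> in Q. 0 \<le> fst (\<omega> k j)"
    by (subst AE_iff_measurable[OF _ refl])
qed simp

lemma measurable_jump_state:
  assumes "i \<in> states"
  shows "(\<lambda>\<omega>. jump_state \<omega> i k) \<in> Q \<rightarrow>\<^sub>M count_space states"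
proof (induction k)
  case 0
  then show ?case using assms by simp
next
  case (Suc k)
  show ?case unfolding jump_state.simps
    by (rule measurable_compose_countable'[OF _ Suc]) (auto intro!: measurable_snd_jump)
qed

lemma measurable_holding_time [measurable]:
  assumes "i \<in> states"
  shows "(\<lambda>\<omega>. holding_time \<omega> i k) \<in> borel_measurable Q"
  unfolding holding_time_def
  by (rule measurable_compose_countable'[OF _ measurable_jump_state[OF assms]])
     (auto intro!: measurable_fst_jump)

lemma measurable_jump_time [measurable]:
  assumes "i \<in> states"
  shows "(\<lambda>\<omega>. jump_time \<omega> i k) \<in> borel_measurable Q"
  unfolding jump_time_def using assms by measurable

lemma measurable_num_jumps [measurable]:
  assumes [measurable]: "i \<in> states"
  shows "(\<lambda>\<omega>. num_jumps \<omega> i t) \<in> Q \<rightarrow>\<^sub>M count_space UNIV"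
  unfolding num_jumps_def by measurable

lemma measurable_flow_along:
  assumes i: "i \<in> states" and s: "s \<in> borel_measurable M" and x: "x \<in> borel_measurable M"
  shows "(\<lambda>\<omega>. flow (u i) (s \<omega>) (x \<omega>)) \<in> borel_measurable M"
  using measurable_compose[OF measurable_Pair[OF s x] borel_measurable_flow[OF forward_complete_u[OF i]]]
  by simp

lemma u_measurable:
  assumes j: "j \<in> states"
  shows "u j \<in> borel_measurable borel"
proof (rule borel_measurable_LIMSEQ_real)
  fix \<xi> :: real
  have "((\<lambda>y. (flow (u j) y \<xi> - flow (u j) 0 \<xi>) / (y - 0)) \<longlongrightarrow> u j \<xi>) (at 0 within {0..})"
    using flow_has_derivative[OF forward_complete_u[OF j], of 0 \<xi>]
    by (simp add: flow_0[OF forward_complete_u[OF j]] has_field_derivative_iff)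
  moreover have "filterlim (\<lambda>n. 1 / real (Suc n)) (at 0 within {0..}) sequentially"
    using LIMSEQ_Suc[OF lim_1_over_n[where 'a=real]] by (auto simp: filterlim_at)
  ultimately show "(\<lambda>n. (flow (u j) (1 / real (Suc n)) \<xi> - flow (u j) 0 \<xi>) / (1 / real (Suc n) - 0)) \<longlonglongrightarrow> u j \<xi>"
    by (rule filterlim_compose)
qed (use measurable_flow_along[OF j borel_measurable_const measurable_ident_sets[OF refl]] in measurable)
lemma measurable_flow_random:
  assumes j: "j \<in> M \<rightarrow>\<^sub>M count_space states" and s: "s \<in> borel_measurable M" and x: "x \<in> borel_measurable M"
  shows "(\<lambda>\<omega>. flow (u (j \<omega>)) (s \<omega>) (x \<omega>)) \<in> borel_measurable M"
  by (rule measurable_compose_countable'[OF _ j]) (auto intro!: measurable_flow_along s x)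

lemma measurable_jump_position:
  assumes i: "i \<in> states"
  shows "(\<lambda>(\<xi>, \<omega>). jump_position u \<omega> \<xi> i k) \<in> borel_measurable (borel \<Otimes>\<^sub>M Q)"
proof (induction k)
  case 0
  then show ?case by simp
next
  case (Suc k)
  have "(\<lambda>p. flow (u (jump_state (snd p) i k)) (holding_time (snd p) i k) (jump_position u (snd p) (fst p) i k))
    \<in> borel_measurable (borel \<Otimes>\<^sub>M Q)"
  proof (rule measurable_flow_random)
    show "(\<lambda>p. jump_state (snd p) i k) \<in> borel \<Otimes>\<^sub>M Q \<rightarrow>\<^sub>M count_space states"
      by (rule measurable_compose[OF measurable_snd measurable_jump_state[OF i]])
    show "(\<lambda>p. holding_time (snd p) i k) \<in> borel_measurable (borel \<Otimes>\<^sub>M Q)"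
      by (rule measurable_compose[OF measurable_snd measurable_holding_time[OF i]])
    show "(\<lambda>p. jump_position u (snd p) (fst p) i k) \<in> borel_measurable (borel \<Otimes>\<^sub>M Q)"
      using Suc by (simp add: case_prod_beta)
  qed
  then show ?case by (simp add: case_prod_beta)
qed

lemma measurable_switch_A:
  assumes i: "i \<in> states"
  shows "(\<lambda>\<omega>. switch_A \<omega> i t) \<in> Q \<rightarrow>\<^sub>M count_space states"
  unfolding switch_A_def
  by (rule measurable_compose_countable[OF measurable_jump_state[OF i] measurable_num_jumps[OF i]])

lemma measurable_switch_X:
  assumes i: "i \<in> states"
  shows "(\<lambda>(\<xi>, \<omega>). switch_X u \<omega> \<xi> i t) \<in> borel_measurable (borel \<Otimes>\<^sub>M Q)"
  unfolding switch_X_def Let_def case_prod_beta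
proof (rule measurable_compose_countable[OF measurable_flow_random])
  fix n
  show "(\<lambda>p. jump_state (snd p) i n) \<in> borel \<Otimes>\<^sub>M Q \<rightarrow>\<^sub>M count_space states"
    by (rule measurable_compose[OF measurable_snd measurable_jump_state[OF i]])
  show "(\<lambda>p. t - jump_time (snd p) i n) \<in> borel_measurable (borel \<Otimes>\<^sub>M Q)"
    using measurable_compose[OF measurable_snd measurable_jump_time[OF i]] by measurable
  show "(\<lambda>p. jump_position u (snd p) (fst p) i n) \<in> borel_measurable (borel \<Otimes>\<^sub>M Q)"
    using measurable_jump_position[OF i] by (simp add: case_prod_beta)
next
  show "(\<lambda>p. num_jumps (snd p) i t) \<in> borel \<Otimes>\<^sub>M Q \<rightarrow>\<^sub>M count_space UNIV"
    by (rule measurable_compose[OF measurable_snd measurable_num_jumps[OF i]])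
qed

text \<open>
The position and state at time \<open>t\<close> as one function of the initial pair and the sample point. The
joint measurability permits the use of Fubini's theorem for a random initial condition.
\<close>
definition process :: "real \<Rightarrow> (real \<times> nat) \<times> sample \<Rightarrow> real \<times> nat" where
  "process t = (\<lambda>((\<xi>, i), \<omega>). (switch_X u \<omega> \<xi> i t, switch_A \<omega> i t))"

lemma measurable_process: "process t \<in> phase \<Otimes>\<^sub>M Q \<rightarrow>\<^sub>M phase"
proof -
  have "(\<lambda>p. (switch_X u (snd p) (fst (fst p)) (snd (fst p)) t, switch_A (snd p) (snd (fst p)) t))
      \<in> phase \<Otimes>\<^sub>M Q \<rightarrow>\<^sub>M phase"
  proof (rule measurable_compose_countable'[where g="\<lambda>p. snd (fst p)" and I=states])
    fix i assume i: "i \<in> states"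
    have "(\<lambda>p. (fst (fst p), snd p)) \<in> phase \<Otimes>\<^sub>M Q \<rightarrow>\<^sub>M borel \<Otimes>\<^sub>M Q" by measurable
    from measurable_compose[OF this measurable_switch_X[OF i]]
    have "(\<lambda>p. switch_X u (snd p) (fst (fst p)) i t) \<in> borel_measurable (phase \<Otimes>\<^sub>M Q)"
      by simp
    moreover have "(\<lambda>p. switch_A (snd p) i t) \<in> phase \<Otimes>\<^sub>M Q \<rightarrow>\<^sub>M count_space states"
      by (rule measurable_compose[OF measurable_snd measurable_switch_A[OF i]])
    ultimately show "(\<lambda>p. (switch_X u (snd p) (fst (fst p)) i t, switch_A (snd p) i t))
      \<in> phase \<Otimes>\<^sub>M Q \<rightarrow>\<^sub>M phase" by (rule measurable_Pair)
  next
    show "(\<lambda>p. snd (fst p)) \<in> phase \<Otimes>\<^sub>M Q \<rightarrow>\<^sub>M count_space states"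
      by (rule measurable_compose[OF measurable_fst measurable_snd])
  qed simp
  then show ?thesis unfolding process_def case_prod_beta .
qed

lemma measurable_process_from:
  "i \<in> states \<Longrightarrow> (\<lambda>\<omega>. process t ((\<xi>, i), \<omega>)) \<in> Q \<rightarrow>\<^sub>M phase"
  by (rule measurable_compose[OF _ measurable_process]) (auto simp: space_pair_measure)

lemma transition_eq: "transition N u lam t \<xi> i = distr Q phase (\<lambda>\<omega>. process t ((\<xi>, i), \<omega>))"
  by (simp add: transition_def process_def)

section \<open>The process over a short time\<close>
lemma measure_holding_le:
  assumes "j \<in> states" "t \<ge> 0"
  shows "measure (holding_law j) {..t} = 1 - exp (- rate j * t)"
proof -
  have "0 \<le> 1 - exp (- rate j * t)"
    using rate_pos[OF assms(1)] assms(2) by simp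
  then show ?thesis
    using emeasure_holding_le[OF assms] by (simp add: measure_def)
qed

lemma measure_target:
  assumes j: "j \<in> states" and k: "k \<in> states"
  shows "measure (target_law j) {k} = (if k = j then 0 else lam j k / rate j)"
proof -
  have nn: "0 \<le> lam j k / rate j" if "k \<noteq> j"
    using that rate_pos[OF j] lam_pos[OF j k] by (auto intro!: divide_nonneg_pos less_imp_le)
  have "emeasure (target_law j) {k} = ennreal (if k = j then 0 else lam j k / rate j)"
    using k by (subst emeasure_density)
      (auto simp: nn_integral_count_space_finite indicator_def of_bool_def if_distrib[of "\<lambda>x. _ * x"] cong: if_cong)
  then show ?thesis using nn by (auto simp: measure_def)
qed

lemma measure_jump_rectangle:
  assumes j: "j \<in> states" and A: "A \<in> sets borel" and B: "B \<subseteq> states"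
  shows "measure Q {\<omega> \<in> space Q. fst (\<omega> k j) \<in> A \<and> snd (\<omega> k j) \<in> B}
    = measure (holding_law j) A * measure (target_law j) B"
  using emeasure_jump_rectangle[OF assms, of k] by (simp add: measure_def enn2real_mult)

lemma measure_first_jump_to:
  assumes j: "j \<in> states" and k: "k \<in> states" and t: "t \<ge> 0"
  shows "measure Q {\<omega> \<in> space Q. fst (\<omega> m j) \<le> t \<and> snd (\<omega> m j) = k}
    = (1 - exp (- rate j * t)) * (if k = j then 0 else lam j k / rate j)"
  using measure_jump_rectangle[OF j, of "{..t}" "{k}" m] k
  by (simp add: measure_holding_le[OF j t] measure_target[OF j k])

lemma measure_holding_time_le:
  assumes j: "j \<in> states" and t: "t \<ge> 0"
  shows "measure Q {\<omega> \<in> space Q. fst (\<omega> m j) \<le> t} = 1 - exp (- rate j * t)"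
proof -
  interpret T: prob_space "target_law j" by (rule prob_space_target_law[OF j])
  have "{\<omega> \<in> space Q. fst (\<omega> m j) \<le> t} = {\<omega> \<in> space Q. fst (\<omega> m j) \<in> {..t} \<and> snd (\<omega> m j) \<in> states}"
    using snd_jump_in_states[OF _ j] by auto
  then show ?thesis
    using measure_jump_rectangle[OF j, of "{..t}" "states" m] T.prob_space
    by (simp add: measure_holding_le[OF j t])
qed

lemma measure_holding_time_gt:
  assumes j: "j \<in> states" and t: "t \<ge> 0"
  shows "measure Q {\<omega> \<in> space Q. t < fst (\<omega> m j)} = exp (- rate j * t)"
proof -
  have "{\<omega> \<in> space Q. t < fst (\<omega> m j)} = space Q - {\<omega> \<in> space Q. fst (\<omega> m j) \<le> t}"
    by auto
  moreover have "{\<omega> \<in> space Q. fst (\<omega> m j) \<le> t} \<in> sets Q" using j by measurable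
  ultimately show ?thesis
    using Q.prob_compl[of "{\<omega> \<in> space Q. fst (\<omega> m j) \<le> t}"] measure_holding_time_le[OF j t, of m] by simp
qed

text \<open>
By independence of the steps, a second jump up to time \<open>t\<close> has a probability of order \<open>t\<^sup>2\<close>.
\<close>
lemma measure_two_short_holding_times:
  assumes j: "j \<in> states" and k: "k \<in> states" and t: "t \<ge> 0"
  shows "measure Q {\<omega> \<in> space Q. fst (\<omega> 0 j) \<le> t \<and> fst (\<omega> 1 k) \<le> t}
    = (1 - exp (- rate j * t)) * (1 - exp (- rate k * t))"
proof -
  define M where "M = PiM states (jump_law N lam)"
  interpret M: prob_space M unfolding M_def by (rule prob_space_step)
  define E where "E i = {h \<in> space M. fst (h i) \<le> t}" for i
  have ME: "E i \<in> sets M" if "i \<in> states" for i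
  proof -
    have "(\<lambda>h. h i) \<in> M \<rightarrow>\<^sub>M phase"
      using measurable_component_singleton[OF that, of "jump_law N lam"]
      by (simp add: M_def sets_jump_law cong: measurable_cong_sets)
    from measurable_compose[OF this measurable_fst] show ?thesis unfolding E_def by measurable
  qed
  have emb: "{\<omega> \<in> space Q. \<forall>m\<in>J. \<omega> m \<in> E (i m)} = prod_emb UNIV (\<lambda>_. M) J (Pi\<^sub>E J (\<lambda>m. E (i m)))" for J and i :: "nat \<Rightarrow> nat"
  proof -
    have "space Q = (\<Pi>\<^sub>E m\<in>UNIV. space M)" by (simp add: sample_space_def M_def space_PiM)
    then show ?thesis
      unfolding prod_emb_def vimage_def Int_def mem_Collect_eq restrict_PiE_iff
      by (intro Collect_cong) (simp only: conj_commute)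
  qed
  have prod: "measure Q {\<omega> \<in> space Q. \<forall>m\<in>J. \<omega> m \<in> E (i m)} = (\<Prod>m\<in>J. measure M (E (i m)))"
    if "finite J" "\<And>m. m \<in> J \<Longrightarrow> i m \<in> states" for J and i :: "nat \<Rightarrow> nat"
  proof -
    have "emeasure Q (prod_emb UNIV (\<lambda>_. M) J (Pi\<^sub>E J (\<lambda>m. E (i m)))) = (\<Prod>m\<in>J. emeasure M (E (i m)))"
      unfolding sample_space_def M_def[symmetric]
      by (rule emeasure_PiM_emb) (use that ME in \<open>auto simp: M_def intro: prob_space_step\<close>)
    then show ?thesis
      unfolding emb[symmetric] Q.emeasure_eq_measure M.emeasure_eq_measure
      by (simp add: prod_ennreal measure_nonneg prod_nonneg)
  qed
  have in_space: "\<omega> m \<in> space M" if "\<omega> \<in> space Q" for \<omega> m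
    using that by (auto simp: sample_space_def M_def space_PiM)
  have single: "measure M (E i) = 1 - exp (- rate i * t)" if i: "i \<in> states" for i
  proof -
    have "{\<omega> \<in> space Q. \<forall>m\<in>{0::nat}. \<omega> m \<in> E i} = {\<omega> \<in> space Q. fst (\<omega> 0 i) \<le> t}"
      using in_space by (auto simp: E_def)
    then show ?thesis using prod[of "{0}" "\<lambda>_. i"] measure_holding_time_le[OF i t, of 0] i by simp
  qed
  let ?i = "\<lambda>m::nat. if m = 0 then j else k"
  have "{\<omega> \<in> space Q. \<forall>m\<in>{0::nat,1}. \<omega> m \<in> E (?i m)} =
      {\<omega> \<in> space Q. fst (\<omega> 0 j) \<le> t \<and> fst (\<omega> 1 k) \<le> t}"
    using in_space by (auto simp: E_def)
  then show ?thesis using prod[of "{0,1}" ?i] j k single[OF j] single[OF k] by simp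
qed

lemma along_flow_Lipschitz:
  assumes j: "j \<in> states"
    and g: "\<And>x. (g has_real_derivative g' x) (at x)" "\<And>x. \<bar>u j x * g' x\<bar> \<le> C" and t: "t \<ge> 0"
  shows "\<bar>g (flow (u j) t \<xi>) - g \<xi>\<bar> \<le> C * t"
proof -
  have "norm (g (flow (u j) t \<xi>) - g (flow (u j) 0 \<xi>)) \<le> C * norm (t - 0)"
  proof (rule field_differentiable_bound[where S="{0..}" and f="\<lambda>s. g (flow (u j) s \<xi>)"])
    fix s :: real assume "s \<in> {0..}"
    then have "((\<lambda>s. flow (u j) s \<xi>) has_real_derivative u j (flow (u j) s \<xi>)) (at s within {0..})"
      using flow_has_derivative[OF forward_complete_u[OF j]] by simp
    from DERIV_chain2[OF g(1) this]
    show "((\<lambda>s. g (flow (u j) s \<xi>)) has_real_derivative g' (flow (u j) s \<xi>) * u j (flow (u j) s \<xi>)) (at s within {0..})" .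
    show "norm (g' (flow (u j) s \<xi>) * u j (flow (u j) s \<xi>)) \<le> C"
      using g(2) by (simp add: mult.commute)
  qed (use t in auto)
  then show ?thesis using t flow_0[OF forward_complete_u[OF j]] by simp
qed

definition total_rate :: real where "total_rate = (\<Sum>k\<in>states. rate k)"

lemma rate_le_total: "j \<in> states \<Longrightarrow> rate j \<le> total_rate"
  unfolding total_rate_def by (rule member_le_sum) (auto intro!: less_imp_le[OF rate_pos])

lemma total_rate_nonneg: "0 \<le> total_rate"
  unfolding total_rate_def by (rule sum_nonneg) (auto intro!: less_imp_le[OF rate_pos])

lemma num_jumps_0: "t < fst (\<omega> 0 i) \<Longrightarrow> num_jumps \<omega> i t = 0"
  unfolding num_jumps_def by (rule Least_equality) (auto simp: jump_time_def holding_time_def)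

lemma num_jumps_1:
  assumes "fst (\<omega> 0 i) \<le> t" "t < fst (\<omega> 0 i) + fst (\<omega> 1 (snd (\<omega> 0 i)))"
  shows "num_jumps \<omega> i t = 1"
  unfolding num_jumps_def
proof (rule Least_equality)
  show "t < jump_time \<omega> i (Suc 1)" using assms by (simp add: jump_time_def holding_time_def One_nat_def)
  fix y assume "t < jump_time \<omega> i (Suc y)"
  then show "1 \<le> y" using assms(1) by (cases y) (auto simp: jump_time_def holding_time_def)
qed

end

lemma one_minus_exp_le: "1 - exp (- x) \<le> (x::real)"
  using exp_ge_add_one_self[of "- x"] by simp
text \<open>
Bounded observables whose derivative along each of the fields is bounded. Their values change by at
most \<open>C * t\<close> along any flow over time \<open>t\<close>, uniformly in the starting point.
\<close>
locale test_functions = switching +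
  fixes f f' :: "nat \<Rightarrow> real \<Rightarrow> real" and B C :: real
  assumes f_deriv: "\<And>k x. k \<in> {1..N} \<Longrightarrow> (f k has_real_derivative f' k x) (at x)"
    and f_bound: "\<And>k x. k \<in> {1..N} \<Longrightarrow> \<bar>f k x\<bar> \<le> B"
    and f'_bound: "\<And>j k x. j \<in> {1..N} \<Longrightarrow> k \<in> {1..N} \<Longrightarrow> \<bar>u j x * f' k x\<bar> \<le> C"
begin

lemma B_nonneg: "0 \<le> B" and C_nonneg: "0 \<le> C"
  using f_bound[of 1 0] f'_bound[of 1 1 0] N_ge_2 by auto

lemma f_measurable [measurable]: "k \<in> states \<Longrightarrow> f k \<in> borel_measurable borel"
  by (rule borel_measurable_continuous_onI, rule DERIV_continuous_on, rule f_deriv)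

abbreviation observable :: "real \<times> nat \<Rightarrow> real" where
  "observable p \<equiv> f (snd p) (fst p)"

lemma measurable_observable: "observable \<in> borel_measurable phase"
  by (rule measurable_compose_countable'[where I=states and f="\<lambda>k p. f k (fst p)"])
     (simp_all add: measurable_compose[OF measurable_fst f_measurable])

text \<open>
The expectation when at most one jump is taken into account and, if it happens, the motion is
neglected.
\<close>
definition one_jump_value :: "real \<Rightarrow> real \<Rightarrow> nat \<Rightarrow> real" where
  "one_jump_value t \<xi> j = exp (- rate j * t) * f j (flow (u j) t \<xi>) +
     (\<Sum>k\<in>states - {j}. (1 - exp (- rate j * t)) * (lam j k / rate j) * f k \<xi>)"

lemma f_along_flow:
  "j \<in> states \<Longrightarrow> k \<in> states \<Longrightarrow> t \<ge> 0 \<Longrightarrow> \<bar>f k (flow (u j) t \<xi>) - f k \<xi>\<bar> \<le> C * t"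
  by (rule along_flow_Lipschitz[where g="f k" and g'="f' k"]) (simp_all add: f_deriv f'_bound)

lemma process_close_to_one_jump:
  assumes j: "j \<in> states" and t: "t \<ge> 0" and \<omega>: "\<omega> \<in> space Q"
    and nn: "\<forall>k. \<forall>j\<in>states. 0 \<le> fst (\<omega> k j)"
  shows "\<bar>observable (process t ((\<xi>, j), \<omega>)) - (if t < fst (\<omega> 0 j) then f j (flow (u j) t \<xi>) else f (snd (\<omega> 0 j)) \<xi>)\<bar>
    \<le> C * t * of_bool (fst (\<omega> 0 j) \<le> t) + (\<Sum>k\<in>states. 2 * B * of_bool (fst (\<omega> 0 j) \<le> t \<and> fst (\<omega> 1 k) \<le> t))"
    (is "\<bar>?\<phi> - ?z\<bar> \<le> ?a + ?b")
proof -
  define T where "T = fst (\<omega> 0 j)"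
  define k where "k = snd (\<omega> 0 j)"
  have k: "k \<in> states" unfolding k_def by (rule snd_jump_in_states[OF \<omega> j])
  have T: "T \<ge> 0" unfolding T_def using nn j by blast
  have a: "0 \<le> ?a" using C_nonneg t by simp
  have b: "0 \<le> ?b" using B_nonneg by (intro sum_nonneg) auto
  \<comment> \<open>No jump up to time \<open>t\<close>; exactly one jump; at least two jumps.\<close>
  consider "t < T" | "T \<le> t" "t < T + fst (\<omega> 1 k)" | "T \<le> t" "T + fst (\<omega> 1 k) \<le> t" by linarith
  then show ?thesis
  proof cases
    case 1
    then have "num_jumps \<omega> j t = 0" unfolding T_def by (rule num_jumps_0)
    then have "?\<phi> = f j (flow (u j) t \<xi>)"
      by (simp add: process_def switch_X_def switch_A_def jump_time_def)
    then show ?thesis using 1 a b unfolding T_def by simp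
  next
    case 2
    then have "num_jumps \<omega> j t = 1" unfolding T_def k_def by (rule num_jumps_1)
    then have "?\<phi> = f k (flow (u k) (t - T) (flow (u j) T \<xi>))"
      by (simp add: process_def switch_X_def switch_A_def jump_time_def holding_time_def T_def k_def One_nat_def)
    moreover have "\<bar>f k (flow (u k) (t - T) (flow (u j) T \<xi>)) - f k (flow (u j) T \<xi>)\<bar> \<le> C * (t - T)"
      using 2 by (intro f_along_flow k) simp
    moreover have "C * (t - T) = C * t - C * T" by (rule right_diff_distrib)
    moreover have "\<bar>f k (flow (u j) T \<xi>) - f k \<xi>\<bar> \<le> C * T"
      by (intro f_along_flow j k T)
    moreover have "?z = f k \<xi>" using 2 unfolding T_def k_def by simp
    moreover have "?a = C * t" using 2 unfolding T_def by simp
    ultimately show ?thesis using b by linarith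
  next
    case 3
    then have "fst (\<omega> 1 k) \<le> t" using T by linarith
    then have "2 * B \<le> ?b"
      using member_le_sum[of k states "\<lambda>k. 2 * B * of_bool (fst (\<omega> 0 j) \<le> t \<and> fst (\<omega> 1 k) \<le> t)"] k B_nonneg 3(1)
      by (simp add: T_def)
    moreover have "snd (process t ((\<xi>, j), \<omega>)) \<in> states"
      using measurable_space[OF measurable_process_from[OF j] \<omega>, of t \<xi>] by (simp add: space_pair_measure mem_Times_iff)
    then have "\<bar>?\<phi>\<bar> \<le> B" by (rule f_bound)
    moreover have "\<bar>?z\<bar> \<le> B" using f_bound j k unfolding k_def by simp
    ultimately show ?thesis using a by linarith
  qed
qed

text \<open>
The constant depends neither on the starting point nor on the state, so that the estimate can be
integrated against \<open>\<mu>\<close>, and the quadratic error disappears after division by \<open>t\<close>.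
\<close>
lemma short_time_expansion:
  assumes j: "j \<in> states" and t: "t \<ge> 0"
  shows "\<bar>(\<integral>\<omega>. observable (process t ((\<xi>, j), \<omega>)) \<partial>Q) - one_jump_value t \<xi> j\<bar>
    \<le> (C * total_rate + 2 * B * total_rate\<^sup>2) * t\<^sup>2"
proof -
  define \<phi> where "\<phi> \<omega> = observable (process t ((\<xi>, j), \<omega>))" for \<omega>
  \<comment> \<open>\<open>z\<close> is the value of the observable when at most one jump happens and the motion after that jump
    is neglected; \<open>e\<close> bounds the resulting error: \<open>C * t\<close> for the neglected motion, and \<open>2 * B\<close> when
    a second jump happens before \<open>t\<close>.\<close>
  define z where "z \<omega> = f j (flow (u j) t \<xi>) * indicator {\<omega> \<in> space Q. t < fst (\<omega> 0 j)} \<omega>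
      + (\<Sum>k\<in>states. f k \<xi> * indicator {\<omega> \<in> space Q. fst (\<omega> 0 j) \<le> t \<and> snd (\<omega> 0 j) = k} \<omega>)" for \<omega>
  define e where "e \<omega> = C * t * indicator {\<omega> \<in> space Q. fst (\<omega> 0 j) \<le> t} \<omega>
      + (\<Sum>k\<in>states. 2 * B * indicator {\<omega> \<in> space Q. fst (\<omega> 0 j) \<le> t \<and> fst (\<omega> 1 k) \<le> t} \<omega>)" for \<omega>
  have ms: "{\<omega> \<in> space Q. t < fst (\<omega> 0 j)} \<in> sets Q"
     "{\<omega> \<in> space Q. fst (\<omega> 0 j) \<le> t} \<in> sets Q" using j by measurable
  have ms2: "{\<omega> \<in> space Q. fst (\<omega> 0 j) \<le> t \<and> fst (\<omega> 1 k) \<le> t} \<in> sets Q" if "k \<in> states" for k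
    using j that by measurable
  have ms3: "{\<omega> \<in> space Q. fst (\<omega> 0 j) \<le> t \<and> snd (\<omega> 0 j) = k} \<in> sets Q" if "k \<in> states" for k
  proof -
    have "{\<omega> \<in> space Q. snd (\<omega> 0 j) = k} \<in> sets Q"
      using measurable_sets[OF measurable_snd_jump[OF j, of 0], of "{k}"] that
      by (simp add: vimage_def Int_def conj_commute)
    from sets.sets_Collect_conj[OF this ms(2)] show ?thesis .
  qed
  have ind: "integrable Q (\<lambda>\<omega>. c * indicator A \<omega> :: real)" if "A \<in> sets Q" for A c
    using that by (intro integrable_mult_right integrable_real_indicator) (simp_all add: Q.emeasure_eq_measure)
  have z1: "integrable Q (\<lambda>\<omega>. f j (flow (u j) t \<xi>) * indicator {\<omega> \<in> space Q. t < fst (\<omega> 0 j)} \<omega>)"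
    by (rule ind[OF ms(1)])
  have z2: "integrable Q (\<lambda>\<omega>. f k \<xi> * indicator {\<omega> \<in> space Q. fst (\<omega> 0 j) \<le> t \<and> snd (\<omega> 0 j) = k} \<omega>)"
    if "k \<in> states" for k by (rule ind[OF ms3[OF that]])
  have e1: "integrable Q (\<lambda>\<omega>. C * t * indicator {\<omega> \<in> space Q. fst (\<omega> 0 j) \<le> t} \<omega>)"
    by (rule ind[OF ms(2)])
  have e2: "integrable Q (\<lambda>\<omega>. 2 * B * indicator {\<omega> \<in> space Q. fst (\<omega> 0 j) \<le> t \<and> fst (\<omega> 1 k) \<le> t} \<omega>)"
    if "k \<in> states" for k by (rule ind[OF ms2[OF that]])
  have zi: "integrable Q z" unfolding z_def
    by (rule Bochner_Integration.integrable_add[OF z1 Bochner_Integration.integrable_sum]) (rule z2)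
  have ei: "integrable Q e" unfolding e_def
    by (rule Bochner_Integration.integrable_add[OF e1 Bochner_Integration.integrable_sum]) (rule e2)
  have int_ind: "(\<integral>\<omega>. c * indicator A \<omega> \<partial>Q) = c * measure Q A" if "A \<in> sets Q" for A and c :: real
    using that by simp
  have \<phi>m: "\<phi> \<in> borel_measurable Q"
    unfolding \<phi>_def by (rule measurable_compose[OF measurable_process_from[OF j] measurable_observable])
  have z_eq: "z \<omega> = (if t < fst (\<omega> 0 j) then f j (flow (u j) t \<xi>) else f (snd (\<omega> 0 j)) \<xi>)"
    if "\<omega> \<in> space Q" for \<omega>
    using that snd_jump_in_states[OF that j, of 0]
    by (auto simp: z_def indicator_def of_bool_def if_distrib[of "\<lambda>x. _ * x"] cong: if_cong)
  have e_eq: "e \<omega> = C * t * of_bool (fst (\<omega> 0 j) \<le> t) + (\<Sum>k\<in>states. 2 * B * of_bool (fst (\<omega> 0 j) \<le> t \<and> fst (\<omega> 1 k) \<le> t))"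
    if "\<omega> \<in> space Q" for \<omega>
    using that by (auto simp: e_def indicator_def)
  have ae: "AE \<omega> in Q. \<bar>\<phi> \<omega> - z \<omega>\<bar> \<le> e \<omega>"
    using AE_holding_time_nonneg AE_space
  proof eventually_elim
    case (elim \<omega>)
    then show ?case
      unfolding z_eq[OF elim(2)] e_eq[OF elim(2)] \<phi>_def
      by (intro process_close_to_one_jump j t) auto
  qed
  have di: "integrable Q (\<lambda>\<omega>. \<phi> \<omega> - z \<omega>)"
  proof (rule Bochner_Integration.integrable_bound[OF ei])
    show "(\<lambda>\<omega>. \<phi> \<omega> - z \<omega>) \<in> borel_measurable Q"
      by (rule borel_measurable_diff[OF \<phi>m borel_measurable_integrable[OF zi]])
    show "AE \<omega> in Q. norm (\<phi> \<omega> - z \<omega>) \<le> norm (e \<omega>)"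
      using ae by eventually_elim simp
  qed
  have \<phi>i: "integrable Q \<phi>"
    using Bochner_Integration.integrable_add[OF di zi] by simp
  have Ez: "(\<integral>\<omega>. z \<omega> \<partial>Q) = one_jump_value t \<xi> j"
  proof -
    have "(\<integral>\<omega>. z \<omega> \<partial>Q) = f j (flow (u j) t \<xi>) * measure Q {\<omega> \<in> space Q. t < fst (\<omega> 0 j)}
      + (\<Sum>k\<in>states. f k \<xi> * measure Q {\<omega> \<in> space Q. fst (\<omega> 0 j) \<le> t \<and> snd (\<omega> 0 j) = k})"
      unfolding z_def
      by (subst Bochner_Integration.integral_add[OF z1 Bochner_Integration.integrable_sum[OF z2]], assumption,
          subst Bochner_Integration.integral_sum[OF z2], assumption,
          simp only: int_ind[OF ms(1)] int_ind[OF ms3] cong: sum.cong)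
    also have "(\<Sum>k\<in>states. f k \<xi> * measure Q {\<omega> \<in> space Q. fst (\<omega> 0 j) \<le> t \<and> snd (\<omega> 0 j) = k})
        = (\<Sum>k\<in>states - {j}. (1 - exp (- rate j * t)) * (lam j k / rate j) * f k \<xi>)"
      by (rule sum.mono_neutral_cong_right) (auto simp: measure_first_jump_to[OF j _ t])
    also have "f j (flow (u j) t \<xi>) * measure Q {\<omega> \<in> space Q. t < fst (\<omega> 0 j)} + \<dots> = one_jump_value t \<xi> j"
      by (simp add: one_jump_value_def measure_holding_time_gt[OF j t] mult.commute)
    finally show ?thesis .
  qed
  have Ee: "(\<integral>\<omega>. e \<omega> \<partial>Q) \<le> (C * total_rate + 2 * B * total_rate\<^sup>2) * t\<^sup>2"
  proof -
    have "(\<integral>\<omega>. e \<omega> \<partial>Q) = C * t * measure Q {\<omega> \<in> space Q. fst (\<omega> 0 j) \<le> t}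
      + (\<Sum>k\<in>states. 2 * B * measure Q {\<omega> \<in> space Q. fst (\<omega> 0 j) \<le> t \<and> fst (\<omega> 1 k) \<le> t})"
      unfolding e_def
      by (subst Bochner_Integration.integral_add[OF e1 Bochner_Integration.integrable_sum[OF e2]], assumption,
          subst Bochner_Integration.integral_sum[OF e2], assumption,
          simp only: int_ind[OF ms(2)] int_ind[OF ms2] cong: sum.cong)
    also have "\<dots> \<le> C * t * (total_rate * t) + (\<Sum>k\<in>states. 2 * B * ((total_rate * t) * (rate k * t)))"
    proof (intro add_mono sum_mono mult_left_mono)
      have r: "1 - exp (- rate i * t) \<le> rate i * t" for i
        using one_minus_exp_le[of "rate i * t"] by simp
      have rj: "1 - exp (- rate j * t) \<le> total_rate * t"
        using r[of j] mult_right_mono[OF rate_le_total[OF j] t] by linarith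
      show "measure Q {\<omega> \<in> space Q. fst (\<omega> 0 j) \<le> t} \<le> total_rate * t"
        using rj by (simp add: measure_holding_time_le[OF j t])
      fix k assume k: "k \<in> states"
      show "measure Q {\<omega> \<in> space Q. fst (\<omega> 0 j) \<le> t \<and> fst (\<omega> 1 k) \<le> t} \<le> (total_rate * t) * (rate k * t)"
        unfolding measure_two_short_holding_times[OF j k t]
        using rate_pos[OF k] t total_rate_nonneg by (intro mult_mono rj r) simp_all
    qed (use B_nonneg C_nonneg t in auto)
    also have "\<dots> = (C * total_rate + 2 * B * total_rate\<^sup>2) * t\<^sup>2"
      by (simp add: total_rate_def sum_distrib_left[symmetric] sum_distrib_right[symmetric] algebra_simps power2_eq_square)
    finally show ?thesis .
  qed
  have "\<bar>(\<integral>\<omega>. \<phi> \<omega> \<partial>Q) - (\<integral>\<omega>. z \<omega> \<partial>Q)\<bar> = \<bar>\<integral>\<omega>. \<phi> \<omega> - z \<omega> \<partial>Q\<bar>"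
    using \<phi>i zi by simp
  also have "\<dots> \<le> (\<integral>\<omega>. \<bar>\<phi> \<omega> - z \<omega>\<bar> \<partial>Q)" by (rule integral_abs_bound)
  also have "\<dots> \<le> (\<integral>\<omega>. e \<omega> \<partial>Q)"
    by (rule integral_mono_AE[OF integrable_abs[OF di] ei ae])
  also note Ee
  finally show ?thesis unfolding Ez \<phi>_def .
qed

end

section \<open>The stationary equation in weak form\<close>
locale stationary_switching = switching +
  fixes \<mu> :: "(real \<times> nat) measure" and \<rho> :: "nat \<Rightarrow> real \<Rightarrow> real"
  assumes invariant: "invariant_measure N u lam \<mu>"
    and density: "\<And>i. i \<in> {1..N} \<Longrightarrow> invariant_density \<mu> i (\<rho> i)"
begin

sublocale \<mu>: prob_space \<mu>
  using invariant by (simp add: invariant_measure_def)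

lemma sets_\<mu>: "sets \<mu> = sets phase"
  using invariant by (simp add: invariant_measure_def)

lemma space_\<mu>: "space \<mu> = UNIV \<times> states"
  using sets_eq_imp_space_eq[OF sets_\<mu>] by (simp add: space_pair_measure)

lemma measurable_\<mu>: "borel_measurable \<mu> = borel_measurable phase" "\<mu> \<rightarrow>\<^sub>M M = phase \<rightarrow>\<^sub>M M"
  by (simp_all add: sets_\<mu> cong: measurable_cong_sets)

lemma slice_sets: "i \<in> states \<Longrightarrow> UNIV \<times> {i} \<in> sets \<mu>"
  by (auto simp: sets_\<mu>)

lemma measurable_slice:
  assumes "g \<in> phase \<rightarrow>\<^sub>M M" "i \<in> states"
  shows "(\<lambda>\<xi>. g (\<xi>, i)) \<in> borel \<rightarrow>\<^sub>M M"
  by (rule measurable_compose[OF _ assms(1)]) (use assms(2) in \<open>auto simp: space_pair_measure\<close>)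

lemma measurable_fst_slice: "fst \<in> restrict_space \<mu> (UNIV \<times> {i}) \<rightarrow>\<^sub>M borel"
  by (rule measurable_restrict_space1) (simp add: measurable_\<mu>)

lemma nn_integral_component:
  assumes g: "g \<in> borel_measurable phase"
  shows "(\<Sum>j\<in>states. \<integral>\<^sup>+\<xi>. g (\<xi>, j) \<partial>component \<mu> j) = (\<integral>\<^sup>+p. g p \<partial>\<mu>)"
proof -
  have gj: "(\<lambda>p. g (fst p, j)) \<in> borel_measurable \<mu>" if "j \<in> states" for j
    using measurable_compose[OF measurable_fst measurable_slice[OF g that]] by (simp add: measurable_\<mu>)
  have comp: "(\<integral>\<^sup>+\<xi>. g (\<xi>, j) \<partial>component \<mu> j) = (\<integral>\<^sup>+p. g (fst p, j) * indicator (UNIV \<times> {j}) p \<partial>\<mu>)"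
    if j: "j \<in> states" for j
  proof -
    have "(\<integral>\<^sup>+\<xi>. g (\<xi>, j) \<partial>component \<mu> j) = (\<integral>\<^sup>+p. g (fst p, j) \<partial>restrict_space \<mu> (UNIV \<times> {j}))"
      unfolding component_def
      by (rule nn_integral_distr[OF measurable_fst_slice]) (simp add: measurable_slice[OF g j])
    also have "\<dots> = (\<integral>\<^sup>+p. g (fst p, j) * indicator (UNIV \<times> {j}) p \<partial>\<mu>)"
      by (rule nn_integral_restrict_space) (use slice_sets[OF j] in \<open>auto simp: sets.Int\<close>)
    finally show ?thesis .
  qed
  have "(\<Sum>j\<in>states. \<integral>\<^sup>+\<xi>. g (\<xi>, j) \<partial>component \<mu> j) =
      (\<Sum>j\<in>states. \<integral>\<^sup>+p. g (fst p, j) * indicator (UNIV \<times> {j}) p \<partial>\<mu>)"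
    by (rule sum.cong[OF refl comp])
  also have "\<dots> = (\<integral>\<^sup>+p. (\<Sum>j\<in>states. g (fst p, j) * indicator (UNIV \<times> {j}) p) \<partial>\<mu>)"
    by (rule nn_integral_sum[symmetric])
       (intro borel_measurable_times_ennreal gj borel_measurable_indicator slice_sets)
  also have "\<dots> = (\<integral>\<^sup>+p. g p \<partial>\<mu>)"
  proof (rule nn_integral_cong)
    fix p assume "p \<in> space \<mu>"
    then obtain \<xi> i where p: "p = (\<xi>, i)" "i \<in> states" by (auto simp: space_\<mu>)
    have "(\<Sum>j\<in>states. g (fst p, j) * indicator (UNIV \<times> {j}) p) = (\<Sum>j\<in>states. if j = i then g (\<xi>, i) else 0)"
      by (rule sum.cong) (auto simp: p(1))
    then show "(\<Sum>j\<in>states. g (fst p, j) * indicator (UNIV \<times> {j}) p) = g p"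
      using p by simp
  qed
  finally show ?thesis .
qed

text \<open>
Every event is the disjoint union of its slices over the finitely many states, so a measure is
determined by its values on rectangles \<open>E \<times> {i}\<close>.
\<close>
lemma emeasure_phase_slices:
  assumes s: "sets \<nu> = sets phase" and A: "A \<in> sets phase"
  shows "emeasure \<nu> A = (\<Sum>i\<in>states. emeasure \<nu> (((\<lambda>x. (x, i)) -` A) \<times> {i}))"
    and "i \<in> states \<Longrightarrow> (\<lambda>x. (x, i)) -` A \<in> sets borel"
proof -
  show slice: "(\<lambda>x. (x, i)) -` A \<in> sets borel" if "i \<in> states" for i
    using measurable_sets[OF measurable_slice[OF measurable_ident that], of A] A by simp
  have "(\<Union>i\<in>states. ((\<lambda>x. (x, i)) -` A) \<times> {i}) = A"
    using sets.sets_into_space[OF A] by (auto simp: space_pair_measure)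
  moreover have "(\<Sum>i\<in>states. emeasure \<nu> (((\<lambda>x. (x, i)) -` A) \<times> {i})) =
      emeasure \<nu> (\<Union>i\<in>states. ((\<lambda>x. (x, i)) -` A) \<times> {i})"
    by (rule sum_emeasure) (use slice s in \<open>auto simp: disjoint_family_on_def\<close>)
  ultimately show "emeasure \<nu> A = (\<Sum>i\<in>states. emeasure \<nu> (((\<lambda>x. (x, i)) -` A) \<times> {i}))" by simp
qed

text \<open>
Invariance in terms of random variables: starting the process with law \<open>\<mu>\<close>, its law at time \<open>t\<close> is \<open>\<mu>\<close>
again.
\<close>
lemma distr_process:
  assumes t: "t \<ge> 0"
  shows "distr (\<mu> \<Otimes>\<^sub>M Q) phase (process t) = \<mu>"
proof (rule measure_eqI)
  let ?\<nu> = "distr (\<mu> \<Otimes>\<^sub>M Q) phase (process t)"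
  have mp: "process t \<in> \<mu> \<Otimes>\<^sub>M Q \<rightarrow>\<^sub>M phase"
    using measurable_process by (simp add: sets_\<mu> cong: measurable_cong_sets sets_pair_measure_cong)
  show "sets ?\<nu> = sets \<mu>" by (simp add: sets_\<mu>)
  have rect: "emeasure ?\<nu> (E \<times> {i}) = emeasure \<mu> (E \<times> {i})" if E: "E \<in> sets borel" and i: "i \<in> states" for E i
  proof -
    let ?X = "process t -` (E \<times> {i}) \<inter> space (\<mu> \<Otimes>\<^sub>M Q)"
    have Ei: "E \<times> {i} \<in> sets phase" using E i by auto
    have X: "?X \<in> sets (\<mu> \<Otimes>\<^sub>M Q)" by (rule measurable_sets[OF mp Ei])
    have tr: "emeasure (transition N u lam t \<xi> j) (E \<times> {i}) = emeasure Q (Pair (\<xi>, j) -` ?X)" if j: "j \<in> states" for \<xi> j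
      unfolding transition_eq using measurable_process_from[OF j] Ei j
      by (subst emeasure_distr) (auto intro!: arg_cong[where f="emeasure Q"] simp: space_pair_measure space_\<mu>)
    have "emeasure ?\<nu> (E \<times> {i}) = (\<integral>\<^sup>+p. emeasure Q (Pair p -` ?X) \<partial>\<mu>)"
      using mp Ei by (simp add: emeasure_distr Q.emeasure_pair_measure_alt[OF X])
    also have "\<dots> = (\<Sum>j\<in>states. \<integral>\<^sup>+\<xi>. emeasure Q (Pair (\<xi>, j) -` ?X) \<partial>component \<mu> j)"
      by (rule nn_integral_component[symmetric])
         (use Q.measurable_emeasure_Pair[OF X] in \<open>simp add: measurable_\<mu>\<close>)
    also have "\<dots> = (\<Sum>j\<in>states. \<integral>\<^sup>+\<xi>. emeasure (transition N u lam t \<xi> j) (E \<times> {i}) \<partial>component \<mu> j)"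
      by (intro sum.cong refl nn_integral_cong tr[symmetric])
    also have "\<dots> = emeasure \<mu> (E \<times> {i})"
      using invariant t E i unfolding invariant_measure_def by simp
    finally show ?thesis .
  qed
  fix A assume "A \<in> sets ?\<nu>"
  then have A: "A \<in> sets phase" by simp
  show "emeasure ?\<nu> A = emeasure \<mu> A"
    unfolding emeasure_phase_slices(1)[OF sets_distr A] emeasure_phase_slices(1)[OF sets_\<mu> A]
    by (intro sum.cong refl rect emeasure_phase_slices(2)[OF sets_\<mu> A])
qed

lemma rho_measurable: "i \<in> states \<Longrightarrow> \<rho> i \<in> borel_measurable borel"
  and rho_nonneg: "i \<in> states \<Longrightarrow> AE x in lborel. 0 \<le> \<rho> i x"
  and component_eq: "i \<in> states \<Longrightarrow> component \<mu> i = density lborel (\<lambda>x. ennreal (\<rho> i x))"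
  using density by (auto simp: invariant_density_def)

lemma emeasure_component:
  assumes i: "i \<in> states" and E: "E \<in> sets borel"
  shows "emeasure (component \<mu> i) E = emeasure \<mu> (E \<times> {i})"
proof -
  have "emeasure (component \<mu> i) E = emeasure (restrict_space \<mu> (UNIV \<times> {i})) (fst -` E \<inter> space (restrict_space \<mu> (UNIV \<times> {i})))"
    unfolding component_def by (rule emeasure_distr[OF measurable_fst_slice E])
  also have "fst -` E \<inter> space (restrict_space \<mu> (UNIV \<times> {i})) = E \<times> {i}"
    using i by (auto simp: space_restrict_space space_\<mu>)
  also have "emeasure (restrict_space \<mu> (UNIV \<times> {i})) (E \<times> {i}) = emeasure \<mu> (E \<times> {i})"
    by (rule emeasure_restrict_space) (use slice_sets[OF i] in auto)
  finally show ?thesis .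
qed

lemma rho_integrable:
  assumes i: "i \<in> states"
  shows "integrable lborel (\<rho> i)"
proof (rule integrableI_nonneg)
  have "(\<integral>\<^sup>+x. ennreal (\<rho> i x) \<partial>lborel) = emeasure (component \<mu> i) UNIV"
    using rho_measurable[OF i] by (simp add: component_eq[OF i] emeasure_density)
  also have "\<dots> = emeasure \<mu> (UNIV \<times> {i})" by (rule emeasure_component[OF i]) simp
  also have "\<dots> < \<infinity>" using \<mu>.emeasure_finite[of "UNIV \<times> {i}"] by (simp add: less_top[symmetric])
  finally show "(\<integral>\<^sup>+x. ennreal (\<rho> i x) \<partial>lborel) < \<infinity>" .
qed (use rho_measurable[OF i] rho_nonneg[OF i] in auto)

lemma rho_bounded_integrable:
  assumes i: "i \<in> states" and g: "g \<in> borel_measurable borel" and b: "\<And>x. \<bar>g x\<bar> \<le> b"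
  shows "integrable lborel (\<lambda>x. \<rho> i x * g x)"
proof (rule Bochner_Integration.integrable_bound[OF integrable_mult_right[OF integrable_abs[OF rho_integrable[OF i]], of b]])
  show "(\<lambda>x. \<rho> i x * g x) \<in> borel_measurable lborel"
    using rho_measurable[OF i] g by simp
  have "\<bar>\<rho> i x\<bar> * \<bar>g x\<bar> \<le> \<bar>b\<bar> * \<bar>\<rho> i x\<bar>" for x
    using mult_left_mono[OF order_trans[OF b abs_ge_self], of "\<bar>\<rho> i x\<bar>" x] by (simp add: mult.commute)
  then show "AE x in lborel. norm (\<rho> i x * g x) \<le> norm (b * \<bar>\<rho> i x\<bar>)"
    by (simp add: abs_mult)
qed

lemma integral_component:
  assumes g: "g \<in> borel_measurable phase" and b: "\<And>p. p \<in> space \<mu> \<Longrightarrow> \<bar>g p\<bar> \<le> (b::real)"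
  shows "(\<integral>p. g p \<partial>\<mu>) = (\<Sum>j\<in>states. \<integral>\<xi>. \<rho> j \<xi> * g (\<xi>, j) \<partial>lborel)"
proof -
  have gm: "g \<in> borel_measurable \<mu>" using g by (simp add: measurable_\<mu>)
  have gi: "integrable \<mu> g"
    by (rule \<mu>.integrable_const_bound[OF _ gm, of b]) (use b in auto)
  have comp: "(\<integral>\<xi>. \<rho> j \<xi> * g (\<xi>, j) \<partial>lborel) = (\<integral>p. indicator (UNIV \<times> {j}) p *\<^sub>R g p \<partial>\<mu>)"
    if j: "j \<in> states" for j
  proof -
    have gj: "(\<lambda>\<xi>. g (\<xi>, j)) \<in> borel_measurable borel" by (rule measurable_slice[OF g j])
    have "(\<integral>\<xi>. \<rho> j \<xi> * g (\<xi>, j) \<partial>lborel) = (\<integral>\<xi>. g (\<xi>, j) \<partial>component \<mu> j)"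
      unfolding component_eq[OF j]
      by (subst integral_density) (use gj rho_measurable[OF j] rho_nonneg[OF j] in auto)
    also have "\<dots> = (\<integral>p. g (fst p, j) \<partial>restrict_space \<mu> (UNIV \<times> {j}))"
      unfolding component_def by (rule integral_distr[OF measurable_fst_slice gj])
    also have "\<dots> = (\<integral>p. indicator (UNIV \<times> {j}) p *\<^sub>R g (fst p, j) \<partial>\<mu>)"
      by (rule integral_restrict_space) (use slice_sets[OF j] in \<open>auto simp: sets.Int\<close>)
    also have "\<dots> = (\<integral>p. indicator (UNIV \<times> {j}) p *\<^sub>R g p \<partial>\<mu>)"
      by (rule Bochner_Integration.integral_cong) (auto simp: indicator_def)
    finally show ?thesis .
  qed
  have "(\<Sum>j\<in>states. \<integral>\<xi>. \<rho> j \<xi> * g (\<xi>, j) \<partial>lborel) =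
      (\<Sum>j\<in>states. \<integral>p. indicator (UNIV \<times> {j}) p *\<^sub>R g p \<partial>\<mu>)"
    by (rule sum.cong[OF refl comp])
  also have "\<dots> = (\<integral>p. (\<Sum>j\<in>states. indicator (UNIV \<times> {j}) p *\<^sub>R g p) \<partial>\<mu>)"
    by (rule Bochner_Integration.integral_sum[symmetric])
       (intro integrable_mult_indicator slice_sets gi)
  also have "\<dots> = (\<integral>p. g p \<partial>\<mu>)"
  proof (rule Bochner_Integration.integral_cong)
    fix p assume "p \<in> space \<mu>"
    then obtain \<xi> i where p: "p = (\<xi>, i)" "i \<in> states" by (auto simp: space_\<mu>)
    have "(\<Sum>j\<in>states. indicator (UNIV \<times> {j}) p *\<^sub>R g p) = (\<Sum>j\<in>states. if j = i then g p else 0)"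
      by (rule sum.cong) (auto simp: p(1))
    then show "(\<Sum>j\<in>states. indicator (UNIV \<times> {j}) p *\<^sub>R g p) = g p"
      using p by simp
  qed simp
  finally show ?thesis by simp
qed

end

locale stationary_test_functions = stationary_switching + test_functions +
  assumes f'_measurable: "\<And>k. k \<in> {1..N} \<Longrightarrow> f' k \<in> borel_measurable borel"
begin

lemma expectation_invariant:
  assumes t: "t \<ge> 0"
  shows "integrable \<mu> (\<lambda>p. \<integral>\<omega>. observable (process t (p, \<omega>)) \<partial>Q)"
    and "(\<integral>p. (\<integral>\<omega>. observable (process t (p, \<omega>)) \<partial>Q) \<partial>\<mu>) = (\<integral>p. observable p \<partial>\<mu>)"
    and "integrable \<mu> observable"
proof -
  interpret pair_prob_space \<mu> Q ..
  have mp: "process t \<in> \<mu> \<Otimes>\<^sub>M Q \<rightarrow>\<^sub>M phase"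
    using measurable_process by (simp add: sets_\<mu> cong: measurable_cong_sets sets_pair_measure_cong)
  have b: "\<bar>observable p\<bar> \<le> B" if "p \<in> space phase" for p
    using that f_bound by (auto simp: space_pair_measure)
  have i: "integrable (\<mu> \<Otimes>\<^sub>M Q) (\<lambda>q. observable (process t q))"
    by (rule integrable_const_bound[of _ B])
       (use measurable_compose[OF mp measurable_observable] b measurable_space[OF mp] in auto)
  show "integrable \<mu> (\<lambda>p. \<integral>\<omega>. observable (process t (p, \<omega>)) \<partial>Q)"
    using integrable_fst'[OF i] .
  have "(\<integral>p. (\<integral>\<omega>. observable (process t (p, \<omega>)) \<partial>Q) \<partial>\<mu>) = (\<integral>q. observable (process t q) \<partial>(\<mu> \<Otimes>\<^sub>M Q))"
    using integral_fst'[OF i] .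
  also have "\<dots> = (\<integral>p. observable p \<partial>distr (\<mu> \<Otimes>\<^sub>M Q) phase (process t))"
    by (rule integral_distr[symmetric, OF mp measurable_observable])
  finally show "(\<integral>p. (\<integral>\<omega>. observable (process t (p, \<omega>)) \<partial>Q) \<partial>\<mu>) = (\<integral>p. observable p \<partial>\<mu>)"
    by (simp add: distr_process[OF t])
  show "integrable \<mu> observable"
    by (rule \<mu>.integrable_const_bound[of _ B])
       (use b sets_eq_imp_space_eq[OF sets_\<mu>] measurable_observable in \<open>auto simp: measurable_\<mu>\<close>)
qed

text \<open>
The infinitesimal generator of the process, applied to the observable.
\<close>
definition generator :: "real \<times> nat \<Rightarrow> real" where
  "generator = (\<lambda>(\<xi>, j). u j \<xi> * f' j \<xi> - rate j * f j \<xi> + (\<Sum>k\<in>states - {j}. lam j k * f k \<xi>))"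

lemma one_jump_value_0:
  assumes j: "j \<in> states"
  shows "one_jump_value 0 \<xi> j = f j \<xi>"
  by (simp add: one_jump_value_def flow_0[OF forward_complete_u[OF j]])

lemma one_jump_value_derivative:
  assumes j: "j \<in> states"
  shows "((\<lambda>t. one_jump_value t \<xi> j) has_real_derivative generator (\<xi>, j)) (at 0 within {0..})"
proof -
  have x: "((\<lambda>s. flow (u j) s \<xi>) has_real_derivative u j \<xi>) (at 0 within {0..})"
    using flow_has_derivative[OF forward_complete_u[OF j], of 0 \<xi>] by (simp add: flow_0[OF forward_complete_u[OF j]])
  have g: "(f j has_real_derivative f' j \<xi>) (at (flow (u j) 0 \<xi>))"
    using f_deriv[OF j, of \<xi>] by (simp add: flow_0[OF forward_complete_u[OF j]])
  have d: "((\<lambda>s. f j (flow (u j) s \<xi>)) has_real_derivative f' j \<xi> * u j \<xi>) (at 0 within {0..})"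
    by (rule DERIV_chain2[where g="\<lambda>s. flow (u j) s \<xi>", OF g x])
  show ?thesis unfolding one_jump_value_def
    apply (rule derivative_eq_intros d refl | simp)+
    using rate_pos[OF j] by (simp add: generator_def flow_0[OF forward_complete_u[OF j]])
qed

lemma one_jump_value_increment:
  assumes j: "j \<in> states" and t: "t \<ge> 0"
  shows "\<bar>one_jump_value t \<xi> j - f j \<xi>\<bar> \<le> (C + 2 * B * total_rate) * t"
proof -
  let ?e = "exp (- rate j * t)"
  have r: "rate j > 0" by (rule rate_pos[OF j])
  have e: "0 \<le> 1 - ?e" "1 - ?e \<le> total_rate * t"
    using r t one_minus_exp_le[of "rate j * t"] mult_right_mono[OF rate_le_total[OF j] t] by auto
  have s: "\<bar>\<Sum>k\<in>states - {j}. (lam j k / rate j) * f k \<xi>\<bar> \<le> B"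
  proof -
    have "\<bar>\<Sum>k\<in>states - {j}. (lam j k / rate j) * f k \<xi>\<bar> \<le> (\<Sum>k\<in>states - {j}. (lam j k / rate j) * B)"
    proof (rule order_trans[OF sum_abs sum_mono])
      fix k assume k: "k \<in> states - {j}"
      have "lam j k / rate j \<ge> 0" using r lam_pos[OF j, of k] k by (auto intro!: divide_nonneg_pos less_imp_le)
      moreover have "\<bar>f k \<xi>\<bar> \<le> B" using f_bound k by simp
      ultimately show "\<bar>(lam j k / rate j) * f k \<xi>\<bar> \<le> (lam j k / rate j) * B"
        using mult_left_mono[of "\<bar>f k \<xi>\<bar>" B "lam j k / rate j"] by (simp only: abs_mult abs_of_nonneg)
    qed
    also have "\<dots> = B"
      using r by (simp add: sum_distrib_right[symmetric] sum_divide_distrib[symmetric] exit_rate_def)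
    finally show ?thesis .
  qed
  have eq: "one_jump_value t \<xi> j - f j \<xi> = ?e * (f j (flow (u j) t \<xi>) - f j \<xi>) +
      (1 - ?e) * ((\<Sum>k\<in>states - {j}. (lam j k / rate j) * f k \<xi>) - f j \<xi>)"
  proof -
    have "(\<Sum>k\<in>states - {j}. (1 - ?e) * (lam j k / rate j) * f k \<xi>) = (1 - ?e) * (\<Sum>k\<in>states - {j}. (lam j k / rate j) * f k \<xi>)"
      unfolding sum_distrib_left by (simp only: mult.assoc)
    then show ?thesis unfolding one_jump_value_def by (simp only: algebra_simps)
  qed
  have "\<bar>one_jump_value t \<xi> j - f j \<xi>\<bar> \<le> \<bar>?e * (f j (flow (u j) t \<xi>) - f j \<xi>)\<bar> + \<bar>(1 - ?e) * ((\<Sum>k\<in>states - {j}. (lam j k / rate j) * f k \<xi>) - f j \<xi>)\<bar>"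
    unfolding eq by (rule abs_triangle_ineq)
  also have "\<dots> \<le> 1 * (C * t) + (total_rate * t) * (2 * B)"
  proof (rule add_mono)
    have "\<bar>?e\<bar> \<le> 1" using r t by simp
    then show "\<bar>?e * (f j (flow (u j) t \<xi>) - f j \<xi>)\<bar> \<le> 1 * (C * t)"
      unfolding abs_mult by (rule mult_mono[OF _ f_along_flow[OF j j t]]) simp_all
    have "\<bar>1 - ?e\<bar> \<le> total_rate * t" using e by linarith
    moreover have "\<bar>(\<Sum>k\<in>states - {j}. (lam j k / rate j) * f k \<xi>) - f j \<xi>\<bar> \<le> 2 * B"
      using s f_bound[OF j, of \<xi>] by linarith
    ultimately show "\<bar>(1 - ?e) * ((\<Sum>k\<in>states - {j}. (lam j k / rate j) * f k \<xi>) - f j \<xi>)\<bar> \<le> (total_rate * t) * (2 * B)"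
      unfolding abs_mult by (rule mult_mono) (use t total_rate_nonneg in simp_all)
  qed
  also have "1 * (C * t) + (total_rate * t) * (2 * B) = (C + 2 * B * total_rate) * t"
    by (simp add: algebra_simps)
  finally show ?thesis .
qed

lemma measurable_generator: "generator \<in> borel_measurable phase"
proof -
  have "(\<lambda>p. u (snd p) (fst p) * f' (snd p) (fst p) - rate (snd p) * f (snd p) (fst p)
      + (\<Sum>k\<in>states - {snd p}. lam (snd p) k * f k (fst p))) \<in> borel_measurable phase"
  proof (rule measurable_compose_countable'[where I=states and f="\<lambda>j p. u j (fst p) * f' j (fst p) - rate j * f j (fst p)
      + (\<Sum>k\<in>states - {j}. lam j k * f k (fst p))"])
    fix j assume j: "j \<in> states"
    have "(\<lambda>x. u j x * f' j x - rate j * f j x + (\<Sum>k\<in>states - {j}. lam j k * f k x)) \<in> borel_measurable borel"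
      by (intro borel_measurable_add borel_measurable_diff borel_measurable_times borel_measurable_sum borel_measurable_const
          u_measurable f'_measurable f_measurable j) simp
    from measurable_compose[OF measurable_fst this]
    show "(\<lambda>p. u j (fst p) * f' j (fst p) - rate j * f j (fst p) + (\<Sum>k\<in>states - {j}. lam j k * f k (fst p))) \<in> borel_measurable phase" .
  qed simp_all
  then show ?thesis by (simp add: generator_def case_prod_beta)
qed

lemma measurable_one_jump_value:
  assumes t: "t \<ge> 0"
  shows "(\<lambda>p. one_jump_value t (fst p) (snd p)) \<in> borel_measurable phase"
proof (rule measurable_compose_countable'[where I=states and f="\<lambda>j p. one_jump_value t (fst p) j"])
  fix j assume j: "j \<in> states"
  have fl: "(\<lambda>x. f j (flow (u j) t x)) \<in> borel_measurable borel"
    by (rule measurable_compose[OF measurable_flow_along[OF j borel_measurable_const] f_measurable[OF j]]) simp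
  have "(\<lambda>x. one_jump_value t x j) \<in> borel_measurable borel"
    unfolding one_jump_value_def
    by (intro borel_measurable_add borel_measurable_times borel_measurable_sum borel_measurable_const fl f_measurable) simp
  from measurable_compose[OF measurable_fst this]
  show "(\<lambda>p. one_jump_value t (fst p) j) \<in> borel_measurable phase" .
qed simp_all

text \<open>
Invariance says that the expectation of the observable at time \<open>t\<close>, averaged over \<open>\<mu>\<close>, does not change
with \<open>t\<close>. Its difference quotient along \<open>t = 1 / (n + 1)\<close> is dominated by a constant and converges to
the generator.
\<close>
lemma integral_generator: "(\<integral>p. generator p \<partial>\<mu>) = 0"
proof -
  define K where "K = C * total_rate + 2 * B * total_rate\<^sup>2"
  define D where "D = C + 2 * B * total_rate"
  define d where "d t p = one_jump_value t (fst p) (snd p) - observable p" for t p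
  define s where "s n = 1 / real (Suc n)" for n
  have s: "s n > 0" for n by (simp add: s_def)
  have st: "snd p \<in> states" if "p \<in> space \<mu>" for p using that by (auto simp: space_\<mu>)
  have dm: "d t \<in> borel_measurable \<mu>" if "t \<ge> 0" for t
    unfolding d_def measurable_\<mu>
    by (rule borel_measurable_diff[OF measurable_one_jump_value[OF that] measurable_observable])
  have db: "\<bar>d t p\<bar> \<le> D * t" if "t \<ge> 0" "p \<in> space \<mu>" for t p
    unfolding d_def D_def by (rule one_jump_value_increment[OF st[OF that(2)] that(1)])
  have di: "integrable \<mu> (d t)" if "t \<ge> 0" for t
    by (rule \<mu>.integrable_const_bound[of _ "D * t", OF _ dm[OF that]]) (use db[OF that] in auto)
  have small: "\<bar>\<integral>p. d t p \<partial>\<mu>\<bar> \<le> K * t\<^sup>2" if t: "t \<ge> 0" for t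
  proof -
    define m where "m p = (\<integral>\<omega>. observable (process t (p, \<omega>)) \<partial>Q)" for p
    have mi: "integrable \<mu> m" and m0: "(\<integral>p. m p \<partial>\<mu>) = (\<integral>p. observable p \<partial>\<mu>)"
      unfolding m_def by (rule expectation_invariant[OF t])+
    have oi: "integrable \<mu> observable" by (rule expectation_invariant(3)[OF t])
    have e: "\<bar>d t p - (m p - observable p)\<bar> \<le> K * t\<^sup>2" if "p \<in> space \<mu>" for p
      using short_time_expansion[OF st[OF that] t, of "fst p"] by (simp add: d_def m_def K_def abs_minus_commute)
    have "(\<integral>p. d t p \<partial>\<mu>) = (\<integral>p. d t p - (m p - observable p) \<partial>\<mu>)"
      using di[OF t] mi oi m0 by simp
    also have "\<bar>\<dots>\<bar> \<le> (\<integral>p. \<bar>d t p - (m p - observable p)\<bar> \<partial>\<mu>)" by (rule integral_abs_bound)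
    also have "\<dots> \<le> (\<integral>p. K * t\<^sup>2 \<partial>\<mu>)"
      by (rule integral_mono) (use di[OF t] mi oi e in auto)
    also have "\<dots> = K * t\<^sup>2" by (simp add: \<mu>.prob_space)
    finally show ?thesis .
  qed
  have lim: "(\<lambda>n. d (s n) p / s n) \<longlonglongrightarrow> generator p" if p: "p \<in> space \<mu>" for p
  proof -
    obtain \<xi> j where pj: "p = (\<xi>, j)" by (cases p)
    have j: "j \<in> states" using st[OF p] pj by simp
    have "((\<lambda>t. (one_jump_value t \<xi> j - one_jump_value 0 \<xi> j) / (t - 0)) \<longlongrightarrow> generator p) (at 0 within {0..})"
      using one_jump_value_derivative[OF j, of \<xi>] by (simp add: has_field_derivative_iff pj)
    moreover have "filterlim s (at 0 within {0..}) sequentially"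
      unfolding s_def using LIMSEQ_Suc[OF lim_1_over_n[where 'a=real]] by (auto simp: filterlim_at)
    ultimately have "(\<lambda>n. (one_jump_value (s n) \<xi> j - one_jump_value 0 \<xi> j) / (s n - 0)) \<longlonglongrightarrow> generator p"
      by (rule filterlim_compose)
    then show ?thesis by (simp add: d_def pj one_jump_value_0[OF j])
  qed
  have "(\<lambda>n. \<integral>p. d (s n) p / s n \<partial>\<mu>) \<longlonglongrightarrow> (\<integral>p. generator p \<partial>\<mu>)"
  proof (rule integral_dominated_convergence[where w="\<lambda>_. D"])
    show "generator \<in> borel_measurable \<mu>" using measurable_generator by (simp add: measurable_\<mu>)
    show "(\<lambda>p. d (s n) p / s n) \<in> borel_measurable \<mu>" for n
      using dm[OF less_imp_le[OF s], of n] by measurable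
    show "AE p in \<mu>. (\<lambda>n. d (s n) p / s n) \<longlonglongrightarrow> generator p" using lim by simp
    show "AE p in \<mu>. norm (d (s n) p / s n) \<le> D" for n
      using db[OF less_imp_le[OF s], of _ n] s[of n] by (auto simp: abs_mult pos_divide_le_eq)
  qed simp
  moreover have "(\<lambda>n. \<integral>p. d (s n) p / s n \<partial>\<mu>) \<longlonglongrightarrow> 0"
  proof (rule Lim_null_comparison)
    show "\<forall>\<^sub>F n in sequentially. norm (\<integral>p. d (s n) p / s n \<partial>\<mu>) \<le> K * s n"
    proof (intro always_eventually allI)
      fix n
      have "\<bar>\<integral>p. d (s n) p \<partial>\<mu>\<bar> / s n \<le> K * s n"
        using small[OF less_imp_le[OF s], of n] s[of n] by (simp add: pos_divide_le_eq power2_eq_square mult.assoc)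
      then show "norm (\<integral>p. d (s n) p / s n \<partial>\<mu>) \<le> K * s n"
        using s[of n] by simp
    qed
    show "(\<lambda>n. K * s n) \<longlonglongrightarrow> 0"
      unfolding s_def using tendsto_mult_right_zero[OF LIMSEQ_Suc[OF lim_1_over_n[where 'a=real]]] .
  qed
  ultimately show ?thesis by (rule LIMSEQ_unique)
qed

lemma weak_stationarity:
  "(\<Sum>j\<in>states. \<integral>\<xi>. \<rho> j \<xi> * generator (\<xi>, j) \<partial>lborel) = 0"
proof -
  have b: "\<bar>generator p\<bar> \<le> C + (\<Sum>j\<in>states. rate j * B + (\<Sum>k\<in>states - {j}. lam j k * B))" if "p \<in> space \<mu>" for p
  proof -
    obtain \<xi> j where p1: "p = (\<xi>, j)" by (cases p)
    have p2: "j \<in> states" using that by (simp add: p1 space_\<mu>)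
    have "\<bar>generator p\<bar> \<le> \<bar>u j \<xi> * f' j \<xi>\<bar> + \<bar>rate j * f j \<xi>\<bar> + \<bar>\<Sum>k\<in>states - {j}. lam j k * f k \<xi>\<bar>"
      by (simp add: p1 generator_def)
    also have "\<dots> \<le> C + rate j * B + (\<Sum>k\<in>states - {j}. lam j k * B)"
    proof (intro add_mono order_trans[OF sum_abs sum_mono])
      show "\<bar>u j \<xi> * f' j \<xi>\<bar> \<le> C" by (rule f'_bound[OF p2 p2])
      show "\<bar>rate j * f j \<xi>\<bar> \<le> rate j * B"
        using rate_pos[OF p2] f_bound[OF p2, of \<xi>] by (auto simp: abs_mult intro!: mult_left_mono)
      fix k assume "k \<in> states - {j}"
      then show "\<bar>lam j k * f k \<xi>\<bar> \<le> lam j k * B"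
        using less_imp_le[OF lam_pos[OF p2, of k]] f_bound[of k \<xi>] by (auto simp: abs_mult intro!: mult_left_mono)
    qed
    also have "\<dots> = C + (rate j * B + (\<Sum>k\<in>states - {j}. lam j k * B))" by simp
    also have "\<dots> \<le> C + (\<Sum>j\<in>states. rate j * B + (\<Sum>k\<in>states - {j}. lam j k * B))"
    proof (intro add_left_mono member_le_sum[OF p2, of "\<lambda>j. rate j * B + (\<Sum>k\<in>states - {j}. lam j k * B)"])
      fix i assume "i \<in> states - {j}"
      then show "0 \<le> rate i * B + (\<Sum>k\<in>states - {i}. lam i k * B)"
        using rate_pos[of i] lam_pos[of i] B_nonneg by (intro add_nonneg_nonneg sum_nonneg mult_nonneg_nonneg) (auto intro: less_imp_le)
    qed simp
    finally show ?thesis .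
  qed
  show ?thesis
    using integral_component[OF measurable_generator b] integral_generator by simp
qed

end

section \<open>Primitives of integrable functions\<close>
text \<open>
Primitives are taken from \<open>-\<infinity>\<close>, so that no base point has to be chosen and the total mass is their
limit at \<open>\<infinity>\<close>.
\<close>
definition primitive :: "(real \<Rightarrow> real) \<Rightarrow> real \<Rightarrow> real" where
  "primitive f y = (\<integral>x. indicator {..y} x * f x \<partial>lborel)"

lemma integrable_indicator_times:
  fixes f :: "real \<Rightarrow> real"
  assumes "integrable lborel f" "A \<in> sets borel"
  shows "integrable lborel (\<lambda>x. indicator A x * f x)"
  using integrable_mult_indicator[OF _ assms(1), of A] assms(2) by simp

lemma primitive_increment:
  assumes f: "integrable lborel f" and xy: "x \<le> y"
  shows "primitive f y - primitive f x = (\<integral>t. indicator {x<..y} t * f t \<partial>lborel)"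
proof -
  have "primitive f y - primitive f x = (\<integral>t. indicator {..y} t * f t - indicator {..x} t * f t \<partial>lborel)"
    unfolding primitive_def by (rule Bochner_Integration.integral_diff[symmetric]) (intro integrable_indicator_times f; simp)+
  also have "\<dots> = (\<integral>t. indicator {x<..y} t * f t \<partial>lborel)"
    by (rule Bochner_Integration.integral_cong) (use xy in \<open>auto simp: indicator_def\<close>)
  finally show ?thesis .
qed

lemma primitive_increment_mono:
  assumes f: "integrable lborel f" and g: "integrable lborel g" and xy: "x \<le> y"
    and le: "AE t in lborel. x < t \<longrightarrow> t < y \<longrightarrow> f t \<le> g t"
  shows "primitive f y - primitive f x \<le> primitive g y - primitive g x"
  unfolding primitive_increment[OF f xy] primitive_increment[OF g xy]
proof (rule integral_mono_AE)
  show "AE t in lborel. indicator {x<..y} t * f t \<le> indicator {x<..y} t * g t"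
    using le AE_lborel_singleton[of y] by eventually_elim (auto simp: indicator_def)
qed (intro integrable_indicator_times f g; simp)+

lemma primitive_cmult: "primitive (\<lambda>t. c * f t) y = c * primitive f y"
  unfolding primitive_def by (simp add: mult.left_commute)

lemma primitive_continuous:
  assumes f: "integrable lborel f"
  shows "continuous_on UNIV (primitive f)"
proof -
  have "isCont (primitive f) y" for y
    unfolding continuous_at_sequentially o_def primitive_def
  proof (intro allI impI)
    fix s :: "nat \<Rightarrow> real" assume s: "s \<longlonglongrightarrow> y"
    show "(\<lambda>n. \<integral>x. indicator {..s n} x * f x \<partial>lborel) \<longlonglongrightarrow> (\<integral>x. indicator {..y} x * f x \<partial>lborel)"
    proof (rule integral_dominated_convergence[where w="\<lambda>x. \<bar>f x\<bar>"])
      show "AE x in lborel. (\<lambda>n. indicator {..s n} x * f x) \<longlonglongrightarrow> indicator {..y} x * f x"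
        using AE_lborel_singleton[of y]
      proof eventually_elim
        case (elim x)
        have "eventually (\<lambda>n. indicator {..s n} x = (indicator {..y} x :: real)) sequentially"
        proof (cases "x < y")
          case True
          from order_tendstoD(1)[OF s this] show ?thesis
            by eventually_elim (use True in \<open>auto simp: indicator_def\<close>)
        next
          case False
          then have "y < x" using elim by simp
          from order_tendstoD(2)[OF s this] show ?thesis
            by eventually_elim (use False elim in \<open>auto simp: indicator_def\<close>)
        qed
        then have "eventually (\<lambda>n. indicator {..s n} x * f x = indicator {..y} x * f x) sequentially"
          by eventually_elim simp
        then show ?case by (rule tendsto_eventually)
      qed
    qed (use f in \<open>auto simp: indicator_def\<close>)
  qed
  then show ?thesis by (simp add: continuous_on_eq_continuous_at)
qed

text \<open>
The fundamental theorem of calculus for an integrand that has a continuous version near the point.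
It applies to the sources of the fluxes, which are only known almost everywhere.
\<close>
lemma primitive_has_derivative:
  assumes f: "integrable lborel f" and c: "isCont g z" and d: "d > 0"
    and eq: "AE t in lborel. \<bar>t - z\<bar> < d \<longrightarrow> f t = g t"
  shows "(primitive f has_real_derivative g z) (at z)"
  unfolding has_field_derivative_iff
proof (rule LIM_I)
  fix r :: real assume r: "r > 0"
  obtain s where s: "s > 0" "\<And>t. \<bar>t - z\<bar> < s \<Longrightarrow> \<bar>g t - g z\<bar> < r / 2"
    using c r unfolding continuous_at_eps_delta dist_real_def by (meson half_gt_zero)
  define e where "e = min d s"
  have inc: "\<bar>primitive f b - primitive f a - (b - a) * g z\<bar> \<le> (b - a) * (r/2)"
    if ab: "a \<le> b" "z - e \<le> a" "b \<le> z + e" for a b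
  proof -
    have const: "integrable lborel (\<lambda>t. indicator {a<..b} t * k)" for k :: real
      by (rule integrable_mult_left, rule integrable_real_indicator) (use ab in simp_all)
    have v: "(\<integral>t. indicator {a<..b} t * k \<partial>lborel) = (b - a) * k" for k
      using ab by simp
    have fi: "integrable lborel (\<lambda>t. indicator {a<..b} t * f t)" by (rule integrable_indicator_times[OF f]) simp
    have ae: "AE t in lborel. indicator {a<..b} t * (g z - r/2) \<le> indicator {a<..b} t * f t \<and>
        indicator {a<..b} t * f t \<le> indicator {a<..b} t * (g z + r/2)"
      using eq AE_lborel_singleton[of b]
    proof eventually_elim
      case (elim t)
      show ?case
      proof (cases "t \<in> {a<..b}")
        case True
        then have "\<bar>t - z\<bar> < e" using elim(2) ab by auto
        then have "\<bar>t - z\<bar> < d" "\<bar>t - z\<bar> < s" by (auto simp: e_def)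
        then have "f t = g t" "\<bar>g t - g z\<bar> < r/2" using elim(1) s(2) by auto
        then have "g z - r/2 \<le> f t" "f t \<le> g z + r/2" by linarith+
        then show ?thesis using True by simp
      qed simp
    qed
    have "(b - a) * (g z - r/2) \<le> primitive f b - primitive f a"
      unfolding primitive_increment[OF f ab(1)] v[symmetric] using ae by (intro integral_mono_AE const fi) auto
    moreover have "primitive f b - primitive f a \<le> (b - a) * (g z + r/2)"
      unfolding primitive_increment[OF f ab(1)] v[symmetric] using ae by (intro integral_mono_AE const fi) auto
    ultimately show ?thesis unfolding right_diff_distrib distrib_left by linarith
  qed
  have key: "\<bar>(primitive f x - primitive f z) / (x - z) - g z\<bar> < r" if x: "x \<noteq> z" "\<bar>x - z\<bar> < e" for x
  proof -
    have "\<bar>primitive f x - primitive f z - (x - z) * g z\<bar> \<le> \<bar>x - z\<bar> * (r/2)"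
    proof (cases "z \<le> x")
      case True
      then show ?thesis using inc[of z x] x by simp
    next
      case False
      then have "\<bar>primitive f z - primitive f x - (z - x) * g z\<bar> \<le> (z - x) * (r/2)"
        using inc[of x z] x by simp
      moreover have "primitive f z - primitive f x - (z - x) * g z = - (primitive f x - primitive f z - (x - z) * g z)"
        by (simp add: algebra_simps)
      ultimately show ?thesis using False by (simp only: abs_minus_cancel) simp
    qed
    moreover have "(primitive f x - primitive f z) / (x - z) - g z = (primitive f x - primitive f z - (x - z) * g z) / (x - z)"
      using x by (simp add: diff_divide_distrib)
    ultimately have "\<bar>(primitive f x - primitive f z) / (x - z) - g z\<bar> \<le> r/2"
      using x by (simp add: pos_divide_le_eq mult.commute)
    then show ?thesis using r by simp
  qed
  show "\<exists>s>0. \<forall>x. x \<noteq> z \<and> norm (x - z) < s \<longrightarrow> norm ((primitive f x - primitive f z) / (x - z) - g z) < r"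
    using key s d by (intro exI[of _ e]) (auto simp: e_def)
qed

text \<open>
A finite measure on the line is determined by its distribution function.
\<close>
lemma AE_zero_if_primitive_zero:
  assumes f: "integrable lborel f" and z: "\<And>y. primitive f y = 0"
  shows "AE x in lborel. f x = 0"
proof -
  have fm[measurable]: "f \<in> borel_measurable borel" using borel_measurable_integrable[OF f] by simp
  \<comment> \<open>\<open>M 1\<close> and \<open>M (-1)\<close> are the measures with the positive and the negative part of \<open>f\<close> as densities;
    their distribution functions differ by the primitive of \<open>f\<close>.\<close>
  define M where "M s = density lborel (\<lambda>x. ennreal (s * f x))" for s :: real
  have fin: "(\<integral>\<^sup>+x. ennreal (s * f x) \<partial>lborel) < \<infinity>" for s
    using integrableD(2)[OF integrable_mult_right[OF f, of s]] by (simp add: le_less_trans[OF nn_integral_mono] less_top)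
  have fb: "finite_borel_measure (M s)" for s
  proof (intro finite_borel_measure.intro finite_measureI finite_borel_measure_axioms.intro)
    show "emeasure (M s) (space (M s)) \<noteq> \<infinity>"
      unfolding M_def using fin[of s] by (simp add: emeasure_density)
  qed (simp add: M_def)
  have cdf: "cdf (M s) y = (\<integral>x. indicator {..y} x * max 0 (s * f x) \<partial>lborel)" for s y
  proof -
    have "emeasure (M s) {..y} = (\<integral>\<^sup>+x. ennreal (indicator {..y} x * max 0 (s * f x)) \<partial>lborel)"
      unfolding M_def by (subst emeasure_density) (auto intro!: nn_integral_cong simp: indicator_def ennreal_neg max_def)
    then show ?thesis unfolding cdf_def measure_def
      by (subst integral_eq_nn_integral) auto
  qed
  have i: "integrable lborel (\<lambda>x. indicator {..y} x * max 0 (s * f x))" for s y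
    by (intro integrable_indicator_times integrable_max integrable_mult_right f) auto
  have "cdf (M 1) y - cdf (M (-1)) y = primitive f y" for y
    unfolding cdf primitive_def Bochner_Integration.integral_diff[OF i i, symmetric]
    by (rule Bochner_Integration.integral_cong) (auto simp: indicator_def max_def)
  then have "cdf (M 1) = cdf (M (-1))" using z by (auto simp: fun_eq_iff)
  then have "M 1 = M (-1)" by (rule cdf_unique'[OF fb fb])
  then have "AE x in lborel. ennreal (1 * f x) = ennreal (- 1 * f x)"
    unfolding M_def using fin[of 1] by (subst (asm) finite_density_unique) auto
  then show ?thesis
  proof eventually_elim
    case (elim x)
    then show ?case by (cases "f x \<ge> 0") (auto simp: ennreal_neg ennreal_eq_0_iff dest: sym)
  qed
qed

text \<open>
Gronwall's inequality in both directions of time: a nonnegative function whose logarithmic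
derivative is bounded cannot leave or reach \<open>0\<close>.
\<close>
lemma linear_growth_vanishes:
  fixes h :: "real \<Rightarrow> real"
  assumes cont: "continuous_on {p..q} h"
    and deriv: "\<And>x. p < x \<Longrightarrow> x < q \<Longrightarrow> (h has_real_derivative h' x) (at x)"
    and growth: "\<And>x. p < x \<Longrightarrow> x < q \<Longrightarrow> \<bar>h' x\<bar> \<le> K * h x"
    and nonneg: "\<And>x. x \<in> {p..q} \<Longrightarrow> 0 \<le> h x"
    and z: "z \<in> {p..q}" "h z = 0" and x: "x \<in> {p..q}"
  shows "h x = 0"
proof -
  \<comment> \<open>\<open>exp (K * x) * h x\<close> is nondecreasing and \<open>exp (- K * x) * h x\<close> is nonincreasing.\<close>
  have up: "exp (K * a) * h a \<le> exp (K * b) * h b" if "p \<le> a" "a \<le> b" "b \<le> q" for a b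
  proof (rule DERIV_nonneg_imp_increasing_open[OF that(2)])
    fix x assume "a < x" "x < b"
    then have x: "p < x" "x < q" using that by auto
    have "((\<lambda>x. exp (K * x) * h x) has_real_derivative exp (K * x) * (K * h x + h' x)) (at x)"
      by (auto intro!: derivative_eq_intros deriv[OF x] simp: algebra_simps)
    moreover have "0 \<le> exp (K * x) * (K * h x + h' x)" using growth[OF x] by (intro mult_nonneg_nonneg) auto
    ultimately show "\<exists>y. ((\<lambda>x. exp (K * x) * h x) has_real_derivative y) (at x) \<and> 0 \<le> y" by blast
  qed (use that in \<open>auto intro!: continuous_intros continuous_on_subset[OF cont]\<close>)
  have down: "exp (- K * b) * h b \<le> exp (- K * a) * h a" if "p \<le> a" "a \<le> b" "b \<le> q" for a b
  proof (rule DERIV_nonpos_imp_decreasing_open[OF that(2)])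
    fix x assume "a < x" "x < b"
    then have x: "p < x" "x < q" using that by auto
    have "((\<lambda>x. exp (- K * x) * h x) has_real_derivative exp (- K * x) * (- K * h x + h' x)) (at x)"
      by (auto intro!: derivative_eq_intros deriv[OF x] simp: algebra_simps)
    moreover have "exp (- K * x) * (- K * h x + h' x) \<le> 0" using growth[OF x] by (intro mult_nonneg_nonpos) auto
    ultimately show "\<exists>y. ((\<lambda>x. exp (- K * x) * h x) has_real_derivative y) (at x) \<and> y \<le> 0" by blast
  qed (use that in \<open>auto intro!: continuous_intros continuous_on_subset[OF cont]\<close>)
  have "h x \<le> 0"
  proof (cases "x \<le> z")
    case True
    then show ?thesis using up[of x z] z x by (simp add: mult_le_0_iff)
  next
    case False
    then show ?thesis using down[of z x] z x by (simp add: mult_le_0_iff)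
  qed
  then show ?thesis using nonneg[OF x] by simp
qed

lemma AE_lborel_witness:
  assumes "AE t in lborel. P t" "a < (b::real)"
  obtains t where "a < t" "t < b" "P t"
proof -
  have "\<exists>t. a < t \<and> t < b \<and> P t"
  proof (rule ccontr)
    assume "\<not> ?thesis"
    then have "AE t in lborel. t \<notin> {a<..<b}"
      using assms(1) by (auto elim!: eventually_mono)
    then have "{a<..<b} \<in> null_sets lborel"
      by (subst (asm) AE_iff_null_sets[symmetric]) auto
    then show False using assms(2) by (auto simp: null_sets_def)
  qed
  then show ?thesis using that by blast
qed

text \<open>
Every neighbourhood of a point has positive measure.
\<close>
lemma continuous_AE_nonneg:
  fixes f :: "real \<Rightarrow> real"
  assumes c: "isCont f x" and d: "d > 0" and ae: "AE t in lborel. \<bar>t - x\<bar> < d \<longrightarrow> 0 \<le> f t"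
  shows "0 \<le> f x"
proof (rule ccontr)
  assume "\<not> ?thesis"
  then obtain e where e: "e > 0" "\<And>t. \<bar>t - x\<bar> < e \<Longrightarrow> \<bar>f t - f x\<bar> < - f x"
    using c unfolding continuous_at_eps_delta dist_real_def by (metis neg_0_less_iff_less not_le)
  obtain t where t: "x - min d e < t" "t < x + min d e" "\<bar>t - x\<bar> < d \<longrightarrow> 0 \<le> f t"
    by (rule AE_lborel_witness[OF ae, of "x - min d e" "x + min d e"]) (use d e(1) in \<open>auto simp: min_def\<close>)
  then have "\<bar>t - x\<bar> < e" "\<bar>t - x\<bar> < d" by auto
  then show False using e(2)[of t] t(3) by linarith
qed

lemma continuous_AE_zero:
  fixes f :: "real \<Rightarrow> real"
  assumes c: "isCont f x" and d: "d > 0" and ae: "AE t in lborel. \<bar>t - x\<bar> < d \<longrightarrow> f t = 0"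
  shows "f x = 0"
proof -
  have "0 \<le> f x" by (rule continuous_AE_nonneg[OF c d]) (use ae in \<open>auto elim!: eventually_mono\<close>)
  moreover have "0 \<le> - f x"
    by (rule continuous_AE_nonneg[where f="\<lambda>t. - f t", OF _ d]) (use ae c in \<open>auto elim!: eventually_mono\<close>)
  ultimately show ?thesis by simp
qed
section \<open>Probability fluxes\<close>
locale regular_switching = stationary_switching +
  assumes C1_u: "\<And>i. i \<in> {1..N} \<Longrightarrow> u i C1_differentiable_on UNIV"
    and isolated: "\<And>x. \<not> x islimpt {y. \<exists>i\<in>{1..N}. u i y = 0}"
begin

lemma u_continuous: "i \<in> states \<Longrightarrow> continuous_on UNIV (u i)"
  using C1_differentiable_imp_continuous_on[OF C1_u] .

lemma u_isCont: "i \<in> states \<Longrightarrow> isCont (u i) x"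
  using u_continuous by (simp add: continuous_on_eq_continuous_at)

text \<open>
The net rate at which the switching creates mass in state \<open>i\<close> at \<open>x\<close>.
\<close>
definition source :: "nat \<Rightarrow> real \<Rightarrow> real" where
  "source i x = (\<Sum>j\<in>states - {i}. lam j i * \<rho> j x) - rate i * \<rho> i x"

text \<open>
The stationary amount of mass per unit time that is carried in state \<open>i\<close> through a point, determined
by the balance of mass to the left of the point.
\<close>
definition flux :: "nat \<Rightarrow> real \<Rightarrow> real" where
  "flux i = primitive (source i)"

text \<open>
The continuous representative of \<open>\<rho> i\<close> off the critical points of \<open>u i\<close>.
\<close>
definition dens :: "nat \<Rightarrow> real \<Rightarrow> real" where
  "dens i x = (if u i x = 0 then 0 else flux i x / u i x)"

lemma source_integrable:
  assumes i: "i \<in> states"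
  shows "integrable lborel (source i)"
  unfolding source_def
  by (intro Bochner_Integration.integrable_diff Bochner_Integration.integrable_sum integrable_mult_right rho_integrable i) simp

lemma flux_continuous: "i \<in> states \<Longrightarrow> continuous_on UNIV (flux i)"
  unfolding flux_def by (rule primitive_continuous[OF source_integrable])

text \<open>
Switching moves mass between states without changing the position, so the sources add up to \<open>0\<close>.
\<close>
lemma sum_flux: "(\<Sum>i\<in>states. flux i y) = 0"
proof -
  have "(\<Sum>i\<in>states. \<Sum>j\<in>states - {i}. lam j i * \<rho> j x) = (\<Sum>j\<in>states. \<Sum>i\<in>states - {j}. lam j i * \<rho> j x)" for x
  proof -
    have "(\<Sum>i\<in>states. \<Sum>j\<in>states - {i}. lam j i * \<rho> j x) = (\<Sum>i\<in>states. \<Sum>j\<in>{j. j \<in> states \<and> j \<noteq> i}. lam j i * \<rho> j x)"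
      by (intro sum.cong refl) auto
    also have "\<dots> = (\<Sum>j\<in>states. \<Sum>i\<in>{i. i \<in> states \<and> j \<noteq> i}. lam j i * \<rho> j x)"
      by (rule sum.swap_restrict) auto
    also have "\<dots> = (\<Sum>j\<in>states. \<Sum>i\<in>states - {j}. lam j i * \<rho> j x)"
      by (intro sum.cong refl) auto
    finally show ?thesis .
  qed
  then have s: "(\<Sum>i\<in>states. source i x) = 0" for x
    unfolding source_def sum_subtractf exit_rate_def sum_distrib_right by simp
  have "(\<Sum>i\<in>states. flux i y) = (\<integral>x. (\<Sum>i\<in>states. indicator {..y} x * source i x) \<partial>lborel)"
    unfolding flux_def primitive_def
    by (rule Bochner_Integration.integral_sum[symmetric]) (simp add: integrable_indicator_times source_integrable)
  also have "\<dots> = 0" by (simp add: sum_distrib_left[symmetric] s)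
  finally show ?thesis .
qed

lemma source_times_integrable:
  assumes i: "i \<in> states" and g: "g \<in> borel_measurable borel" and b: "\<And>x. \<bar>g x\<bar> \<le> b"
  shows "integrable lborel (\<lambda>x. source i x * g x)"
proof -
  have "integrable lborel (\<lambda>x. (\<Sum>j\<in>states - {i}. lam j i * (\<rho> j x * g x)) - rate i * (\<rho> i x * g x))"
    by (intro Bochner_Integration.integrable_diff Bochner_Integration.integrable_sum integrable_mult_right rho_bounded_integrable[OF _ g b] i) simp
  then show ?thesis by (simp add: source_def left_diff_distrib sum_distrib_right mult.assoc)
qed

text \<open>
The forward equation of state \<open>i\<close>. Boundedness of the test function suffices for the
passage to the limit, so it may be a constant or the primitive of a bump.
\<close>
lemma weak_stationarity_single:
  assumes i: "i \<in> states"
    and g: "\<And>x. (g has_real_derivative g' x) (at x)" and g': "g' \<in> borel_measurable borel"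
    and b: "\<And>x. \<bar>g x\<bar> \<le> b" and c: "\<And>j x. j \<in> states \<Longrightarrow> \<bar>u j x * g' x\<bar> \<le> c"
  shows "(\<integral>x. \<rho> i x * (u i x * g' x) \<partial>lborel) + (\<integral>x. source i x * g x \<partial>lborel) = 0"
proof -
  let ?f = "\<lambda>k x. if k = i then g x else 0" and ?f' = "\<lambda>k x. if k = i then g' x else 0"
  have c0: "0 \<le> c" using c[OF i, of 0] by linarith
  have b0: "0 \<le> b" using b[of 0] by linarith
  \<comment> \<open>The function \<open>g\<close> on state \<open>i\<close> and \<open>0\<close> on all other states.\<close>
  interpret T: stationary_test_functions N u lam \<mu> \<rho> ?f ?f' b c
  proof
    fix k x assume "k \<in> {1..N}"
    show "(?f k has_real_derivative ?f' k x) (at x)" using g by (cases "k = i") simp_all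
    show "\<bar>?f k x\<bar> \<le> b" using b b0 by simp
  next
    fix j k x assume "j \<in> {1..N}" "k \<in> {1..N}"
    then show "\<bar>u j x * ?f' k x\<bar> \<le> c" using c c0 by simp
  next
    fix k assume "k \<in> {1..N}"
    show "?f' k \<in> borel_measurable borel" using g' by (cases "k = i") simp_all
  qed
  have gm: "g \<in> borel_measurable borel"
    by (rule borel_measurable_continuous_onI, rule DERIV_continuous_on, rule g)
  have um: "(\<lambda>x. u i x * g' x) \<in> borel_measurable borel"
    using u_measurable[OF i] g' by measurable
  have Ii: "integrable lborel (\<lambda>x. \<rho> i x * (u i x * g' x))"
    by (rule rho_bounded_integrable[OF i um c[OF i]])
  have Ig: "integrable lborel (\<lambda>x. \<rho> j x * g x)" if "j \<in> states" for j
    by (rule rho_bounded_integrable[OF that gm b])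
  have gen_i: "T.generator (x, i) = u i x * g' x - rate i * g x" for x
    by (simp add: T.generator_def)
  have gen_j: "T.generator (x, j) = lam j i * g x" if "j \<noteq> i" for x j
    using that i by (simp add: T.generator_def if_distrib[of "\<lambda>y. _ * y"] cong: if_cong)
  have "0 = (\<integral>x. \<rho> i x * T.generator (x, i) \<partial>lborel) + (\<Sum>j\<in>states - {i}. \<integral>x. \<rho> j x * T.generator (x, j) \<partial>lborel)"
    using T.weak_stationarity sum.remove[OF _ i, of "\<lambda>j. \<integral>x. \<rho> j x * T.generator (x, j) \<partial>lborel"] by simp
  also have "(\<integral>x. \<rho> i x * T.generator (x, i) \<partial>lborel) = (\<integral>x. \<rho> i x * (u i x * g' x) - rate i * (\<rho> i x * g x) \<partial>lborel)"
    unfolding gen_i by (rule Bochner_Integration.integral_cong) (auto simp: algebra_simps)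
  also have "\<dots> = (\<integral>x. \<rho> i x * (u i x * g' x) \<partial>lborel) - (\<integral>x. rate i * (\<rho> i x * g x) \<partial>lborel)"
    by (rule Bochner_Integration.integral_diff[OF Ii integrable_mult_right[OF Ig[OF i]]])
  also have "(\<Sum>j\<in>states - {i}. \<integral>x. \<rho> j x * T.generator (x, j) \<partial>lborel)
      = (\<Sum>j\<in>states - {i}. \<integral>x. lam j i * (\<rho> j x * g x) \<partial>lborel)"
    by (rule sum.cong[OF refl], rule Bochner_Integration.integral_cong) (auto simp: gen_j)
  also have "\<dots> = (\<integral>x. (\<Sum>j\<in>states - {i}. lam j i * (\<rho> j x * g x)) \<partial>lborel)"
    by (rule Bochner_Integration.integral_sum[symmetric]) (intro integrable_mult_right Ig; simp)
  finally have "0 = (\<integral>x. \<rho> i x * (u i x * g' x) \<partial>lborel) + ((\<integral>x. (\<Sum>j\<in>states - {i}. lam j i * (\<rho> j x * g x)) \<partial>lborel) - (\<integral>x. rate i * (\<rho> i x * g x) \<partial>lborel))"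
    by linarith
  also have "(\<integral>x. (\<Sum>j\<in>states - {i}. lam j i * (\<rho> j x * g x)) \<partial>lborel) - (\<integral>x. rate i * (\<rho> i x * g x) \<partial>lborel)
    = (\<integral>x. (\<Sum>j\<in>states - {i}. lam j i * (\<rho> j x * g x)) - rate i * (\<rho> i x * g x) \<partial>lborel)"
    by (rule Bochner_Integration.integral_diff[symmetric])
       (intro Bochner_Integration.integrable_sum integrable_mult_right Ig i; simp)+
  also have "\<dots> = (\<integral>x. source i x * g x \<partial>lborel)"
    by (rule Bochner_Integration.integral_cong) (auto simp: source_def left_diff_distrib sum_distrib_right mult.assoc)
  finally show ?thesis by simp
qed

lemma source_integral_0:
  assumes i: "i \<in> states"
  shows "(\<integral>x. source i x \<partial>lborel) = 0"
  using weak_stationarity_single[OF i, of "\<lambda>_. 1" "\<lambda>_. 0" 1 0] by simp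

lemma u_locally_bounded:
  obtains c where "\<And>j x. j \<in> states \<Longrightarrow> x \<in> {p..q} \<Longrightarrow> \<bar>u j x\<bar> \<le> c" "0 \<le> c"
proof -
  have "\<exists>c. \<forall>x\<in>{p..q}. \<bar>u j x\<bar> \<le> c" if "j \<in> states" for j
  proof -
    have "compact (u j ` {p..q})"
      by (intro compact_continuous_image continuous_on_subset[OF u_continuous[OF that]]) auto
    from compact_imp_bounded[OF this] show ?thesis by (auto simp: bounded_iff)
  qed
  then obtain c where c: "\<And>j x. j \<in> states \<Longrightarrow> x \<in> {p..q} \<Longrightarrow> \<bar>u j x\<bar> \<le> c j" by metis
  show ?thesis
  proof (rule that[of "\<Sum>j\<in>states. \<bar>c j\<bar>"])
    fix j x assume "j \<in> states" "x \<in> {p..q}"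
    then have "\<bar>u j x\<bar> \<le> \<bar>c j\<bar>" using c[of j x] by linarith
    also have "\<dots> \<le> (\<Sum>j\<in>states. \<bar>c j\<bar>)" by (rule member_le_sum) (use \<open>j \<in> states\<close> in auto)
    finally show "\<bar>u j x\<bar> \<le> (\<Sum>j\<in>states. \<bar>c j\<bar>)" .
  qed (simp add: sum_nonneg)
qed

lemma flux_measurable: "i \<in> states \<Longrightarrow> flux i \<in> borel_measurable borel"
  by (rule borel_measurable_continuous_onI[OF flux_continuous])

text \<open>
Testing with the primitive of \<open>\<phi>\<close> and moving the primitive over to the source.
\<close>
lemma rho_u_tested:
  assumes i: "i \<in> states" and \<phi>: "continuous_on UNIV \<phi>"
    and \<phi>01: "\<And>x. 0 \<le> \<phi> x" "\<And>x. \<phi> x \<le> 1" and supp: "\<And>x. x \<notin> {p..q} \<Longrightarrow> \<phi> x = 0"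
  shows "(\<integral>x. \<rho> i x * (u i x * \<phi> x) \<partial>lborel) = (\<integral>x. \<phi> x * flux i x \<partial>lborel)"
proof -
  obtain c where c: "\<And>j x. j \<in> states \<Longrightarrow> x \<in> {p..q} \<Longrightarrow> \<bar>u j x\<bar> \<le> c" "0 \<le> c"
    using u_locally_bounded[of p q] by blast
  have \<phi>m[measurable]: "\<phi> \<in> borel_measurable borel" by (rule borel_measurable_continuous_onI[OF \<phi>])
  have ipq: "integrable lborel (indicator {p..q} :: real \<Rightarrow> real)"
    by (rule integrable_real_indicator) (simp_all add: emeasure_lborel_Icc_eq)
  have \<phi>i: "integrable lborel \<phi>"
    by (rule Bochner_Integration.integrable_bound[OF ipq]) (use \<phi>01 supp in \<open>auto simp: indicator_def\<close>)
  have pb: "\<bar>primitive \<phi> x\<bar> \<le> integral\<^sup>L lborel \<phi>" for x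
  proof -
    have "0 \<le> primitive \<phi> x" unfolding primitive_def using \<phi>01 by (intro Bochner_Integration.integral_nonneg) simp
    moreover have "primitive \<phi> x \<le> integral\<^sup>L lborel \<phi>"
      unfolding primitive_def by (rule integral_mono[OF integrable_indicator_times[OF \<phi>i] \<phi>i]) (use \<phi>01 in \<open>auto simp: indicator_def\<close>)
    ultimately show ?thesis by simp
  qed
  have gd: "(primitive \<phi> has_real_derivative \<phi> x) (at x)" for x
    by (rule primitive_has_derivative[OF \<phi>i, of _ _ 1]) (use \<phi> in \<open>auto simp: continuous_on_eq_continuous_at\<close>)
  have gm[measurable]: "primitive \<phi> \<in> borel_measurable borel"
    by (rule borel_measurable_continuous_onI[OF primitive_continuous[OF \<phi>i]])
  have cb: "\<bar>u j x * \<phi> x\<bar> \<le> c" if "j \<in> states" for j x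
  proof (cases "x \<in> {p..q}")
    case True
    have "\<bar>u j x\<bar> * \<bar>\<phi> x\<bar> \<le> c * 1"
      using \<phi>01[of x] by (intro mult_mono c that True) auto
    then show ?thesis by (simp add: abs_mult)
  next
    case False
    then show ?thesis using supp c(2) by simp
  qed
  have weak: "(\<integral>x. \<rho> i x * (u i x * \<phi> x) \<partial>lborel) + (\<integral>x. source i x * primitive \<phi> x \<partial>lborel) = 0"
    by (rule weak_stationarity_single[OF i gd \<phi>m pb cb])
  \<comment> \<open>Integration by parts in the form of an exchange of the order of integration.\<close>
  let ?k = "\<lambda>x y. source i x * (indicator {..x} y * \<phi> y)"
  have sm[measurable]: "source i \<in> borel_measurable borel"
    using borel_measurable_integrable[OF source_integrable[OF i]] by simp
  have in1: "(\<integral>y. ?k x y \<partial>lborel) = source i x * primitive \<phi> x" for x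
    unfolding primitive_def by simp
  have in2: "(\<integral>x. ?k x y \<partial>lborel) = - (\<phi> y * flux i y)" for y
  proof -
    have "(\<integral>x. ?k x y \<partial>lborel) = (\<integral>x. \<phi> y * (source i x - indicator {..y} x * source i x) \<partial>lborel)"
    proof (rule integral_cong_AE)
      show "AE x in lborel. ?k x y = \<phi> y * (source i x - indicator {..y} x * source i x)"
        using AE_lborel_singleton[of y] by eventually_elim (auto simp: indicator_def)
      have "(\<lambda>x. source i x * (of_bool (y \<le> x) * \<phi> y)) \<in> borel_measurable lborel" by measurable
      then show "(\<lambda>x. ?k x y) \<in> borel_measurable lborel" by (simp add: indicator_def of_bool_def)
    qed auto
    also have "\<dots> = \<phi> y * ((\<integral>x. source i x \<partial>lborel) - flux i y)"
      unfolding flux_def primitive_def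
      by (simp add: Bochner_Integration.integral_diff[OF source_integrable[OF i] integrable_indicator_times[OF source_integrable[OF i]]])
    finally show ?thesis by (simp add: source_integral_0[OF i])
  qed
  have ip: "integrable (lborel \<Otimes>\<^sub>M lborel) (\<lambda>(x, y). ?k x y)"
  proof (rule lborel_pair.Fubini_integrable)
    have "(\<lambda>p. source i (fst p) * (of_bool (snd p \<le> fst p) * \<phi> (snd p))) \<in> borel_measurable (lborel \<Otimes>\<^sub>M lborel)"
      by measurable
    then show "(\<lambda>(x, y). ?k x y) \<in> borel_measurable (lborel \<Otimes>\<^sub>M lborel)"
      by (simp add: case_prod_beta indicator_def of_bool_def)
    have "(\<integral>y. norm (case (x, y) of (x, y) \<Rightarrow> ?k x y) \<partial>lborel) = \<bar>source i x * primitive \<phi> x\<bar>" for x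
    proof -
      have "(\<integral>y. norm (case (x, y) of (x, y) \<Rightarrow> ?k x y) \<partial>lborel) = (\<integral>y. \<bar>source i x\<bar> * (indicator {..x} y * \<phi> y) \<partial>lborel)"
        by (rule Bochner_Integration.integral_cong) (use \<phi>01 in \<open>auto simp: abs_mult\<close>)
      also have "\<dots> = \<bar>source i x\<bar> * primitive \<phi> x" unfolding primitive_def by simp
      also have "\<dots> = \<bar>source i x * primitive \<phi> x\<bar>"
        using \<phi>01 by (simp add: abs_mult primitive_def Bochner_Integration.integral_nonneg)
      finally show ?thesis .
    qed
    then show "integrable lborel (\<lambda>x. \<integral>y. norm (case (x, y) of (x, y) \<Rightarrow> ?k x y) \<partial>lborel)"
      using integrable_abs[OF source_times_integrable[OF i gm pb]] by simp
    show "AE x in lborel. integrable lborel (\<lambda>y. case (x, y) of (x, y) \<Rightarrow> ?k x y)"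
      using integrable_indicator_times[OF \<phi>i] by simp
  qed
  have "(\<integral>x. source i x * primitive \<phi> x \<partial>lborel) = (\<integral>y. - (\<phi> y * flux i y) \<partial>lborel)"
    unfolding in1[symmetric] in2[symmetric] by (rule lborel_pair.Fubini_integral[OF ip, symmetric])
  then show ?thesis using weak by simp
qed

text \<open>
The test functions \<open>\<phi>\<close> approximate indicators of intervals, and intervals determine an integrable
function up to null sets.
\<close>
lemma u_rho_eq_flux:
  assumes i: "i \<in> states"
  shows "AE x in lborel. u i x * \<rho> i x = flux i x"
proof -
  define D where "D x = u i x * \<rho> i x - flux i x" for x
  have [measurable]: "u i \<in> borel_measurable borel" "\<rho> i \<in> borel_measurable borel" "flux i \<in> borel_measurable borel"
    by (rule u_measurable rho_measurable flux_measurable, rule i)+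
  have int: "integrable lborel (\<lambda>x. indicator A x * (u i x * \<rho> i x))" "integrable lborel (\<lambda>x. indicator A x * flux i x)"
    if A: "A \<subseteq> {p..q}" "A \<in> sets borel" for A p q
  proof -
    obtain c where c: "\<And>j x. j \<in> states \<Longrightarrow> x \<in> {p..q} \<Longrightarrow> \<bar>u j x\<bar> \<le> c" "0 \<le> c"
      using u_locally_bounded[of p q] by blast
    have "\<bar>indicator A x * u i x\<bar> \<le> c" for x
      using c(1)[OF i, of x] c(2) A(1) by (auto simp: indicator_def)
    then have "integrable lborel (\<lambda>x. \<rho> i x * (indicator A x * u i x))"
      using A(2) by (intro rho_bounded_integrable[OF i, of _ c]) auto
    then show "integrable lborel (\<lambda>x. indicator A x * (u i x * \<rho> i x))"
      by (simp add: mult.commute mult.left_commute)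
    have "integrable lborel (\<lambda>x. indicator A x *\<^sub>R (indicator {p..q} x *\<^sub>R flux i x))"
      by (rule integrable_mult_indicator, use A(2) in simp)
         (rule borel_integrable_compact[unfolded set_integrable_def], auto intro: continuous_on_subset[OF flux_continuous[OF i]])
    then show "integrable lborel (\<lambda>x. indicator A x * flux i x)"
      by (rule Bochner_Integration.integrable_cong[THEN iffD1, rotated -1]) (use A(1) in \<open>auto simp: indicator_def\<close>)
  qed
  have intD: "integrable lborel (\<lambda>x. indicator A x * D x)"
    if A: "A \<subseteq> {p..q}" "A \<in> sets borel" for A p q
    unfolding D_def right_diff_distrib by (rule Bochner_Integration.integrable_diff[OF int[OF that]])
  have zero: "(\<integral>x. indicator {p<..<q} x * D x \<partial>lborel) = 0" for p q
  proof -
    \<comment> \<open>Trapezoidal functions that increase to the indicator of the open interval.\<close>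
    define \<phi> where "\<phi> n x = max 0 (min 1 (real n * min (x - p) (q - x)))" for n :: nat and x
    have \<phi>: "continuous_on UNIV (\<phi> n)" "0 \<le> \<phi> n x" "\<phi> n x \<le> 1" "x \<notin> {p..q} \<Longrightarrow> \<phi> n x = 0" for n x
    proof -
      show "continuous_on UNIV (\<phi> n)" unfolding \<phi>_def by (intro continuous_intros)
      assume "x \<notin> {p..q}"
      then have "min (x - p) (q - x) \<le> 0" by auto
      then have "real n * min (x - p) (q - x) \<le> 0" by (rule mult_nonneg_nonpos[OF of_nat_0_le_iff])
      then show "\<phi> n x = 0" by (simp add: \<phi>_def)
    qed (auto simp: \<phi>_def)
    have \<phi>m[measurable]: "\<phi> n \<in> borel_measurable borel" for n by (rule borel_measurable_continuous_onI[OF \<phi>(1)])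
    have lim: "(\<lambda>n. \<phi> n x) \<longlonglongrightarrow> indicator {p<..<q} x" for x
    proof (cases "x \<in> {p<..<q}")
      case True
      then have m: "0 < min (x - p) (q - x)" by simp
      obtain n0 where n0: "1 / min (x - p) (q - x) < real n0" using reals_Archimedean2 by blast
      have "\<phi> n x = 1" if "n \<ge> n0" for n
      proof -
        have "1 / min (x - p) (q - x) \<le> real n" using n0 that by linarith
        then have "1 \<le> real n * min (x - p) (q - x)" using m by (simp only: pos_divide_le_eq)
        then show ?thesis by (simp add: \<phi>_def)
      qed
      then have "eventually (\<lambda>n. \<phi> n x = 1) sequentially" unfolding eventually_sequentially by blast
      then show ?thesis using True by (simp add: tendsto_eventually)
    next
      case False
      then have "min (x - p) (q - x) \<le> 0" by auto
      then have "real n * min (x - p) (q - x) \<le> 0" for n by (rule mult_nonneg_nonpos[OF of_nat_0_le_iff])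
      then have "\<phi> n x = 0" for n unfolding \<phi>_def by (simp only: min_absorb2 max_absorb1 order_trans[OF _ zero_le_one])
      then show ?thesis using False by simp
    qed
    have dom: "norm (\<phi> n x * a) \<le> \<bar>indicator {p..q} x * a\<bar>" for n x a
      using \<phi>(2,3)[of n x] \<phi>(4)[of x n]
      by (cases "x \<in> {p..q}") (simp_all add: abs_mult mult_left_le_one_le)
    have D0: "(\<integral>x. \<phi> n x * D x \<partial>lborel) = 0" for n
    proof -
      have b1: "integrable lborel (\<lambda>x. \<phi> n x * (u i x * \<rho> i x))"
        by (rule Bochner_Integration.integrable_bound[OF int(1)[of "{p..q}" p q]])
           (use dom in auto)
      have b2: "integrable lborel (\<lambda>x. \<phi> n x * flux i x)"
        by (rule Bochner_Integration.integrable_bound[OF int(2)[of "{p..q}" p q]])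
           (use dom in auto)
      have "(\<integral>x. \<phi> n x * D x \<partial>lborel) = (\<integral>x. \<phi> n x * (u i x * \<rho> i x) \<partial>lborel) - (\<integral>x. \<phi> n x * flux i x \<partial>lborel)"
        unfolding D_def right_diff_distrib by (rule Bochner_Integration.integral_diff[OF b1 b2])
      also have "(\<integral>x. \<phi> n x * (u i x * \<rho> i x) \<partial>lborel) = (\<integral>x. \<rho> i x * (u i x * \<phi> n x) \<partial>lborel)"
        by (simp add: mult.commute mult.left_commute)
      also have "\<dots> = (\<integral>x. \<phi> n x * flux i x \<partial>lborel)" by (rule rho_u_tested[OF i \<phi>])
      finally show ?thesis by simp
    qed
    have "(\<lambda>n. \<integral>x. \<phi> n x * D x \<partial>lborel) \<longlonglongrightarrow> (\<integral>x. indicator {p<..<q} x * D x \<partial>lborel)"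
    proof (rule integral_dominated_convergence[where w="\<lambda>x. \<bar>indicator {p..q} x * D x\<bar>"])
      show "AE x in lborel. norm (\<phi> n x * D x) \<le> \<bar>indicator {p..q} x * D x\<bar>" for n
        using dom by simp
      show "AE x in lborel. (\<lambda>n. \<phi> n x * D x) \<longlonglongrightarrow> indicator {p<..<q} x * D x"
        using lim by (auto intro!: tendsto_mult_right)
    qed (use intD[of "{p..q}" p q] in \<open>auto simp: D_def\<close>)
    then show ?thesis using D0 by (simp add: LIMSEQ_const_iff)
  qed
  have "AE x in lborel. indicator {- real n<..<real n} x * D x = 0" for n
  proof (rule AE_zero_if_primitive_zero)
    show "integrable lborel (\<lambda>x. indicator {- real n<..<real n} x * D x)"
      by (rule intD[of _ "- real n" "real n"]) auto
    fix y
    have "primitive (\<lambda>x. indicator {- real n<..<real n} x * D x) y = (\<integral>x. indicator {- real n<..<min y (real n)} x * D x \<partial>lborel)"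
      unfolding primitive_def
    proof (rule integral_cong_AE)
      show "AE x in lborel. indicator {..y} x * (indicator {- real n<..<real n} x * D x) = indicator {- real n<..<min y (real n)} x * D x"
        using AE_lborel_singleton[of y] by eventually_elim (auto simp: indicator_def)
    qed (auto simp: D_def)
    then show "primitive (\<lambda>x. indicator {- real n<..<real n} x * D x) y = 0" using zero by simp
  qed
  then have "AE x in lborel. \<forall>n::nat. indicator {- real n<..<real n} x * D x = 0"
    unfolding AE_all_countable by blast
  then show ?thesis
  proof eventually_elim
    case (elim x)
    obtain n :: nat where "\<bar>x\<bar> < real n" using reals_Archimedean2 by blast
    then have "x \<in> {- real n<..<real n}" by auto
    then have "D x = 0" using elim[rule_format, of n] by simp
    then show ?case by (simp add: D_def)
  qed
qed

abbreviation critical :: "real set" where "critical \<equiv> {y. \<exists>i\<in>states. u i y = 0}"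

text \<open>
A set without accumulation points has finitely many points in every bounded interval.
\<close>
lemma countable_critical: "countable critical"
proof -
  have "finite (critical \<inter> {- real n..real n})" for n
  proof (rule ccontr)
    assume "infinite (critical \<inter> {- real n..real n})"
    then obtain x where "x islimpt (critical \<inter> {- real n..real n})"
      using compact_eq_Bolzano_Weierstrass[THEN iffD1, OF compact_Icc, of "- real n" "real n"] by blast
    then have "x islimpt critical" by (rule islimpt_subset) auto
    then show False using isolated by blast
  qed
  then have "countable (\<Union>n. critical \<inter> {- real n..real n})"
    by (intro countable_UN) (auto intro: countable_finite)
  moreover have "x \<in> (\<Union>n. {- real n..real n})" for x
  proof -
    obtain n :: nat where "\<bar>x\<bar> < real n" using reals_Archimedean2 by blast
    then have "x \<in> {- real n..real n}" by auto
    then show ?thesis by blast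
  qed
  then have "critical \<subseteq> (\<Union>n. critical \<inter> {- real n..real n})" by blast
  ultimately show ?thesis using countable_subset by blast
qed

lemma AE_noncritical: "AE x in lborel. \<forall>i\<in>states. u i x \<noteq> 0"
  using AE_not_in[OF countable_imp_null_set_lborel[OF countable_critical]] by (auto elim!: eventually_mono)

lemma dens_eq_rho: "AE x in lborel. \<forall>i\<in>states. dens i x = \<rho> i x"
proof (intro AE_ball_countable' countable_finite)
  fix i assume i: "i \<in> states"
  show "AE x in lborel. dens i x = \<rho> i x"
    using AE_noncritical u_rho_eq_flux[OF i]
  proof eventually_elim
    case (elim x)
    have "u i x \<noteq> 0" using elim(1) i by blast
    then show ?case using elim(2) by (simp add: dens_def field_simps)
  qed
qed simp

lemma dens_continuous: "i \<in> states \<Longrightarrow> continuous_on {x. u i x \<noteq> 0} (dens i)"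
proof -
  assume i: "i \<in> states"
  have "continuous_on {x. u i x \<noteq> 0} (\<lambda>x. flux i x / u i x)"
    by (intro continuous_on_divide continuous_on_subset[OF flux_continuous[OF i]] continuous_on_subset[OF u_continuous[OF i]]) auto
  then show ?thesis
    by (rule continuous_on_cong[THEN iffD1, rotated -1, OF _ refl]) (simp add: dens_def)
qed

lemma dens_isCont:
  assumes i: "i \<in> states" and x: "u i x \<noteq> 0"
  shows "isCont (dens i) x"
proof -
  have "open {x. u i x \<noteq> 0}" by (rule open_Collect_neq[OF u_continuous[OF i] continuous_on_const])
  then show ?thesis using dens_continuous[OF i] x by (simp add: continuous_on_eq_continuous_at)
qed

lemma dens_measurable: "i \<in> states \<Longrightarrow> dens i \<in> borel_measurable borel"
  unfolding dens_def using u_measurable flux_measurable by measurable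

lemma flux_eq: "u i x \<noteq> 0 \<Longrightarrow> flux i x = u i x * dens i x"
  by (simp add: dens_def)

lemma AE_rho_nonneg: "AE x in lborel. \<forall>i\<in>states. 0 \<le> \<rho> i x"
  by (intro AE_ball_countable' countable_finite rho_nonneg) auto

lemma dens_nonneg:
  assumes i: "i \<in> states"
  shows "0 \<le> dens i x"
proof (cases "u i x = 0")
  case False
  show ?thesis
  proof (rule continuous_AE_nonneg[OF dens_isCont[OF i False] zero_less_one])
    show "AE t in lborel. \<bar>t - x\<bar> < 1 \<longrightarrow> 0 \<le> dens i t"
      using dens_eq_rho AE_rho_nonneg by eventually_elim (use i in auto)
  qed
qed (simp add: dens_def)

lemma flux_isCont: "i \<in> states \<Longrightarrow> isCont (flux i) x"
  using flux_continuous by (simp add: continuous_on_eq_continuous_at)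

text \<open>
Away from all critical points the forward equation holds in the classical sense.
\<close>
lemma flux_has_derivative:
  assumes i: "i \<in> states" and z: "\<And>j. j \<in> states \<Longrightarrow> u j z \<noteq> 0"
  shows "(flux i has_real_derivative (\<Sum>j\<in>states - {i}. lam j i * dens j z) - rate i * dens i z) (at z)"
  unfolding flux_def
proof (rule primitive_has_derivative[OF source_integrable[OF i], where d=1 and g="\<lambda>z. (\<Sum>j\<in>states - {i}. lam j i * dens j z) - rate i * dens i z"])
  show "isCont (\<lambda>z. (\<Sum>j\<in>states - {i}. lam j i * dens j z) - rate i * dens i z) z"
    by (intro continuous_intros dens_isCont i z) auto
  show "AE t in lborel. \<bar>t - z\<bar> < 1 \<longrightarrow> source i t = (\<Sum>j\<in>states - {i}. lam j i * dens j t) - rate i * dens i t"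
    using dens_eq_rho by eventually_elim (use i in \<open>auto simp: source_def\<close>)
qed simp

section \<open>Vanishing of the densities and the support\<close>
text \<open>
A point is silent if it lies outside the support of the densities.
\<close>
definition silent :: "real \<Rightarrow> bool" where
  "silent x \<longleftrightarrow> (\<exists>d>0. AE t in lborel. \<bar>t - x\<bar> < d \<longrightarrow> (\<forall>j\<in>states. \<rho> j t = 0))"

lemma silent_open:
  assumes "silent x"
  obtains d where "d > 0" "\<And>y. \<bar>y - x\<bar> < d \<Longrightarrow> silent y"
proof -
  obtain d where d: "d > 0" "AE t in lborel. \<bar>t - x\<bar> < d \<longrightarrow> (\<forall>j\<in>states. \<rho> j t = 0)"
    using assms unfolding silent_def by blast
  have "silent y" if y: "\<bar>y - x\<bar> < d" for y
    unfolding silent_def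
  proof (intro exI[of _ "d - \<bar>y - x\<bar>"] conjI)
    show "AE t in lborel. \<bar>t - y\<bar> < d - \<bar>y - x\<bar> \<longrightarrow> (\<forall>j\<in>states. \<rho> j t = 0)"
      using d(2) by eventually_elim auto
  qed (use y in simp)
  then show ?thesis using d(1) that by blast
qed

lemma silentI:
  assumes "a < x" "x < b" "AE t in lborel. a < t \<longrightarrow> t < b \<longrightarrow> (\<forall>j\<in>states. \<rho> j t = 0)"
  shows "silent x"
  unfolding silent_def
proof (intro exI[of _ "min (x - a) (b - x)"] conjI)
  show "AE t in lborel. \<bar>t - x\<bar> < min (x - a) (b - x) \<longrightarrow> (\<forall>j\<in>states. \<rho> j t = 0)"
    using assms(3) by eventually_elim auto
qed (use assms in simp)

lemma silent_flux:
  assumes s: "silent x" and i: "i \<in> states"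
  shows "flux i x = 0"
proof -
  obtain d where d: "d > 0" "AE t in lborel. \<bar>t - x\<bar> < d \<longrightarrow> (\<forall>j\<in>states. \<rho> j t = 0)"
    using s unfolding silent_def by blast
  show ?thesis
  proof (rule continuous_AE_zero[OF flux_isCont[OF i] d(1)])
    show "AE t in lborel. \<bar>t - x\<bar> < d \<longrightarrow> flux i t = 0"
      using d(2) u_rho_eq_flux[OF i]
    proof eventually_elim
      case (elim t)
      show ?case
      proof
        assume "\<bar>t - x\<bar> < d"
        then have "\<rho> i t = 0" using elim(1) i by blast
        then show "flux i t = 0" using elim(2) by simp
      qed
    qed
  qed
qed

text \<open>
Mass upstream of a point with vanishing flux would have to pass that point. Quantitatively, mass in
state \<open>i\<close> is lost at most at rate \<open>rate i\<close> while it travels with speed at least \<open>m\<close>, so the flux at \<open>x\<close> is at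
most \<open>rate i / m\<close> times the integral of the flux from \<open>x\<close> to the downstream end, where it vanishes;
hence it vanishes on the whole interval. Then state \<open>i\<close> carries no mass in the interval, and nothing
can enter it from the other states, whose densities must therefore vanish as well.
\<close>
lemma vanishing_upstream:
  assumes i: "i \<in> states" and pq: "p < q" and nz: "\<And>x. x \<in> {p..q} \<Longrightarrow> u i x \<noteq> 0"
    and z: "flux i (if u i p > 0 then q else p) = 0"
  shows "AE t in lborel. p < t \<longrightarrow> t < q \<longrightarrow> (\<forall>j\<in>states. \<rho> j t = 0)"
proof -
  \<comment> \<open>The sign \<open>s\<close> treats both directions of the flow at once; \<open>z\<close> is the downstream end.\<close>
  define s where "s = sgn (u i p)"
  define z where "z = (if u i p > 0 then q else p)"
  have s1: "s = 1 \<or> s = -1" using nz[of p] pq by (auto simp: s_def sgn_if)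
  have sgn_u: "0 < s * u i x" if x: "x \<in> {p..q}" for x
  proof (rule ccontr)
    assume "\<not> ?thesis"
    then have le: "s * u i x \<le> 0" by simp
    have "\<exists>c\<ge>p. c \<le> x \<and> s * u i c = 0"
    proof (rule IVT2')
      show "0 \<le> s * u i p" by (simp add: s_def sgn_if)
      show "continuous_on {p..x} (\<lambda>x. s * u i x)"
        by (intro continuous_intros continuous_on_subset[OF u_continuous[OF i]]) auto
    qed (use le x in auto)
    then obtain c where "p \<le> c" "c \<le> x" "s * u i c = 0" by blast
    then show False using nz[of c] s1 x by auto
  qed
  have abs_u: "\<bar>u i x\<bar> = s * u i x" if "x \<in> {p..q}" for x
    using sgn_u[OF that] s1 by auto
  have abs_flux: "\<bar>flux i x\<bar> = s * flux i x" if x: "x \<in> {p..q}" for x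
  proof -
    have "\<bar>flux i x\<bar> = \<bar>u i x\<bar> * dens i x"
      using flux_eq[OF nz[OF x]] dens_nonneg[OF i, of x] by (simp add: abs_mult)
    then show ?thesis using flux_eq[OF nz[OF x]] abs_u[OF x] by simp
  qed
  obtain m where m: "m > 0" "\<And>x. x \<in> {p..q} \<Longrightarrow> m \<le> \<bar>u i x\<bar>"
  proof -
    have "continuous_on {p..q} (\<lambda>x. \<bar>u i x\<bar>)"
      by (intro continuous_intros continuous_on_subset[OF u_continuous[OF i]]) auto
    then obtain x0 where "x0 \<in> {p..q}" "\<forall>x\<in>{p..q}. \<bar>u i x0\<bar> \<le> \<bar>u i x\<bar>"
      using continuous_attains_inf[of "{p..q}" "\<lambda>x. \<bar>u i x\<bar>"] pq by auto
    then show ?thesis using that[of "\<bar>u i x0\<bar>"] nz by auto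
  qed
  define K where "K = rate i / m"
  define k where "k t = indicator {p..q} t * \<bar>flux i t\<bar>" for t
  have ki: "integrable lborel k"
    unfolding k_def
    using borel_integrable_compact[of "{p..q}" "\<lambda>t. \<bar>flux i t\<bar>"]
    by (auto simp: set_integrable_def intro!: continuous_intros continuous_on_subset[OF flux_continuous[OF i]])
  define G where "G = primitive k"
  have Gmono: "G x \<le> G y" if "x \<le> y" for x y
  proof -
    have "0 \<le> G y - G x"
      unfolding G_def primitive_increment[OF ki that] by (intro Bochner_Integration.integral_nonneg) (simp add: k_def)
    then show ?thesis by simp
  qed
  \<comment> \<open>The integral of \<open>\<bar>flux i\<bar>\<close> between \<open>x\<close> and the downstream end.\<close>
  define h where "h x = s * (G z - G x)" for x
  have zpq: "z \<in> {p..q}" and flux_z: "flux i z = 0"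
    using pq assms(4) by (auto simp: z_def)
  \<comment> \<open>The loss term alone bounds the source from below, and it is controlled by the flux itself.\<close>
  have source_ge: "AE t in lborel. p < t \<and> t < q \<longrightarrow> - K * k t \<le> source i t"
    using u_rho_eq_flux[OF i] AE_rho_nonneg
  proof eventually_elim
    case (elim t)
    show ?case
    proof
      assume t: "p < t \<and> t < q"
      have "m * \<rho> i t \<le> \<bar>u i t\<bar> * \<rho> i t" using m(2)[of t] t elim(2) i by (intro mult_right_mono) auto
      also have "\<dots> = \<bar>flux i t\<bar>"
        using elim(2) i unfolding elim(1)[symmetric] by (simp add: abs_mult)
      finally have "K * (m * \<rho> i t) \<le> K * k t"
        using t m(1) rate_pos[OF i] by (intro mult_left_mono) (auto simp: k_def K_def)
      then have "rate i * \<rho> i t \<le> K * k t" using m(1) by (simp add: K_def)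
      moreover have "0 \<le> (\<Sum>j\<in>states - {i}. lam j i * \<rho> j t)"
        using elim(2) lam_pos[OF _ i] by (intro sum_nonneg mult_nonneg_nonneg) (auto intro: less_imp_le)
      ultimately show "- K * k t \<le> source i t" unfolding source_def by linarith
    qed
  qed
  have growth: "\<bar>flux i x\<bar> \<le> K * h x" if x: "x \<in> {p..q}" for x
  proof -
    have inc: "- K * (G b - G a) \<le> flux i b - flux i a" if "p \<le> a" "a \<le> b" "b \<le> q" for a b
    proof -
      have "primitive (\<lambda>t. - K * k t) b - primitive (\<lambda>t. - K * k t) a \<le> flux i b - flux i a"
        unfolding flux_def
        by (rule primitive_increment_mono[OF integrable_mult_right[OF ki] source_integrable[OF i] that(2)])
           (use source_ge that in \<open>auto elim!: eventually_mono\<close>)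
      then show ?thesis unfolding primitive_cmult G_def by (simp add: right_diff_distrib)
    qed
    show ?thesis
    proof (cases "u i p > 0")
      case True
      then have "s = 1" "z = q" by (auto simp: s_def z_def)
      then show ?thesis using inc[of x q] x flux_z abs_flux[OF x] by (simp add: h_def)
    next
      case False
      then have "s = -1" "z = p" using nz[of p] pq by (auto simp: s_def z_def sgn_if)
      then show ?thesis using inc[of p x] x flux_z abs_flux[OF x] by (simp add: h_def)
    qed
  qed
  have h0: "h x = 0" if "x \<in> {p..q}" for x
  proof (rule linear_growth_vanishes[where h=h and h'="\<lambda>x. - s * \<bar>flux i x\<bar>" and z=z and K=K, OF _ _ _ _ zpq _ that])
    show "continuous_on {p..q} h"
      unfolding h_def G_def by (intro continuous_intros continuous_on_subset[OF primitive_continuous[OF ki]]) auto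
    show "h z = 0" by (simp add: h_def)
    fix x assume x: "p < x" "x < q"
    have "(G has_real_derivative \<bar>flux i x\<bar>) (at x)"
      unfolding G_def
    proof (rule primitive_has_derivative[OF ki, where d="min (x - p) (q - x)"])
      show "AE t in lborel. \<bar>t - x\<bar> < min (x - p) (q - x) \<longrightarrow> k t = \<bar>flux i t\<bar>"
        by (rule AE_I2) (auto simp: k_def indicator_def)
    qed (use x in \<open>auto intro!: continuous_intros flux_isCont i\<close>)
    then show "(h has_real_derivative - s * \<bar>flux i x\<bar>) (at x)"
      unfolding h_def by (auto intro!: derivative_eq_intros)
    show "\<bar>- s * \<bar>flux i x\<bar>\<bar> \<le> K * h x"
      using growth[of x] x s1 by auto
  next
    fix x assume x: "x \<in> {p..q}"
    show "0 \<le> h x"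
    proof (cases "u i p > 0")
      case True
      then show ?thesis using Gmono[of x q] x by (simp add: h_def s_def z_def)
    next
      case False
      then show ?thesis using nz[of p] pq Gmono[of p x] x by (simp add: h_def s_def z_def sgn_if)
    qed
  qed
  have flux0: "flux i x = 0" if "x \<in> {p..q}" for x
    using growth[OF that] h0[OF that] by simp
  have rho0: "AE t in lborel. p < t \<and> t < q \<longrightarrow> \<rho> i t = 0"
    using u_rho_eq_flux[OF i]
  proof eventually_elim
    case (elim t)
    show ?case
    proof
      assume "p < t \<and> t < q"
      then have t: "t \<in> {p..q}" by simp
      then show "\<rho> i t = 0" using elim flux0[OF t] nz[OF t] by simp
    qed
  qed
  have sn: "AE t in lborel. 0 \<le> indicator {p<..q} t * source i t"
    using rho0 AE_rho_nonneg AE_lborel_singleton[of q]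
  proof eventually_elim
    case (elim t)
    show ?case
    proof (cases "t \<in> {p<..q}")
      case True
      then have "\<rho> i t = 0" using elim by auto
      moreover have "0 \<le> (\<Sum>j\<in>states - {i}. lam j i * \<rho> j t)"
        using elim(2) lam_pos[OF _ i] by (intro sum_nonneg mult_nonneg_nonneg) (auto intro: less_imp_le)
      ultimately show ?thesis by (simp add: source_def)
    qed simp
  qed
  have "(\<integral>t. indicator {p<..q} t * source i t \<partial>lborel) = 0"
    using primitive_increment[OF source_integrable[OF i] less_imp_le[OF pq]] flux0[of p] flux0[of q] pq
    by (simp add: flux_def)
  then have "AE t in lborel. indicator {p<..q} t * source i t = 0"
    using integral_nonneg_eq_0_iff_AE[OF integrable_indicator_times[OF source_integrable[OF i]] sn] by simp
  then show ?thesis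
    using rho0 AE_rho_nonneg
  proof eventually_elim
    case (elim t)
    show ?case
    proof (intro impI ballI)
      fix j assume t: "p < t" "t < q" and j: "j \<in> states"
      have ri: "\<rho> i t = 0" using elim(2) t by blast
      show "\<rho> j t = 0"
      proof (cases "j = i")
        case False
        have "(\<Sum>j\<in>states - {i}. lam j i * \<rho> j t) = 0"
          using elim(1) t ri by (simp add: source_def)
        moreover have "\<forall>j\<in>states - {i}. 0 \<le> lam j i * \<rho> j t"
        proof
          fix k assume "k \<in> states - {i}"
          then show "0 \<le> lam k i * \<rho> k t"
            using elim(3) less_imp_le[OF lam_pos[OF _ i, of k]] by (intro mult_nonneg_nonneg) auto
        qed
        ultimately have "lam j i * \<rho> j t = 0"
          using sum_nonneg_eq_0_iff[of "states - {i}" "\<lambda>j. lam j i * \<rho> j t"] j False by auto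
        then show ?thesis using lam_pos[OF j i False] by simp
      qed (use ri in simp)
    qed
  qed
qed

text \<open>
The vanishing extends a little beyond \<open>x\<close>, because \<open>u i x \<noteq> 0\<close>; therefore \<open>x\<close> itself is silent.
\<close>
lemma silent_left:
  assumes i: "i \<in> states" and x: "u i x > 0" and xz: "x < z"
    and nz: "\<And>y. y \<in> {x..z} \<Longrightarrow> u i y \<noteq> 0" and z: "flux i z = 0"
  shows "silent x"
proof -
  obtain e where e: "e > 0" "\<And>y. \<bar>y - x\<bar> < e \<Longrightarrow> \<bar>u i y - u i x\<bar> < u i x"
    using u_isCont[OF i, of x] x unfolding continuous_at_eps_delta dist_real_def by meson
  have pos: "u i y > 0" if "\<bar>y - x\<bar> < e" for y using e(2)[OF that] by linarith
  have "AE t in lborel. x - e/2 < t \<longrightarrow> t < z \<longrightarrow> (\<forall>j\<in>states. \<rho> j t = 0)"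
  proof (rule vanishing_upstream[OF i])
    show "x - e/2 < z" using e xz by simp
    show "u i y \<noteq> 0" if "y \<in> {x - e/2..z}" for y
      using pos[of y] nz[of y] that e(1) by (cases "y < x") auto
    show "flux i (if 0 < u i (x - e/2) then z else x - e/2) = 0"
      using pos[of "x - e/2"] e(1) z by simp
  qed
  then show ?thesis by (rule silentI[rotated 2]) (use e xz in auto)
qed

lemma silent_right:
  assumes i: "i \<in> states" and x: "u i x < 0" and xz: "z < x"
    and nz: "\<And>y. y \<in> {z..x} \<Longrightarrow> u i y \<noteq> 0" and z: "flux i z = 0"
  shows "silent x"
proof -
  obtain e where e: "e > 0" "\<And>y. \<bar>y - x\<bar> < e \<Longrightarrow> \<bar>u i y - u i x\<bar> < - u i x"
    using u_isCont[OF i, of x] x unfolding continuous_at_eps_delta dist_real_def by (metis neg_0_less_iff_less)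
  have neg: "u i y < 0" if "\<bar>y - x\<bar> < e" for y using e(2)[OF that] by linarith
  have nz': "u i y \<noteq> 0" if "y \<in> {z..x + e/2}" for y
    using neg[of y] nz[of y] that e(1) by (cases "x < y") auto
  have "\<not> u i z > 0"
  proof
    assume "u i z > 0"
    have "\<exists>c\<ge>z. c \<le> x \<and> u i c = 0"
      by (rule IVT2') (use \<open>u i z > 0\<close> x xz in \<open>auto intro: continuous_on_subset[OF u_continuous[OF i]]\<close>)
    then show False using nz by auto
  qed
  have "AE t in lborel. z < t \<longrightarrow> t < x + e/2 \<longrightarrow> (\<forall>j\<in>states. \<rho> j t = 0)"
    by (rule vanishing_upstream[OF i]) (use e(1) xz nz' z \<open>\<not> u i z > 0\<close> in auto)
  then show ?thesis by (rule silentI[rotated 2]) (use e xz in auto)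
qed

text \<open>
If the trajectory meets a critical point of \<open>u i\<close>, it stays there, so a critical point can occur only
at the end of the way.
\<close>
lemma silent_flow:
  assumes i: "i \<in> states" and t: "t \<ge> 0" and s: "silent (flow (u i) t x)"
  shows "silent x"
proof -
  have fc: "forward_complete (u i)" by (rule forward_complete_u[OF i])
  define y where "y = flow (u i) t x"
  have sy: "silent y" using s by (simp add: y_def)
  obtain d where d: "d > 0" "\<And>y'. \<bar>y' - y\<bar> < d \<Longrightarrow> silent y'" using silent_open[OF sy] by blast
  have crit: "compact ({a..b} \<inter> {c. u i c = 0})" for a b
    by (intro compact_Int_closed closed_Collect_eq[OF u_continuous[OF i] continuous_on_const]) simp
  consider "u i x = 0" | "u i x > 0" | "u i x < 0" by linarith
  then show ?thesis
  proof cases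
    case 1
    then show ?thesis using s flow_critical[OF fc 1 t] by simp
  next
    case 2
    have xy: "x \<le> y" unfolding y_def by (rule flow_ge[OF fc _ t]) (use 2 in auto)
    show ?thesis
    proof (cases "{x..y} \<inter> {c. u i c = 0} = {}")
      case True
      then have nz: "\<And>v. v \<in> {x..y} \<Longrightarrow> u i v \<noteq> 0" by blast
      show ?thesis
      proof (cases "x = y")
        case False
        show ?thesis by (rule silent_left[OF i 2 _ nz silent_flux[OF sy i]]) (use xy False in auto)
      qed (use sy in simp)
    next
      case False
      obtain c where c: "c \<in> {x..y} \<inter> {c. u i c = 0}" "\<And>c'. c' \<in> {x..y} \<inter> {c. u i c = 0} \<Longrightarrow> c \<le> c'"
        using compact_attains_inf[OF crit False] by blast
      have xc: "x < c" using c(1) 2 by (cases "x = c") auto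
      have "y \<le> c" unfolding y_def by (rule flow_le[OF fc _ t]) (use c(1) in auto)
      then have yc: "y = c" using c(1) by simp
      \<comment> \<open>The end point is critical for \<open>u i\<close>, so the argument starts from a slightly earlier silent point.\<close>
      obtain z where zm: "max x (y - d) < z" and zy: "z < y"
        using dense[of "max x (y - d)" y] xc yc d(1) by auto
      have z: "x < z" "\<bar>z - y\<bar> < d" using zm zy by auto
      have nz: "u i v \<noteq> 0" if "v \<in> {x..z}" for v using c(2)[of v] that z zy yc by auto
      show ?thesis by (rule silent_left[OF i 2 z(1) nz silent_flux[OF d(2)[OF z(2)] i]])
    qed
  next
    case 3
    have xy: "y \<le> x" unfolding y_def by (rule flow_le[OF fc _ t]) (use 3 in auto)
    show ?thesis
    proof (cases "{y..x} \<inter> {c. u i c = 0} = {}")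
      case True
      then have nz: "\<And>v. v \<in> {y..x} \<Longrightarrow> u i v \<noteq> 0" by blast
      show ?thesis
      proof (cases "x = y")
        case False
        show ?thesis by (rule silent_right[OF i 3 _ nz silent_flux[OF sy i]]) (use xy False in auto)
      qed (use sy in simp)
    next
      case False
      obtain c where c: "c \<in> {y..x} \<inter> {c. u i c = 0}" "\<And>c'. c' \<in> {y..x} \<inter> {c. u i c = 0} \<Longrightarrow> c' \<le> c"
        using compact_attains_sup[OF crit False] by blast
      have xc: "c < x" using c(1) 3 by (cases "x = c") auto
      have "c \<le> y" unfolding y_def by (rule flow_ge[OF fc _ t]) (use c(1) in auto)
      then have yc: "y = c" using c(1) by simp
      \<comment> \<open>As before, a silent point slightly upstream of the critical end point.\<close>
      obtain z where zm: "z < min x (y + d)" and zy: "y < z"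
        using dense[of y "min x (y + d)"] xc yc d(1) by auto
      have z: "z < x" "\<bar>z - y\<bar> < d" using zm zy by auto
      have nz: "u i v \<noteq> 0" if "v \<in> {z..x}" for v using c(2)[of v] that z zy yc by auto
      show ?thesis by (rule silent_right[OF i 3 z(1) nz silent_flux[OF d(2)[OF z(2)] i]])
    qed
  qed
qed

text \<open>
Finite compositions of flows, encoded as lists of pairs of a state and a duration.
\<close>
abbreviation admissible :: "(nat \<times> real) list \<Rightarrow> bool" where
  "admissible ps \<equiv> (\<forall>(i, t)\<in>set ps. i \<in> states \<and> 0 \<le> t)"
abbreviation run :: "(nat \<times> real) list \<Rightarrow> real \<Rightarrow> real" where
  "run ps \<equiv> fold (\<lambda>(i, t). flow (u i) t) ps"

lemma silent_run: "admissible ps \<Longrightarrow> silent (run ps x) \<Longrightarrow> silent x"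
proof (induction ps arbitrary: x)
  case (Cons p ps)
  obtain i t where p: "p = (i, t)" by (cases p)
  have it: "i \<in> states" "0 \<le> t" using Cons.prems(1) p by auto
  have "silent (flow (u i) t x)" using Cons p by auto
  then show ?case by (rule silent_flow[OF it])
qed simp

lemma minimal_invariant_set_reach:
  assumes J: "minimal_invariant_set N u J" and x: "x \<in> J" and y: "y \<in> J"
  obtains ps where "admissible ps" "run ps x = y"
proof -
  \<comment> \<open>The set reachable from \<open>x\<close> is invariant and contained in \<open>J\<close>, hence equal to \<open>J\<close>.\<close>
  define R where "R = {run ps x | ps. admissible ps}"
  have "x \<in> R" unfolding R_def by (auto intro!: exI[of _ "[]"])
  then have ne: "R \<noteq> {}" by blast
  have "invariant_set N u R"
    unfolding invariant_set_def
  proof (intro conjI ne allI impI ballI)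
    fix ps z assume ps: "admissible ps" and "z \<in> R"
    then obtain qs where qs: "admissible qs" "z = run qs x" unfolding R_def by blast
    have "run ps z = run (qs @ ps) x" "admissible (qs @ ps)" using ps qs by auto
    then show "run ps z \<in> R" unfolding R_def by blast
  qed
  moreover have "R \<subseteq> J"
    using J x unfolding R_def minimal_invariant_set_def invariant_set_def by blast
  ultimately have "R = J"
    using J ne unfolding minimal_invariant_set_def by blast
  then show ?thesis using y that unfolding R_def by blast
qed

lemma AE_silent: "AE t in lborel. silent t \<longrightarrow> (\<forall>j\<in>states. \<rho> j t = 0)"
proof -
  \<comment> \<open>Countably many rational intervals cover the silent set.\<close>
  define good where "good = {p \<in> \<rat> \<times> \<rat>. AE t in lborel. fst p < t \<longrightarrow> t < snd p \<longrightarrow> (\<forall>j\<in>states. \<rho> j t = 0)}"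
  have "countable good"
    unfolding good_def by (rule countable_subset[of _ "\<rat> \<times> \<rat>"]) (auto intro: countable_rat)
  moreover have "\<forall>p\<in>good. AE t in lborel. fst p < t \<longrightarrow> t < snd p \<longrightarrow> (\<forall>j\<in>states. \<rho> j t = 0)"
    by (simp add: good_def)
  ultimately have "AE t in lborel. \<forall>p\<in>good. fst p < t \<longrightarrow> t < snd p \<longrightarrow> (\<forall>j\<in>states. \<rho> j t = 0)"
    by (subst AE_ball_countable) auto
  then show ?thesis
  proof eventually_elim
    case (elim t)
    show ?case
    proof
      assume "silent t"
      then obtain d where d: "d > 0" "AE s in lborel. \<bar>s - t\<bar> < d \<longrightarrow> (\<forall>j\<in>states. \<rho> j s = 0)"
        unfolding silent_def by blast
      obtain a where a: "a \<in> \<rat>" "t - d < a" "a < t" using Rats_dense_in_real[of "t - d" t] d(1) by auto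
      obtain b where b: "b \<in> \<rat>" "t < b" "b < t + d" using Rats_dense_in_real[of t "t + d"] d(1) by auto
      have "AE s in lborel. a < s \<longrightarrow> s < b \<longrightarrow> (\<forall>j\<in>states. \<rho> j s = 0)"
        using d(2)
      proof eventually_elim
        case (elim s)
        show ?case
        proof (intro impI)
          assume "a < s" "s < b"
          then have "\<bar>s - t\<bar> < d" using a b by linarith
          then show "\<forall>j\<in>states. \<rho> j s = 0" using elim by blast
        qed
      qed
      then have "(a, b) \<in> good" using a b by (simp add: good_def)
      then show "\<forall>j\<in>states. \<rho> j t = 0" using elim a b by fastforce
    qed
  qed
qed

lemma silent_set_null:
  assumes J: "\<And>x. x \<in> J \<Longrightarrow> silent x"
  shows "measure \<mu> (J \<times> states) = 0"
proof (cases "J \<times> states \<in> sets \<mu>")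
  case True
  then have Jp: "J \<times> states \<in> sets phase" by (simp add: sets_\<mu>)
  have "emeasure \<mu> (J \<times> states) = (\<integral>\<^sup>+p. indicator (J \<times> states) p \<partial>\<mu>)"
    using True by simp
  also have "\<dots> = (\<Sum>j\<in>states. \<integral>\<^sup>+\<xi>. indicator (J \<times> states) (\<xi>, j) \<partial>component \<mu> j)"
    by (rule nn_integral_component[symmetric]) (use Jp in simp)
  also have "\<dots> = 0"
  proof (rule sum.neutral, rule ballI)
    fix j assume j: "j \<in> states"
    have m: "(\<lambda>\<xi>. indicator (J \<times> states) (\<xi>, j) :: ennreal) \<in> borel_measurable borel"
      by (rule measurable_slice[OF _ j]) (use Jp in simp)
    have "(\<integral>\<^sup>+\<xi>. indicator (J \<times> states) (\<xi>, j) \<partial>component \<mu> j)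
        = (\<integral>\<^sup>+\<xi>. ennreal (\<rho> j \<xi>) * indicator (J \<times> states) (\<xi>, j) \<partial>lborel)"
      unfolding component_eq[OF j] by (rule nn_integral_density) (use rho_measurable[OF j] m in auto)
    also have "\<dots> = 0"
    proof -
      have "AE \<xi> in lborel. ennreal (\<rho> j \<xi>) * indicator (J \<times> states) (\<xi>, j) = 0"
        using AE_silent
      proof eventually_elim
        case (elim \<xi>)
        show ?case
        proof (cases "\<xi> \<in> J")
          case True
          then have "\<rho> j \<xi> = 0" using elim J j by blast
          then show ?thesis by simp
        qed simp
      qed
      from nn_integral_cong_AE[OF this] show ?thesis by simp
    qed
    finally show "(\<integral>\<^sup>+\<xi>. indicator (J \<times> states) (\<xi>, j) \<partial>component \<mu> j) = 0" .
  qed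
  finally show ?thesis by (simp add: measure_def)
qed (simp add: measure_notin_sets)

text \<open>
If one point of \<open>J\<close> were silent, then so would all points of \<open>J\<close>, as each of them reaches that point,
and \<open>J\<close> would be a null set.
\<close>
lemma not_silent_in_support:
  assumes J: "minimal_invariant_set N u J" and pos: "measure \<mu> (J \<times> states) > 0" and x: "x \<in> J"
  shows "\<not> silent x"
proof
  assume sx: "silent x"
  have "silent y" if y: "y \<in> J" for y
  proof -
    obtain ps where "admissible ps" "run ps y = x" by (rule minimal_invariant_set_reach[OF J y x])
    then show ?thesis using silent_run[of ps y] sx by simp
  qed
  then show False using silent_set_null[of J] pos by simp
qed

end

section \<open>A linear differential equation with a singular point\<close>
lemma eventually_at_right_0_I:
  "e > 0 \<Longrightarrow> (\<And>x. 0 < x \<Longrightarrow> x < e \<Longrightarrow> P x) \<Longrightarrow> eventually P (at_right (0::real))"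
  by (auto simp: eventually_at_right_field intro!: exI[of _ e])

lemma powr_at_right_0:
  fixes p :: real
  shows "p > 0 \<Longrightarrow> ((\<lambda>x. x powr p) \<longlongrightarrow> 0) (at_right 0)"
    and "p < 0 \<Longrightarrow> filterlim (\<lambda>x. x powr p) at_top (at_right 0)"
proof -
  show z: "((\<lambda>x. x powr p) \<longlongrightarrow> 0) (at_right 0)" if "p > 0" for p :: real
    by (rule tendsto_zero_powrI[of "\<lambda>x. x" _ "\<lambda>_. p" p])
       (use that in \<open>auto intro!: tendsto_eq_intros eventually_at_right_0_I[of 1]\<close>)
  show "filterlim (\<lambda>x. x powr p) at_top (at_right 0)" if "p < 0"
  proof -
    have "filterlim (\<lambda>x. inverse (x powr (- p))) at_top (at_right 0)"
      by (rule filterlim_inverse_at_top[OF z]) (use that in \<open>auto intro!: eventually_at_right_0_I[of 1]\<close>)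
    then show ?thesis by (simp add: powr_minus)
  qed
qed

lemma nondecreasing_bounded_at_right_0:
  fixes h :: "real \<Rightarrow> real"
  assumes e: "e > 0" and mono: "\<And>x y. 0 < x \<Longrightarrow> x \<le> y \<Longrightarrow> y < e \<Longrightarrow> h x \<le> h y"
    and bdd: "\<And>x. 0 < x \<Longrightarrow> x < e \<Longrightarrow> B \<le> h x"
  obtains L where "(h \<longlongrightarrow> L) (at_right 0)" "\<And>x. 0 < x \<Longrightarrow> x < e \<Longrightarrow> L \<le> h x"
proof -
  define L where "L = Inf (h ` {0<..<e})"
  have bb: "bdd_below (h ` {0<..<e})" using bdd by (auto intro!: bdd_belowI)
  have ne: "h ` {0<..<e} \<noteq> {}" using e by auto
  have le: "L \<le> h x" if "0 < x" "x < e" for x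
    unfolding L_def by (rule cInf_lower[OF _ bb]) (use that in auto)
  have "(h \<longlongrightarrow> L) (at_right 0)"
  proof (rule order_tendstoI)
    fix a assume "a < L"
    then show "eventually (\<lambda>x. a < h x) (at_right 0)"
      using le by (intro eventually_at_right_0_I[OF e]) (auto intro: less_le_trans)
  next
    fix a assume "L < a"
    then obtain y where y: "0 < y" "y < e" "h y < a"
      unfolding L_def by (subst (asm) cInf_less_iff[OF ne bb]) auto
    then show "eventually (\<lambda>x. h x < a) (at_right 0)"
    proof (intro eventually_at_right_0_I[of y] y(1))
      fix x assume "0 < x" "x < y"
      then have "h x \<le> h y" using mono[of x y] y(2) by simp
      then show "h x < a" using y(3) by simp
    qed
  qed
  then show ?thesis using le that by blast
qed

text \<open>
The scalar equation \<open>w' = b - l * w / v\<close> to the right of a simple zero of \<open>v\<close>. In the application \<open>v\<close> is the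
field with the critical point, \<open>w\<close> its flux, so that \<open>w / v\<close> is the density, and \<open>b\<close> is the inflow from
the other states.
\<close>
locale boundary_ode =
  fixes v v' w b :: "real \<Rightarrow> real" and a l \<delta> C b0 :: real
  assumes a_nz: "a \<noteq> 0" and l_pos: "l > 0" and \<delta>_pos: "\<delta> > 0"
    and v_deriv: "\<And>x. (v has_real_derivative v' x) (at x)"
    and v_lim: "((\<lambda>x. v x / x) \<longlongrightarrow> - a) (at_right 0)"
    and v'_lim: "(v' \<longlongrightarrow> - a) (at_right 0)"
    and v_quad: "eventually (\<lambda>x. \<bar>v x + a * x\<bar> \<le> C * x\<^sup>2) (at_right 0)"
    and v_nz: "\<And>x. 0 < x \<Longrightarrow> x < \<delta> \<Longrightarrow> v x \<noteq> 0"
    and w_deriv: "\<And>x. 0 < x \<Longrightarrow> x < \<delta> \<Longrightarrow> (w has_real_derivative b x - l * (w x / v x)) (at x)"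
    and w_lim: "(w \<longlongrightarrow> 0) (at_right 0)"
    and r_nonneg: "\<And>x. 0 < x \<Longrightarrow> x < \<delta> \<Longrightarrow> 0 \<le> w x / v x"
    and b_nonneg: "\<And>x. 0 < x \<Longrightarrow> x < \<delta> \<Longrightarrow> 0 \<le> b x"
    and b_lim: "(b \<longlongrightarrow> b0) (at_right 0)"
begin

definition integrating_factor :: "(real \<Rightarrow> real) \<Rightarrow> real \<Rightarrow> bool" where
  "integrating_factor F \<epsilon> \<longleftrightarrow> 0 < \<epsilon> \<and> \<epsilon> \<le> \<delta> \<and>
     (\<forall>x. 0 < x \<and> x < \<epsilon> \<longrightarrow> F x > 0 \<and> (F has_real_derivative l * F x / v x) (at x)) \<and>
     ((\<lambda>x. F x * x powr (l / a)) \<longlongrightarrow> 1) (at_right 0)"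

text \<open>
The exact factor is the exponential of a primitive of \<open>l / v\<close>. Splitting off the singular part
\<open>- l / (a * x)\<close> leaves a bounded function, whose primitive tends to \<open>0\<close> at \<open>0\<close>.
\<close>
lemma integrating_factor_exists: "\<exists>F \<epsilon>. integrating_factor F \<epsilon>"
proof -
  have "eventually (\<lambda>x. \<bar>a\<bar> / 2 < \<bar>v x / x\<bar>) (at_right 0)"
    by (rule order_tendstoD(1)[OF tendsto_rabs[OF v_lim]]) (use a_nz in auto)
  from eventually_conj[OF this v_quad] obtain e where e: "e > 0"
    "\<And>x. 0 < x \<Longrightarrow> x < e \<Longrightarrow> \<bar>a\<bar> / 2 < \<bar>v x / x\<bar>"
    "\<And>x. 0 < x \<Longrightarrow> x < e \<Longrightarrow> \<bar>v x + a * x\<bar> \<le> C * x\<^sup>2"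
    unfolding eventually_at_right_field by auto
  define \<epsilon> where "\<epsilon> = min e \<delta>"
  have \<epsilon>: "0 < \<epsilon>" "\<epsilon> \<le> \<delta>" "\<epsilon> \<le> e" using e(1) \<delta>_pos by (auto simp: \<epsilon>_def)
  \<comment> \<open>\<open>k\<close> is what remains of \<open>l / v\<close> when its singular part \<open>- l / (a * x)\<close> is removed; the quadratic bound
    on \<open>v x + a * x\<close> makes it bounded.\<close>
  define k where "k x = l * (1 / v x + 1 / (a * x))" for x
  define \<kappa> where "\<kappa> x = indicator {0<..<\<epsilon>} x * k x" for x
  have vc: "isCont v x" for x using v_deriv[of x] by (rule DERIV_isCont)
  have kc: "isCont k x" if "0 < x" "x < \<epsilon>" for x
    unfolding k_def using that v_nz[of x] \<epsilon> a_nz by (intro continuous_intros vc) auto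
  have C_nn: "0 \<le> C"
  proof -
    have "0 \<le> C * (\<epsilon>/2)\<^sup>2" using e(3)[of "\<epsilon>/2"] \<epsilon> by linarith
    then show ?thesis using \<epsilon>(1) by (simp add: zero_le_mult_iff)
  qed
  have kb: "\<bar>k x\<bar> \<le> 2 * l * C / a\<^sup>2" if x: "0 < x" "x < \<epsilon>" for x
  proof -
    have vx: "\<bar>a\<bar> / 2 * x \<le> \<bar>v x\<bar>"
      using e(2)[of x] x \<epsilon> by (simp add: abs_divide pos_less_divide_eq)
    have nz: "v x \<noteq> 0" "x \<noteq> 0" using v_nz[of x] x \<epsilon> by auto
    have "k x = l * (v x + a * x) / (a * x * v x)"
      using nz a_nz by (simp add: k_def field_simps)
    then have "\<bar>k x\<bar> = l * \<bar>v x + a * x\<bar> / (\<bar>a\<bar> * x * \<bar>v x\<bar>)"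
      using l_pos x by (simp add: abs_mult abs_divide)
    also have "\<dots> \<le> l * (C * x\<^sup>2) / (\<bar>a\<bar> * x * (\<bar>a\<bar> / 2 * x))"
    proof (rule frac_le)
      show "l * \<bar>v x + a * x\<bar> \<le> l * (C * x\<^sup>2)" using e(3)[of x] x \<epsilon> l_pos by simp
      show "\<bar>a\<bar> * x * (\<bar>a\<bar> / 2 * x) \<le> \<bar>a\<bar> * x * \<bar>v x\<bar>" using vx x by (intro mult_left_mono) auto
    qed (use C_nn l_pos x a_nz in auto)
    also have "\<dots> = 2 * l * C / a\<^sup>2"
      using x a_nz by (simp add: field_simps power2_eq_square)
    finally show ?thesis .
  qed
  have \<kappa>i: "integrable lborel \<kappa>"
  proof (rule Bochner_Integration.integrable_bound)
    show "integrable lborel (\<lambda>x. indicator {0<..<\<epsilon>} x * (2 * l * C / a\<^sup>2))"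
      by (rule integrable_mult_left, rule integrable_real_indicator) (use \<epsilon> in simp_all)
    have "continuous_on {0<..<\<epsilon>} k"
      by (rule continuous_at_imp_continuous_on) (use kc in auto)
    from borel_measurable_continuous_on_indicator[OF _ this]
    show "\<kappa> \<in> borel_measurable lborel" unfolding \<kappa>_def by simp
    show "AE x in lborel. norm (\<kappa> x) \<le> norm (indicator {0<..<\<epsilon>} x * (2 * l * C / a\<^sup>2))"
      using kb C_nn l_pos by (intro AE_I2) (auto simp: \<kappa>_def indicator_def)
  qed
  define p where "p x = primitive \<kappa> x - primitive \<kappa> 0" for x
  have p0: "(p \<longlongrightarrow> 0) (at_right 0)"
  proof -
    have "isCont (primitive \<kappa>) 0"
      using primitive_continuous[OF \<kappa>i] by (simp add: continuous_on_eq_continuous_at)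
    then have "(primitive \<kappa> \<longlongrightarrow> primitive \<kappa> 0) (at_right 0)"
      unfolding isCont_def by (rule filterlim_mono) (auto simp: at_le)
    from tendsto_diff[OF this tendsto_const[of "primitive \<kappa> 0"]] show ?thesis by (simp add: p_def[abs_def])
  qed
  have pd: "(p has_real_derivative k x) (at x)" if x: "0 < x" "x < \<epsilon>" for x
  proof -
    have "(primitive \<kappa> has_real_derivative k x) (at x)"
    proof (rule primitive_has_derivative[OF \<kappa>i kc[OF x], of "min x (\<epsilon> - x)"])
      show "AE t in lborel. \<bar>t - x\<bar> < min x (\<epsilon> - x) \<longrightarrow> \<kappa> t = k t"
        by (rule AE_I2) (auto simp: \<kappa>_def indicator_def)
    qed (use x in auto)
    then show ?thesis unfolding p_def by (auto intro!: derivative_eq_intros)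
  qed
  define F where "F x = x powr (- l / a) * exp (p x)" for x
  have "integrating_factor F \<epsilon>"
    unfolding integrating_factor_def
  proof (intro conjI allI impI \<epsilon>(1,2); (elim conjE)?)
    fix x assume x: "0 < x" "x < \<epsilon>"
    show "F x > 0" using x by (simp add: F_def)
    have "v x \<noteq> 0" using v_nz[of x] x \<epsilon> by simp
    have "(F has_real_derivative (- l / a) * x powr (- l / a - 1) * exp (p x) + x powr (- l / a) * (exp (p x) * k x)) (at x)"
      unfolding F_def using x pd[OF x] by (auto intro!: derivative_eq_intros has_real_derivative_powr)
    also have "(- l / a) * x powr (- l / a - 1) * exp (p x) + x powr (- l / a) * (exp (p x) * k x) = F x * ((- l / a) / x + k x)"
      using x by (simp add: F_def powr_diff algebra_simps)
    also have "(- l / a) / x + k x = l / v x"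
      using x a_nz \<open>v x \<noteq> 0\<close> by (simp add: k_def field_simps)
    finally show "(F has_real_derivative l * F x / v x) (at x)" by (simp add: mult.commute)
  next
    have "((\<lambda>x. exp (p x)) \<longlongrightarrow> 1) (at_right 0)" using tendsto_exp[OF p0] by simp
    moreover have "eventually (\<lambda>x. exp (p x) = F x * x powr (l / a)) (at_right 0)"
      by (rule eventually_at_right_0_I[of 1]) (simp_all add: F_def powr_add[symmetric])
    ultimately show "((\<lambda>x. F x * x powr (l / a)) \<longlongrightarrow> 1) (at_right 0)"
      by (rule Lim_transform_eventually)
  qed
  then show ?thesis by blast
qed

lemma
  assumes F: "integrating_factor F \<epsilon>"
  shows factor_range: "0 < \<epsilon>" "\<epsilon> \<le> \<delta>"
    and factor_pos: "0 < x \<Longrightarrow> x < \<epsilon> \<Longrightarrow> F x > 0"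
    and factor_deriv: "0 < x \<Longrightarrow> x < \<epsilon> \<Longrightarrow> (F has_real_derivative l * F x / v x) (at x)"
    and factor_lim: "((\<lambda>x. F x * x powr (l / a)) \<longlongrightarrow> 1) (at_right 0)"
  using F unfolding integrating_factor_def by blast+

lemma factor_times_w:
  assumes F: "integrating_factor F \<epsilon>" and x: "0 < x" "x < \<epsilon>"
  shows "((\<lambda>x. w x * F x) has_real_derivative b x * F x) (at x)"
proof -
  have x': "x < \<delta>" using x factor_range[OF F] by simp
  have "((\<lambda>x. w x * F x) has_real_derivative (b x - l * (w x / v x)) * F x + (l * F x / v x) * w x) (at x)"
    by (rule DERIV_mult[OF w_deriv[OF x(1) x'] factor_deriv[OF F x]])
  also have "(b x - l * (w x / v x)) * F x + (l * F x / v x) * w x = b x * F x"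
    by (simp add: left_diff_distrib)
  finally show ?thesis .
qed

lemma factor_times_v:
  assumes F: "integrating_factor F \<epsilon>" and x: "0 < x" "x < \<epsilon>"
  shows "((\<lambda>x. v x * F x) has_real_derivative (v' x + l) * F x) (at x)"
proof -
  have nz: "v x \<noteq> 0" using v_nz[of x] x factor_range[OF F] by simp
  have "((\<lambda>x. v x * F x) has_real_derivative v' x * F x + (l * F x / v x) * v x) (at x)"
    by (rule DERIV_mult[OF v_deriv factor_deriv[OF F x]])
  also have "v' x * F x + (l * F x / v x) * v x = (v' x + l) * F x"
    using nz by (simp add: distrib_right)
  finally show ?thesis .
qed

lemma factor_times_v_lim:
  assumes F: "integrating_factor F \<epsilon>"
  shows "((\<lambda>x. v x * F x * x powr (l / a - 1)) \<longlongrightarrow> - a) (at_right 0)"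
proof -
  have "((\<lambda>x. (v x / x) * (F x * x powr (l / a))) \<longlongrightarrow> - a * 1) (at_right 0)"
    by (rule tendsto_mult[OF v_lim factor_lim[OF F]])
  then have "((\<lambda>x. (v x / x) * (F x * x powr (l / a))) \<longlongrightarrow> - a) (at_right 0)" by simp
  moreover have "eventually (\<lambda>x. (v x / x) * (F x * x powr (l / a)) = v x * F x * x powr (l / a - 1)) (at_right 0)"
    by (rule eventually_at_right_0_I[of 1]) (simp_all add: powr_diff)
  ultimately show ?thesis by (rule Lim_transform_eventually)
qed

text \<open>
With the integrating factor \<open>F\<close>, the derivatives of \<open>w * F\<close> and \<open>v * F\<close> are \<open>b * F\<close> and \<open>(v' + l) * F\<close>, so the
quotient of the derivatives tends to \<open>b0 / (l - a)\<close>. By the rule of l'Hopital so does \<open>w / v\<close>: for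
\<open>0 < a < l\<close> the denominator is unbounded, for \<open>a < 0\<close> numerator and denominator tend to \<open>0\<close>.
\<close>
lemma finite_limit:
  assumes la: "a < l"
  shows "((\<lambda>x. w x / v x) \<longlongrightarrow> b0 / (l - a)) (at_right 0)"
proof -
  obtain F \<epsilon> where F: "integrating_factor F \<epsilon>" using integrating_factor_exists by blast
  note \<epsilon> = factor_range[OF F] and Fpos = factor_pos[OF F] and dw = factor_times_w[OF F]
    and dv = factor_times_v[OF F]
    and Flim = factor_lim[OF F] and vFlim = factor_times_v_lim[OF F]
  have r: "w x * F x / (v x * F x) = w x / v x" if "0 < x" "x < \<epsilon>" for x
    using Fpos[OF that] by simp
  have v'l: "((\<lambda>x. v' x + l) \<longlongrightarrow> l - a) (at_right 0)"
    using tendsto_add[OF v'_lim tendsto_const[of l]] by simp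
  have ev_v'l: "eventually (\<lambda>x. v' x + l > 0) (at_right 0)"
    by (rule order_tendstoD(1)[OF v'l]) (use la in simp)
  have ev: "eventually (\<lambda>x. 0 < x \<and> x < \<epsilon>) (at_right 0)" by (rule eventually_at_right_0_I[OF \<epsilon>(1)]) simp
  have quot: "((\<lambda>x. b x / (v' x + l)) \<longlongrightarrow> b0 / (l - a)) (at_right 0)"
    by (rule tendsto_divide[OF b_lim v'l]) (use la in simp)
  have "((\<lambda>x. w x * F x / (v x * F x)) \<longlongrightarrow> b0 / (l - a)) (at_right 0)"
  proof (cases "a > 0")
    case True
    have top: "filterlim (\<lambda>x. - (v x * F x)) at_top (at_right 0)"
    proof -
      have "1 - l / a < 0" using True la by (simp add: field_simps)
      note ptop = powr_at_right_0(2)[OF this]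
      have lim: "filterlim (\<lambda>x. - (v x * F x * x powr (l / a - 1)) * x powr (1 - l / a)) at_top (at_right 0)"
        by (rule filterlim_tendsto_pos_mult_at_top[OF tendsto_minus[OF vFlim] _ ptop]) (use True in simp)
      have "eventually (\<lambda>x. - (v x * F x * x powr (l / a - 1)) * x powr (1 - l / a) = - (v x * F x)) (at_right 0)"
        by (rule eventually_at_right_0_I[of 1]) (simp_all add: mult.assoc powr_add[symmetric])
      from filterlim_cong[OF refl refl this] lim show ?thesis by (rule iffD1)
    qed
    have "((\<lambda>x. - (w x * F x) / - (v x * F x)) \<longlongrightarrow> b0 / (l - a)) (at_right 0)"
    proof (rule lhopital_right_0_at_top[OF top])
      show "\<forall>\<^sub>F x in at_right 0. - ((v' x + l) * F x) \<noteq> 0"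
        using ev ev_v'l by eventually_elim (use Fpos in force)
      show "\<forall>\<^sub>F x in at_right 0. ((\<lambda>x. - (w x * F x)) has_real_derivative - (b x * F x)) (at x)"
        using ev by eventually_elim (auto intro: DERIV_minus dw)
      show "\<forall>\<^sub>F x in at_right 0. ((\<lambda>x. - (v x * F x)) has_real_derivative - ((v' x + l) * F x)) (at x)"
        using ev by eventually_elim (auto intro: DERIV_minus dv)
      have "eventually (\<lambda>x. b x / (v' x + l) = - (b x * F x) / - ((v' x + l) * F x)) (at_right 0)"
        using ev by eventually_elim (use Fpos in force)
      then show "((\<lambda>x. - (b x * F x) / - ((v' x + l) * F x)) \<longlongrightarrow> b0 / (l - a)) (at_right 0)"
        by (rule Lim_transform_eventually[OF quot])
    qed
    then show ?thesis by simp
  next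
    case False
    then have a: "a < 0" using a_nz by simp
    have Fz: "(F \<longlongrightarrow> 0) (at_right 0)"
    proof -
      have "- l / a > 0" using a l_pos by (simp add: field_simps)
      from tendsto_mult[OF Flim powr_at_right_0(1)[OF this]]
      have "((\<lambda>x. F x * x powr (l / a) * x powr (- l / a)) \<longlongrightarrow> 0) (at_right 0)" by simp
      moreover have "eventually (\<lambda>x. F x * x powr (l / a) * x powr (- l / a) = F x) (at_right 0)"
        by (rule eventually_at_right_0_I[of 1]) (simp_all add: mult.assoc powr_add[symmetric])
      ultimately show ?thesis by (rule Lim_transform_eventually)
    qed
    have vz: "(v \<longlongrightarrow> 0) (at_right 0)"
    proof -
      have "((\<lambda>x. v x / x * x) \<longlongrightarrow> - a * 0) (at_right 0)"
        by (rule tendsto_mult[OF v_lim]) (rule tendsto_ident_at)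
      then have "((\<lambda>x. v x / x * x) \<longlongrightarrow> 0) (at_right 0)" by simp
      moreover have "eventually (\<lambda>x. v x / x * x = v x) (at_right 0)"
        by (rule eventually_at_right_0_I[of 1]) simp_all
      ultimately show ?thesis by (rule Lim_transform_eventually)
    qed
    show ?thesis
    proof (rule lhopital_right_0)
      show "((\<lambda>x. w x * F x) \<longlongrightarrow> 0) (at_right 0)" using tendsto_mult[OF w_lim Fz] by simp
      show "((\<lambda>x. v x * F x) \<longlongrightarrow> 0) (at_right 0)" using tendsto_mult[OF vz Fz] by simp
      show "\<forall>\<^sub>F x in at_right 0. v x * F x \<noteq> 0"
        using ev by eventually_elim (use Fpos v_nz \<epsilon> in force)
      show "\<forall>\<^sub>F x in at_right 0. (v' x + l) * F x \<noteq> 0"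
        using ev ev_v'l by eventually_elim (use Fpos in force)
      show "\<forall>\<^sub>F x in at_right 0. ((\<lambda>x. w x * F x) has_real_derivative b x * F x) (at x)"
        using ev by eventually_elim (auto intro: dw)
      show "\<forall>\<^sub>F x in at_right 0. ((\<lambda>x. v x * F x) has_real_derivative (v' x + l) * F x) (at x)"
        using ev by eventually_elim (auto intro: dv)
      have "eventually (\<lambda>x. b x / (v' x + l) = b x * F x / ((v' x + l) * F x)) (at_right 0)"
        using ev by eventually_elim (use Fpos in force)
      then show "((\<lambda>x. b x * F x / ((v' x + l) * F x)) \<longlongrightarrow> b0 / (l - a)) (at_right 0)"
        by (rule Lim_transform_eventually[OF quot])
    qed
  qed
  moreover have "eventually (\<lambda>x. w x * F x / (v x * F x) = w x / v x) (at_right 0)"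
    using ev by eventually_elim (use r in auto)
  ultimately show ?thesis by (rule Lim_transform_eventually)
qed

text \<open>
Here \<open>F\<close> behaves like \<open>1 / x\<close>, so \<open>w * F\<close> grows like \<open>b0 * ln x\<close>, while \<open>v * F\<close> tends to \<open>- a\<close>.
\<close>
lemma logarithmic_limit:
  assumes la: "l = a"
  shows "((\<lambda>x. (w x / v x) / (- ln x)) \<longlongrightarrow> b0 / a) (at_right 0)"
proof -
  obtain F \<epsilon> where F: "integrating_factor F \<epsilon>" using integrating_factor_exists by blast
  note \<epsilon> = factor_range[OF F] and Fpos = factor_pos[OF F] and dw = factor_times_w[OF F]
    and Flim = factor_lim[OF F] and vFlim = factor_times_v_lim[OF F]
  have r: "w x * F x / (v x * F x) = w x / v x" if "0 < x" "x < \<epsilon>" for x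
    using Fpos[OF that] by simp
  have ev: "eventually (\<lambda>x. 0 < x \<and> x < \<epsilon>) (at_right 0)" by (rule eventually_at_right_0_I[OF \<epsilon>(1)]) simp
  have la1: "l / a = 1" using la a_nz by simp
  have top: "filterlim (\<lambda>x::real. - ln x) at_top (at_right 0)"
    using ln_at_0 by (simp add: filterlim_uminus_at_bot)
  have "((\<lambda>x. w x * F x / - ln x) \<longlongrightarrow> - b0) (at_right 0)"
  proof (rule lhopital_right_0_at_top[OF top])
    show "\<forall>\<^sub>F x in at_right (0::real). - (1 / x) \<noteq> 0" using ev by eventually_elim auto
    show "\<forall>\<^sub>F x in at_right 0. ((\<lambda>x. w x * F x) has_real_derivative b x * F x) (at x)"
      using ev by eventually_elim (auto intro: dw)
    show "\<forall>\<^sub>F x in at_right 0. ((\<lambda>x. - ln x) has_real_derivative - (1 / x)) (at x)"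
      using ev by eventually_elim (auto intro!: derivative_eq_intros)
    have "((\<lambda>x. - (b x * (F x * x powr (l / a)))) \<longlongrightarrow> - (b0 * 1)) (at_right 0)"
      by (intro tendsto_intros b_lim Flim)
    then have lim: "((\<lambda>x. - (b x * (F x * x powr (l / a)))) \<longlongrightarrow> - b0) (at_right 0)" by simp
    have "eventually (\<lambda>x. - (b x * (F x * x powr (l / a))) = b x * F x / - (1 / x)) (at_right 0)"
      using ev by eventually_elim (simp add: la1)
    from Lim_transform_eventually[OF lim this]
    show "((\<lambda>x. b x * F x / - (1 / x)) \<longlongrightarrow> - b0) (at_right 0)" .
  qed
  from tendsto_divide[OF this vFlim]
  have "((\<lambda>x. w x * F x / - ln x / (v x * F x * x powr (l / a - 1))) \<longlongrightarrow> b0 / a) (at_right 0)"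
    using a_nz by simp
  moreover have "eventually (\<lambda>x. w x * F x / - ln x / (v x * F x * x powr (l / a - 1)) = (w x / v x) / - ln x) (at_right 0)"
    using ev
  proof eventually_elim
    case (elim x)
    have "w x * F x / - ln x / (v x * F x * x powr (l / a - 1)) = (w x * F x / (v x * F x)) / - ln x"
      using elim by (simp add: la1)
    then show ?case using r[of x] elim by simp
  qed
  ultimately show ?thesis by (rule Lim_transform_eventually)
qed

text \<open>
The function \<open>w * F\<close> is nonpositive and nondecreasing, and \<open>F\<close> is integrable at \<open>0\<close>, so \<open>w * F\<close> has a finite
limit at \<open>0\<close>. A limit \<open>0\<close> would force \<open>w\<close> and \<open>b\<close> to vanish near \<open>0\<close>.
\<close>
lemma power_law:
  assumes la: "l < a" and ne: "\<And>e. 0 < e \<Longrightarrow> e \<le> \<delta> \<Longrightarrow> \<exists>x. 0 < x \<and> x < e \<and> (w x \<noteq> 0 \<or> b x \<noteq> 0)"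
  obtains c where "c > 0" "((\<lambda>x. (w x / v x) / x powr (l / a - 1)) \<longlongrightarrow> c) (at_right 0)"
proof -
  have a: "a > 0" using la l_pos by simp
  obtain F \<epsilon> where F: "integrating_factor F \<epsilon>" using integrating_factor_exists by blast
  note \<epsilon> = factor_range[OF F] and Fpos = factor_pos[OF F] and dw = factor_times_w[OF F]
    and Flim = factor_lim[OF F] and vFlim = factor_times_v_lim[OF F]
  have r: "w x * F x / (v x * F x) = w x / v x" if "0 < x" "x < \<epsilon>" for x
    using Fpos[OF that] by simp
  have ev: "eventually (\<lambda>x. 0 < x \<and> x < \<epsilon>) (at_right 0)" by (rule eventually_at_right_0_I[OF \<epsilon>(1)]) simp
  define p where "p = 1 - l / a"
  have p: "p > 0" using la a by (simp add: p_def)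
  define M where "M = \<bar>b0\<bar> + 1"
  have "eventually (\<lambda>x. b x < M) (at_right 0)" by (rule order_tendstoD(2)[OF b_lim]) (simp add: M_def)
  moreover have "eventually (\<lambda>x. F x * x powr (l / a) < 2) (at_right 0)" by (rule order_tendstoD(2)[OF Flim]) simp
  moreover have "eventually (\<lambda>x. v x / x < 0) (at_right 0)" by (rule order_tendstoD(2)[OF v_lim]) (use a in simp)
  ultimately have "eventually (\<lambda>x. b x < M \<and> F x * x powr (l / a) < 2 \<and> v x / x < 0) (at_right 0)"
    by eventually_elim simp
  then obtain e1 where e1: "e1 > 0" "\<And>x. 0 < x \<Longrightarrow> x < e1 \<Longrightarrow> b x < M \<and> F x * x powr (l / a) < 2 \<and> v x / x < 0"
    unfolding eventually_at_right_field by auto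
  define e where "e = min e1 \<epsilon>"
  have e: "0 < e" "e \<le> e1" "e \<le> \<epsilon>" using e1(1) \<epsilon> by (auto simp: e_def)
  define H where "H x = w x * F x" for x
  have dH: "(H has_real_derivative b x * F x) (at x)" if "0 < x" "x < e" for x
    unfolding H_def using dw[of x] that e by simp
  have H_mono: "H x \<le> H y" if "0 < x" "x \<le> y" "y < e" for x y
  proof (rule DERIV_nonneg_imp_nondecreasing[OF that(2)])
    fix z assume z: "x \<le> z" "z \<le> y"
    then have "0 \<le> b z * F z"
      using b_nonneg[of z] Fpos[of z] that e \<epsilon> by (auto intro!: mult_nonneg_nonneg less_imp_le)
    then show "\<exists>d. (H has_real_derivative d) (at z) \<and> 0 \<le> d" using dH[of z] z that by auto
  qed
  have H_neg: "H x \<le> 0" if "0 < x" "x < e" for x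
  proof -
    have "v x < 0" using e1(2)[of x] that e by (simp add: divide_less_0_iff)
    then have "w x \<le> 0" using r_nonneg[of x] that e \<epsilon> by (simp add: zero_le_divide_iff)
    then show ?thesis unfolding H_def using Fpos[of x] that e by (simp add: mult_nonpos_nonneg)
  qed
  \<comment> \<open>\<open>H x - (2 * M / p) * x powr p\<close> is nonincreasing, because \<open>H\<close> has derivative \<open>b * F\<close>, which is at most
    \<open>2 * M * x powr (p - 1)\<close>; hence \<open>H\<close> is bounded below.\<close>
  define B where "B = H (e/2) - (2 * M / p) * (e/2) powr p"
  have B_le: "B \<le> H x" if x: "0 < x" "x < e / 2" for x
  proof -
    have "H (e/2) - (2 * M / p) * (e/2) powr p \<le> H x - (2 * M / p) * x powr p"
    proof (rule DERIV_nonpos_imp_nonincreasing[OF less_imp_le[OF x(2)]])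
      fix z assume z: "x \<le> z" "z \<le> e/2"
      then have z': "0 < z" "z < e" using x e by auto
      have "((\<lambda>z. H z - (2 * M / p) * z powr p) has_real_derivative b z * F z - (2 * M / p) * (p * z powr (p - 1))) (at z)"
        by (rule DERIV_diff[OF dH[OF z'] DERIV_cmult[OF has_real_derivative_powr[OF z'(1)]]])
      moreover have "b z * F z - (2 * M / p) * (p * z powr (p - 1)) \<le> 0"
      proof -
        have Fz: "F z \<le> 2 * z powr (- l / a)"
          using e1(2)[of z] z' e by (simp add: powr_minus_divide pos_le_divide_eq)
        have "b z * F z \<le> M * (2 * z powr (- l / a))"
          using e1(2)[of z] z' e \<epsilon> Fpos[of z] b_nonneg[of z] by (intro mult_mono Fz) (auto simp: M_def)
        also have "\<dots> = (2 * M / p) * (p * z powr (p - 1))"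
        proof -
          have "p - 1 = - l / a" by (simp add: p_def)
          then show ?thesis using p by (simp only:) simp
        qed
        finally show ?thesis by simp
      qed
      ultimately show "\<exists>d. ((\<lambda>z. H z - (2 * M / p) * z powr p) has_real_derivative d) (at z) \<and> d \<le> 0"
        by (intro exI conjI)
    qed
    moreover have "0 \<le> (2 * M / p) * x powr p" using p by (simp add: M_def)
    ultimately show ?thesis by (simp add: B_def)
  qed
  obtain L where L: "(H \<longlongrightarrow> L) (at_right 0)" "\<And>x. 0 < x \<Longrightarrow> x < e/2 \<Longrightarrow> L \<le> H x"
    by (rule nondecreasing_bounded_at_right_0[of "e/2" H B]) (use e H_mono B_le in auto)
  \<comment> \<open>If the limit were \<open>0\<close>, then \<open>H\<close>, which is nondecreasing and nonpositive, would vanish near \<open>0\<close>.\<close>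
  have "L \<noteq> 0"
  proof
    assume "L = 0"
    then have H0: "H x = 0" if "0 < x" "x < e/2" for x
      using L(2)[OF that] H_neg[of x] that by simp
    have w0: "w x = 0" if "0 < x" "x < e/2" for x
      using H0[OF that] Fpos[of x] that e by (auto simp: H_def)
    have b0': "b x = 0" if x: "0 < x" "x < e/2" for x
    proof -
      have "eventually (\<lambda>y. y \<in> {0<..<e/2}) (nhds x)"
        by (rule eventually_nhds_in_open) (use x in auto)
      then have "eventually (\<lambda>y. H y = 0) (nhds x)" by eventually_elim (use H0 in auto)
      from DERIV_cong_ev[OF refl this refl] have "(H has_real_derivative 0) (at x)" by simp
      moreover have "(H has_real_derivative b x * F x) (at x)" by (rule dH) (use x in auto)
      ultimately have "b x * F x = 0" by (metis DERIV_unique)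
      then show ?thesis using Fpos[of x] x e by auto
    qed
    obtain x where "0 < x" "x < e/2" "w x \<noteq> 0 \<or> b x \<noteq> 0" using ne[of "e/2"] e \<epsilon> by auto
    then show False using w0 b0' by auto
  qed
  moreover have "L \<le> 0" using L(2)[of "e/4"] H_neg[of "e/4"] e by simp
  ultimately have Lneg: "L < 0" by simp
  have "((\<lambda>x. H x / (v x * F x * x powr (l / a - 1))) \<longlongrightarrow> L / - a) (at_right 0)"
    by (rule tendsto_divide[OF L(1) vFlim]) (use a in simp)
  moreover have "eventually (\<lambda>x. H x / (v x * F x * x powr (l / a - 1)) = (w x / v x) / x powr (l / a - 1)) (at_right 0)"
    using ev
  proof eventually_elim
    case (elim x)
    have "H x / (v x * F x * x powr (l / a - 1)) = (w x * F x / (v x * F x)) / x powr (l / a - 1)"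
      by (simp add: H_def)
    then show ?case using r[of x] elim by simp
  qed
  ultimately have "((\<lambda>x. (w x / v x) / x powr (l / a - 1)) \<longlongrightarrow> L / - a) (at_right 0)"
    by (rule Lim_transform_eventually)
  moreover have "L / - a > 0" using Lneg a by (simp add: field_simps)
  ultimately show ?thesis using that by blast
qed

end

section \<open>The densities at the critical point\<close>
locale critical_origin = regular_switching +
  fixes a :: real
  assumes u_1_0: "u 1 0 = 0"
    and u_other_0: "\<And>i. i \<in> {1..N} - {1} \<Longrightarrow> u i 0 \<noteq> 0"
    and a_nonzero: "a \<noteq> 0"
    and u_1_asymp: "(\<lambda>\<eta>. u 1 \<eta> - (- a * \<eta>)) \<in> O[at_right 0](\<lambda>\<eta>. \<eta> ^ 2)"
begin

lemma one_in_states: "1 \<in> states" and two_in_states: "2 \<in> states - {1}"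
  using N_ge_2 by auto

text \<open>
The function \<open>\<lambda>\<eta>. \<Sum>i>1. lam i 1 * \<rho> i \<eta>\<close>, formed with the continuous representatives.
\<close>
abbreviation inflow :: "real \<Rightarrow> real" where "inflow \<equiv> rho_bar N lam dens"

lemma inflow_eq: "inflow x = (\<Sum>j\<in>states - {1}. lam j 1 * dens j x)"
  unfolding rho_bar_def by (rule sum.cong) auto

lemma inflow_nonneg: "0 \<le> inflow x"
  unfolding inflow_eq
  by (intro sum_nonneg mult_nonneg_nonneg dens_nonneg less_imp_le[OF lam_pos[OF _ one_in_states]]) auto

lemma inflow_eq_0_iff: "inflow x = 0 \<longleftrightarrow> (\<forall>j\<in>states - {1}. dens j x = 0)"
proof -
  have pos: "lam j 1 > 0" if "j \<in> states - {1}" for j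
    by (rule lam_pos[OF _ one_in_states]) (use that in auto)
  have "inflow x = 0 \<longleftrightarrow> (\<forall>j\<in>states - {1}. lam j 1 * dens j x = 0)"
    unfolding inflow_eq
    by (rule sum_nonneg_eq_0_iff) (simp_all add: mult_nonneg_nonneg[OF less_imp_le[OF pos] dens_nonneg])
  also have "\<dots> \<longleftrightarrow> (\<forall>j\<in>states - {1}. dens j x = 0)"
  proof (rule ball_cong[OF refl])
    fix j assume "j \<in> states - {1}"
    from pos[OF this] show "lam j 1 * dens j x = 0 \<longleftrightarrow> dens j x = 0" by simp
  qed
  finally show ?thesis .
qed

text \<open>
\<open>x / 0 = 0\<close> agrees with the value chosen at critical points.
\<close>
lemma dens_eq: "dens i x = flux i x / u i x"
  by (simp add: dens_def)

lemma noncritical_near_0: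
  obtains \<delta> where "\<delta> > 0" "\<And>x i. x \<noteq> 0 \<Longrightarrow> \<bar>x\<bar> < \<delta> \<Longrightarrow> i \<in> states \<Longrightarrow> u i x \<noteq> 0"
proof -
  obtain \<delta> where \<delta>: "\<delta> > 0" "\<not> (\<exists>x\<in>critical. x \<noteq> 0 \<and> dist x 0 < \<delta>)"
    using isolated[of 0] unfolding islimpt_approachable by blast
  have "u i x \<noteq> 0" if "x \<noteq> 0" "\<bar>x\<bar> < \<delta>" "i \<in> states" for x i
  proof
    assume "u i x = 0"
    then have "x \<in> critical" using that(3) by blast
    then show False using \<delta>(2) that(1,2) by (auto simp: dist_real_def)
  qed
  from that[OF \<delta>(1) this] show ?thesis .
qed

lemma u_1_quadratic:
  obtains C where "eventually (\<lambda>x. \<bar>u 1 x + a * x\<bar> \<le> C * x\<^sup>2) (at_right 0)"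
proof -
  obtain C where "eventually (\<lambda>x. norm (u 1 x - (- a * x)) \<le> C * norm (x ^ 2)) (at_right 0)"
    using u_1_asymp by (rule landau_o.bigE)
  then have "eventually (\<lambda>x. \<bar>u 1 x + a * x\<bar> \<le> C * x\<^sup>2) (at_right 0)"
    by eventually_elim simp
  then show ?thesis by (rule that)
qed

lemma u_1_slope: "((\<lambda>x. u 1 x / x) \<longlongrightarrow> - a) (at_right 0)"
proof -
  obtain C where C: "eventually (\<lambda>x. \<bar>u 1 x + a * x\<bar> \<le> C * x\<^sup>2) (at_right 0)"
    using u_1_quadratic by blast
  have "((\<lambda>x. u 1 x / x + a) \<longlongrightarrow> 0) (at_right 0)"
  proof (rule Lim_null_comparison)
    have "((\<lambda>x::real. C * x) \<longlongrightarrow> C * 0) (at_right 0)" by (intro tendsto_intros)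
    then show "((\<lambda>x::real. C * x) \<longlongrightarrow> 0) (at_right 0)" by simp
    show "eventually (\<lambda>x. norm (u 1 x / x + a) \<le> C * x) (at_right 0)"
      using C eventually_at_right_less[of "0::real"]
    proof eventually_elim
      case (elim x)
      have "u 1 x / x + a = (u 1 x + a * x) / x" using elim by (simp add: field_simps)
      then have "\<bar>u 1 x / x + a\<bar> = \<bar>u 1 x + a * x\<bar> / x" using elim by (simp add: abs_divide)
      also have "\<dots> \<le> C * x" using elim by (simp add: pos_divide_le_eq power2_eq_square mult.assoc)
      finally show ?case by simp
    qed
  qed
  from tendsto_diff[OF this tendsto_const[of a]] show ?thesis by simp
qed

text \<open>
Otherwise the density \<open>flux 1 / u 1\<close> would be at least a positive multiple of \<open>1 / x\<close> near \<open>0\<close>, and not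
integrable.
\<close>
lemma flux_1_0: "flux 1 0 = 0"
proof (rule ccontr)
  assume nz: "flux 1 0 \<noteq> 0"
  define m where "m = \<bar>flux 1 0\<bar>"
  have m: "m > 0" using nz by (simp add: m_def)
  define K where "K = \<bar>a\<bar> + 1"
  have K: "K > 0" by (simp add: K_def)
  obtain \<delta> where \<delta>: "\<delta> > 0" "\<And>x i. x \<noteq> 0 \<Longrightarrow> \<bar>x\<bar> < \<delta> \<Longrightarrow> i \<in> states \<Longrightarrow> u i x \<noteq> 0"
    using noncritical_near_0 by blast
  have "(flux 1 \<longlongrightarrow> flux 1 0) (at_right 0)"
    using flux_isCont[OF one_in_states, of 0] unfolding isCont_def by (rule filterlim_mono) (auto simp: at_le)
  then have "eventually (\<lambda>x. m / 2 < \<bar>flux 1 x\<bar>) (at_right 0)"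
    by (intro order_tendstoD(1)[OF tendsto_rabs]) (use m in \<open>auto simp: m_def\<close>)
  moreover have "eventually (\<lambda>x. \<bar>u 1 x / x\<bar> < K) (at_right 0)"
    by (rule order_tendstoD(2)[OF tendsto_rabs[OF u_1_slope]]) (simp add: K_def)
  ultimately have "eventually (\<lambda>x. m / 2 < \<bar>flux 1 x\<bar> \<and> \<bar>u 1 x / x\<bar> < K) (at_right 0)"
    by eventually_elim simp
  then obtain e where e: "e > 0" "\<And>x. 0 < x \<Longrightarrow> x < e \<Longrightarrow> m / 2 < \<bar>flux 1 x\<bar> \<and> \<bar>u 1 x / x\<bar> < K"
    unfolding eventually_at_right_field by auto
  define e' where "e' = min e \<delta> / 2"
  have e': "0 < e'" "e' < e" "e' < \<delta>" using e(1) \<delta>(1) by (auto simp: e'_def)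
  define k where "k = m / (2 * K)"
  have k: "k > 0" using m K by (simp add: k_def)
  have dens_ge: "k / x \<le> dens 1 x" if x: "0 < x" "x \<le> e'" for x
  proof -
    have nzu: "u 1 x \<noteq> 0" using \<delta>(2)[of x 1] x e' one_in_states by auto
    have ux: "\<bar>u 1 x\<bar> \<le> K * x" using e(2)[of x] x e' by (simp add: abs_divide pos_divide_less_eq)
    have "k / x = (m / 2) / (K * x)" by (simp add: k_def)
    also have "\<dots> \<le> \<bar>flux 1 x\<bar> / \<bar>u 1 x\<bar>"
      by (rule frac_le) (use e(2)[of x] x e' nzu ux m in auto)
    also have "\<dots> = dens 1 x"
      unfolding abs_divide[symmetric] dens_eq[symmetric] by (rule abs_of_nonneg[OF dens_nonneg[OF one_in_states]])
    finally show ?thesis .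
  qed
  \<comment> \<open>The primitive of the density grows at least like \<open>k * ln\<close>, but it is continuous at \<open>0\<close>.\<close>
  define R where "R = primitive (\<rho> 1)"
  have Ri: "integrable lborel (\<rho> 1)" by (rule rho_integrable[OF one_in_states])
  have dR: "(R has_real_derivative dens 1 x) (at x)" if x: "0 < x" "x \<le> e'" for x
    unfolding R_def
  proof (rule primitive_has_derivative[OF Ri dens_isCont[OF one_in_states] zero_less_one])
    show "u 1 x \<noteq> 0" using \<delta>(2)[of x 1] x e' one_in_states by auto
    show "AE t in lborel. \<bar>t - x\<bar> < 1 \<longrightarrow> \<rho> 1 t = dens 1 t"
      using dens_eq_rho by eventually_elim (use one_in_states in auto)
  qed
  have bound: "R s - k * ln s \<le> R e' - k * ln e'" if s: "0 < s" "s \<le> e'" for s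
  proof (rule DERIV_nonneg_imp_nondecreasing[OF s(2)])
    fix x assume x: "s \<le> x" "x \<le> e'"
    then have "((\<lambda>x. R x - k * ln x) has_real_derivative dens 1 x - k * (1 / x)) (at x)"
      using s by (intro DERIV_diff dR DERIV_cmult DERIV_ln_divide) auto
    moreover have "0 \<le> dens 1 x - k * (1 / x)" using dens_ge[of x] x s by simp
    ultimately show "\<exists>d. ((\<lambda>x. R x - k * ln x) has_real_derivative d) (at x) \<and> 0 \<le> d"
      by (intro exI conjI)
  qed
  have "(R \<longlongrightarrow> R 0) (at_right 0)"
  proof -
    have "isCont R 0" unfolding R_def using primitive_continuous[OF Ri] by (simp add: continuous_on_eq_continuous_at)
    then show ?thesis unfolding isCont_def by (rule filterlim_mono) (auto simp: at_le)
  qed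
  then have "eventually (\<lambda>s. R 0 - 1 < R s) (at_right 0)" by (rule order_tendstoD(1)) simp
  moreover have "eventually (\<lambda>s. ln s < ((R 0 - 1) - (R e' - k * ln e')) / k) (at_right (0::real))"
    using ln_at_0 unfolding filterlim_at_bot_dense by blast
  moreover have "eventually (\<lambda>s. 0 < s \<and> s < e') (at_right 0)" by (rule eventually_at_right_0_I[OF e'(1)]) simp
  ultimately have "eventually (\<lambda>s::real. False) (at_right 0)"
  proof eventually_elim
    case (elim s)
    then have "k * ln s < (R 0 - 1) - (R e' - k * ln e')" using k by (simp add: pos_less_divide_eq mult.commute)
    then show False using bound[of s] elim by linarith
  qed
  then show False by simp
qed

lemma obtain_boundary_ode:
  obtains v' \<delta> C where "boundary_ode (u 1) v' (flux 1) inflow a (rate 1) \<delta> C (inflow 0)"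
    "\<And>x i. x \<noteq> 0 \<Longrightarrow> \<bar>x\<bar> < \<delta> \<Longrightarrow> i \<in> states \<Longrightarrow> u i x \<noteq> 0"
proof -
  obtain \<delta> where \<delta>: "\<delta> > 0" "\<And>x i. x \<noteq> 0 \<Longrightarrow> \<bar>x\<bar> < \<delta> \<Longrightarrow> i \<in> states \<Longrightarrow> u i x \<noteq> 0"
    using noncritical_near_0 by blast
  obtain C where C: "eventually (\<lambda>x. \<bar>u 1 x + a * x\<bar> \<le> C * x\<^sup>2) (at_right 0)"
    using u_1_quadratic by blast
  obtain v' where v': "\<And>x. (u 1 has_real_derivative v' x) (at x)" "continuous_on UNIV v'"
    using C1_u[OF one_in_states] unfolding C1_differentiable_on_def
    by (auto simp: has_real_derivative_iff_has_vector_derivative)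
  have "((\<lambda>x. u 1 x / x) \<longlongrightarrow> v' 0) (at_right 0)"
  proof -
    have "((\<lambda>x. (u 1 x - u 1 0) / (x - 0)) \<longlongrightarrow> v' 0) (at 0)"
      using v'(1)[of 0] by (simp only: has_field_derivative_iff)
    then have "((\<lambda>x. u 1 x / x) \<longlongrightarrow> v' 0) (at 0)" by (simp add: u_1_0)
    then show ?thesis by (rule filterlim_mono) (auto simp: at_le)
  qed
  then have v'0: "v' 0 = - a" using tendsto_unique[OF _ _ u_1_slope] by simp
  have v'l: "(v' \<longlongrightarrow> - a) (at_right 0)"
  proof -
    have "isCont v' 0" using v'(2) by (simp add: continuous_on_eq_continuous_at)
    then have "(v' \<longlongrightarrow> v' 0) (at_right 0)" unfolding isCont_def by (rule filterlim_mono) (auto simp: at_le)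
    then show ?thesis by (simp add: v'0)
  qed
  have "boundary_ode (u 1) v' (flux 1) inflow a (rate 1) \<delta> C (inflow 0)"
  proof
    show "a \<noteq> 0" by (rule a_nonzero)
    show "rate 1 > 0" by (rule rate_pos[OF one_in_states])
    show "\<delta> > 0" by (rule \<delta>(1))
    show "(u 1 has_real_derivative v' x) (at x)" for x by (rule v'(1))
    show "((\<lambda>x. u 1 x / x) \<longlongrightarrow> - a) (at_right 0)" by (rule u_1_slope)
    show "(v' \<longlongrightarrow> - a) (at_right 0)" by (rule v'l)
    show "eventually (\<lambda>x. \<bar>u 1 x + a * x\<bar> \<le> C * x\<^sup>2) (at_right 0)" by (rule C)
    have "(flux 1 \<longlongrightarrow> flux 1 0) (at_right 0)"
      using flux_isCont[OF one_in_states, of 0] unfolding isCont_def by (rule filterlim_mono) (auto simp: at_le)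
    then show "(flux 1 \<longlongrightarrow> 0) (at_right 0)" by (simp add: flux_1_0)
    have "isCont inflow 0"
      unfolding inflow_eq[abs_def] by (intro continuous_intros dens_isCont u_other_0) auto
    then show "(inflow \<longlongrightarrow> inflow 0) (at_right 0)" unfolding isCont_def by (rule filterlim_mono) (auto simp: at_le)
    fix x :: real assume x: "0 < x" "x < \<delta>"
    have nz: "u i x \<noteq> 0" if "i \<in> states" for i using \<delta>(2)[of x i] x that by auto
    show "u 1 x \<noteq> 0" by (rule nz[OF one_in_states])
    show "(flux 1 has_real_derivative inflow x - rate 1 * (flux 1 x / u 1 x)) (at x)"
      using flux_has_derivative[OF one_in_states nz] by (simp add: inflow_eq dens_eq)
    show "0 \<le> flux 1 x / u 1 x" using dens_nonneg[OF one_in_states, of x] by (simp add: dens_eq)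
    show "0 \<le> inflow x" by (rule inflow_nonneg)
  qed
  then show ?thesis using \<delta>(2) by (rule that)
qed

text \<open>
Points of a charged minimal invariant set are not silent.
\<close>
lemma density_positive_near_0:
  assumes J: "minimal_invariant_set N u J" "measure \<mu> (J \<times> states) > 0"
    and near: "\<And>e. 0 < e \<Longrightarrow> \<exists>x\<in>J. 0 < x \<and> x < e" and e: "0 < e"
    and nz: "\<And>x. 0 < x \<Longrightarrow> x < e \<Longrightarrow> u 1 x \<noteq> 0"
  shows "\<exists>x. 0 < x \<and> x < e \<and> (flux 1 x \<noteq> 0 \<or> inflow x \<noteq> 0)"
proof (rule ccontr)
  assume "\<not> ?thesis"
  then have z: "flux 1 x = 0 \<and> inflow x = 0" if "0 < x" "x < e" for x using that by blast
  have d0: "dens j x = 0" if "0 < x" "x < e" "j \<in> states" for j x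
  proof (cases "j = 1")
    case True
    then show ?thesis using z[OF that(1,2)] by (simp add: dens_eq)
  next
    case False
    then show ?thesis using z[OF that(1,2)] that(3) unfolding inflow_eq_0_iff by blast
  qed
  obtain x where x: "x \<in> J" "0 < x" "x < e" using near[OF e] by blast
  have "silent x"
  proof (rule silentI[OF x(2,3)])
    show "AE t in lborel. 0 < t \<longrightarrow> t < e \<longrightarrow> (\<forall>j\<in>states. \<rho> j t = 0)"
      using dens_eq_rho by eventually_elim (use d0 in auto)
  qed
  then show False using not_silent_in_support[OF J x(1)] by simp
qed

lemma run_ge: "admissible ps \<Longrightarrow> (\<And>i. i \<in> states \<Longrightarrow> 0 \<le> u i p) \<Longrightarrow> p \<le> x \<Longrightarrow> p \<le> run ps x"
proof (induction ps arbitrary: x)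
  case (Cons q ps)
  obtain i t where q: "q = (i, t)" by (cases q)
  have it: "i \<in> states" "0 \<le> t" using Cons.prems(1) q by auto
  have "p \<le> flow (u i) t x"
    by (rule flow_ge[OF forward_complete_u[OF it(1)] Cons.prems(2)[OF it(1)] it(2) Cons.prems(3)])
  moreover have "admissible ps" using Cons.prems(1) by simp
  ultimately show ?case using Cons.IH[of "flow (u i) t x"] Cons.prems(2) q by simp
qed simp

lemma run_le: "admissible ps \<Longrightarrow> (\<And>i. i \<in> states \<Longrightarrow> u i p \<le> 0) \<Longrightarrow> x \<le> p \<Longrightarrow> run ps x \<le> p"
proof (induction ps arbitrary: x)
  case (Cons q ps)
  obtain i t where q: "q = (i, t)" by (cases q)
  have it: "i \<in> states" "0 \<le> t" using Cons.prems(1) q by auto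
  have "flow (u i) t x \<le> p"
    by (rule flow_le[OF forward_complete_u[OF it(1)] Cons.prems(2)[OF it(1)] it(2) Cons.prems(3)])
  moreover have "admissible ps" using Cons.prems(1) by simp
  ultimately show ?case using Cons.IH[of "flow (u i) t x"] Cons.prems(2) q by simp
qed simp

lemma flow_stays_in_invariant_set:
  assumes J: "minimal_invariant_set N u J" and x: "x \<in> J" and i: "i \<in> states" "0 \<le> t"
  shows "flow (u i) t x \<in> J"
proof -
  have "\<forall>ps. admissible ps \<longrightarrow> (\<forall>x\<in>J. run ps x \<in> J)"
    using J unfolding minimal_invariant_set_def invariant_set_def by blast
  from this[rule_format, of "[(i, t)]" x] show ?thesis using x i by simp
qed

lemma meets_interior_of_closure:
  assumes "0 \<in> interior (closure (J :: real set))" "0 < e"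
  shows "\<exists>x\<in>J. 0 < x \<and> x < e" "\<exists>x\<in>J. - e < x \<and> x < 0"
proof -
  obtain d where d: "d > 0" "ball 0 d \<subseteq> closure J" using assms(1) unfolding mem_interior by blast
  have meets: "J \<inter> {p<..<q} \<noteq> {}" if "p < q" "\<bar>p\<bar> < d" "\<bar>q\<bar> < d" for p q
  proof
    assume "J \<inter> {p<..<q} = {}"
    then have "closure J \<inter> {p<..<q} = {}" by (metis open_greaterThanLessThan open_Int_closure_eq_empty inf_commute)
    moreover have "(p + q) / 2 \<in> ball 0 d" using that by (auto simp: dist_real_def abs_less_iff)
    moreover have "(p + q) / 2 \<in> {p<..<q}" using that(1) by simp
    ultimately show False using d(2) by blast
  qed
  have "J \<inter> {0<..<min d e / 2} \<noteq> {}" by (rule meets) (use d(1) assms(2) in auto)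
  then show "\<exists>x\<in>J. 0 < x \<and> x < e" using d(1) assms(2) by force
  have "J \<inter> {- (min d e / 2)<..<0} \<noteq> {}" by (rule meets) (use d(1) assms(2) in auto)
  then show "\<exists>x\<in>J. - e < x \<and> x < 0" using d(1) assms(2) by force
qed

text \<open>
Points of \<open>J\<close> on either side of \<open>0\<close> reach each other, so there are fields of both signs at \<open>0\<close>. If
the inflow vanished at \<open>0\<close>, then so would the fluxes of these fields, and hence all densities
upstream of \<open>0\<close> for either field, which are both sides of \<open>0\<close>.
\<close>
lemma inflow_positive_inside:
  assumes J: "minimal_invariant_set N u J" "measure \<mu> (J \<times> states) > 0" and int: "0 \<in> interior (closure J)"
  shows "inflow 0 > 0"
proof (rule ccontr)
  assume "\<not> ?thesis"
  then have "inflow 0 = 0" using inflow_nonneg[of 0] by simp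
  then have d0: "dens j 0 = 0" if "j \<in> states - {1}" for j using that unfolding inflow_eq_0_iff by blast
  note near = meets_interior_of_closure[OF int]
  obtain x where x: "x \<in> J" "x < 0" using near(2)[OF zero_less_one] by blast
  obtain y where y: "y \<in> J" "0 < y" using near(1)[OF zero_less_one] by blast
  obtain \<delta> where \<delta>: "\<delta> > 0" "\<And>x i. x \<noteq> 0 \<Longrightarrow> \<bar>x\<bar> < \<delta> \<Longrightarrow> i \<in> states \<Longrightarrow> u i x \<noteq> 0"
    using noncritical_near_0 by blast
  define e where "e = \<delta> / 2"
  have e: "e > 0" "e < \<delta>" using \<delta>(1) by (auto simp: e_def)
  have nz: "u i z \<noteq> 0" if "i \<in> states - {1}" "z \<in> {- e..e}" for i z
  proof (cases "z = 0")
    case True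
    then show ?thesis using u_other_0[OF that(1)] by simp
  next
    case False
    have "\<bar>z\<bar> < \<delta>" using that(2) e(2) by (simp add: abs_less_iff)
    from \<delta>(2)[OF False this, of i] show ?thesis using that(1) by blast
  qed
  have flux0: "flux i 0 = 0" if "i \<in> states - {1}" for i
    using d0[OF that] u_other_0[OF that] by (simp add: dens_eq)
  obtain i where i: "i \<in> states" "u i 0 < 0"
  proof -
    obtain ps where ps: "admissible ps" "run ps y = x" by (rule minimal_invariant_set_reach[OF J(1) y(1) x(1)])
    have "\<exists>i\<in>states. u i 0 < 0"
    proof (rule ccontr)
      assume "\<not> ?thesis"
      then have "\<And>i. i \<in> states \<Longrightarrow> 0 \<le> u i 0" using not_less by blast
      then have "0 \<le> run ps y" by (intro run_ge[OF ps(1)]) (use y in simp_all)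
      then show False using ps(2) x by simp
    qed
    then show ?thesis using that by blast
  qed
  obtain j where j: "j \<in> states" "u j 0 > 0"
  proof -
    obtain ps where ps: "admissible ps" "run ps x = y" by (rule minimal_invariant_set_reach[OF J(1) x(1) y(1)])
    have "\<exists>j\<in>states. u j 0 > 0"
    proof (rule ccontr)
      assume "\<not> ?thesis"
      then have "\<And>i. i \<in> states \<Longrightarrow> u i 0 \<le> 0" using not_less by blast
      then have "run ps x \<le> 0" by (intro run_le[OF ps(1)]) (use x in simp_all)
      then show False using ps(2) y by simp
    qed
    then show ?thesis using that by blast
  qed
  have i1: "i \<in> states - {1}" using i u_1_0 by auto
  have j1: "j \<in> states - {1}" using j u_1_0 by auto
  \<comment> \<open>The field with \<open>u i 0 < 0\<close> makes the right neighbourhood of \<open>0\<close> upstream, the field with \<open>u j 0 > 0\<close>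
    the left one.\<close>
  have right: "AE t in lborel. 0 < t \<longrightarrow> t < e \<longrightarrow> (\<forall>j\<in>states. \<rho> j t = 0)"
    by (rule vanishing_upstream[OF i(1)]) (use e i i1 nz flux0 in auto)
  have left: "AE t in lborel. - e < t \<longrightarrow> t < 0 \<longrightarrow> (\<forall>j\<in>states. \<rho> j t = 0)"
  proof (rule vanishing_upstream[OF j(1)])
    have "u j (- e) > 0"
    proof (rule ccontr)
      assume "\<not> ?thesis"
      then have "\<exists>c\<ge>- e. c \<le> 0 \<and> u j c = 0"
        by (intro IVT') (use j e in \<open>auto intro: continuous_on_subset[OF u_continuous[OF j(1)]]\<close>)
      then show False using nz[OF j1] e by auto
    qed
    then show "flux j (if 0 < u j (- e) then 0 else - e) = 0" using flux0[OF j1] by simp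
  qed (use e nz[OF j1] in auto)
  have "silent 0"
  proof (rule silentI[of "- e" 0 e])
    show "AE t in lborel. - e < t \<longrightarrow> t < e \<longrightarrow> (\<forall>j\<in>states. \<rho> j t = 0)"
      using left right AE_lborel_singleton[of 0]
    proof eventually_elim
      case (elim t)
      then show ?case by (cases "t < 0") auto
    qed
  qed (use e in auto)
  then obtain d where d: "d > 0" "\<And>y. \<bar>y - 0\<bar> < d \<Longrightarrow> silent y" using silent_open by blast
  obtain z where z: "z \<in> J" "0 < z" "z < d" using near(1)[OF d(1)] by blast
  then have "silent z" using d(2)[of z] by simp
  then show False using not_silent_in_support[OF J z(1)] by simp
qed

text \<open>
The assumptions make \<open>0\<close> the left endpoint of the closure of the minimal invariant set \<open>J\<close>.
\<close>
context
  fixes J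
  assumes J: "minimal_invariant_set N u J" and zero: "0 \<in> closure J" and right: "\<And>x. x \<in> J \<Longrightarrow> 0 \<le> x"
begin

text \<open>
If \<open>0\<close> itself is the point of \<open>J\<close> close to \<open>0\<close>, the field \<open>u 2\<close> moves it to the right.
\<close>
lemma left_endpoint_near:
  assumes e: "0 < e"
  shows "\<exists>x\<in>J. 0 < x \<and> x < e"
proof -
  obtain x where x: "x \<in> J" "dist x 0 < e" using zero e unfolding closure_approachable by blast
  have "0 \<le> x" by (rule right[OF x(1)])
  show ?thesis
  proof (cases "x = 0")
    case False
    then show ?thesis using x \<open>0 \<le> x\<close> by (intro bexI[of _ x]) auto
  next
    case True
    have 2: "2 \<in> states" using two_in_states by blast
    have fc: "forward_complete (u 2)" by (rule forward_complete_u[OF 2])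
    let ?X = "\<lambda>t. flow (u 2) t 0"
    have d: "(?X has_real_derivative u 2 0) (at 0 within {0..})"
      using flow_has_derivative[OF fc, of 0 0] by (simp add: flow_0[OF fc])
    have in_J: "?X t \<in> J" if "t \<ge> 0" for t
      using flow_stays_in_invariant_set[OF J _ 2 that, of 0] x(1) True by simp
    have "\<not> u 2 0 < 0"
    proof
      assume "u 2 0 < 0"
      from has_real_derivative_neg_dec_right[OF d this]
      obtain r where r: "r > 0" "\<And>h. h > 0 \<Longrightarrow> 0 + h \<in> {0..} \<Longrightarrow> h < r \<Longrightarrow> ?X 0 > ?X (0 + h)" by blast
      have "?X (r/2) < 0" using r(2)[of "r/2"] r(1) by (simp add: flow_0[OF fc])
      then show False using right[OF in_J[of "r/2"]] r(1) by simp
    qed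
    then have "u 2 0 > 0" using u_other_0[OF two_in_states] by simp
    from has_real_derivative_pos_inc_right[OF d this]
    obtain r where r: "r > 0" "\<And>h. h > 0 \<Longrightarrow> 0 + h \<in> {0..} \<Longrightarrow> h < r \<Longrightarrow> ?X 0 < ?X (0 + h)" by blast
    have "continuous (at 0 within {0..}) ?X" using d by (rule DERIV_continuous)
    then obtain s where s: "s > 0" "\<And>t. t \<in> {0..} \<Longrightarrow> dist t 0 < s \<Longrightarrow> dist (?X t) (?X 0) < e"
      using e unfolding continuous_within_eps_delta by blast
    define h where "h = min r s / 2"
    have h: "h > 0" "h < r" "h < s" using r(1) s(1) by (auto simp: h_def)
    have "0 < ?X h" using r(2)[of h] h by (simp add: flow_0[OF fc])
    moreover have "?X h < e" using s(2)[of h] h by (simp add: flow_0[OF fc] dist_real_def)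
    ultimately show ?thesis using in_J[of h] h by auto
  qed
qed

text \<open>
A field pointing to the left at \<open>0\<close> would carry points of \<open>J\<close> across \<open>0\<close>.
\<close>
lemma left_endpoint_inward:
  assumes i: "i \<in> states - {1}"
  shows "u i 0 > 0"
proof (rule ccontr)
  assume "\<not> ?thesis"
  then have neg: "u i 0 < 0" using u_other_0[OF i] by simp
  have ist: "i \<in> states" using i by blast
  have fc: "forward_complete (u i)" by (rule forward_complete_u[OF ist])
  define m where "m = - u i 0 / 2"
  have m: "m > 0" using neg by (simp add: m_def)
  obtain e where e: "e > 0" "\<And>y. \<bar>y - 0\<bar> < e \<Longrightarrow> \<bar>u i y - u i 0\<bar> < m"
    using u_isCont[OF ist, of 0] m unfolding continuous_at_eps_delta dist_real_def by meson
  have um: "u i y \<le> - m" if "\<bar>y\<bar> < e" for y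
    using e(2)[of y] that by (simp add: m_def)
  obtain x where x: "x \<in> J" "0 < x" "x < e" using left_endpoint_near[OF e(1)] by blast
  let ?X = "\<lambda>t. flow (u i) t x"
  have X: "0 \<le> ?X t" "?X t \<le> x" if "t \<ge> 0" for t
  proof -
    show "0 \<le> ?X t" by (rule right[OF flow_stays_in_invariant_set[OF J x(1) ist that]])
    show "?X t \<le> x" by (rule flow_le[OF fc _ that]) (use um[of x] x m in auto)
  qed
  \<comment> \<open>After time \<open>T\<close> a trajectory with velocity at most \<open>- m\<close> has travelled farther than from \<open>x\<close> to \<open>0\<close>.\<close>
  define T where "T = (x + 1) / m"
  have T: "T > 0" using x m by (simp add: T_def)
  have "?X T + m * T \<le> ?X 0 + m * 0"
  proof (rule DERIV_nonpos_imp_decreasing_open[OF less_imp_le[OF T]])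
    fix t assume t: "0 < t" "t < T"
    have "(?X has_real_derivative u i (?X t)) (at t within {0..})"
      using flow_has_derivative[OF fc, of t x] t by simp
    moreover have "at t within {0..} = at t" by (rule at_within_interior) (use t in simp)
    ultimately have "((\<lambda>t. ?X t + m * t) has_real_derivative u i (?X t) + m) (at t)"
      by (auto intro!: derivative_eq_intros)
    moreover have "u i (?X t) + m \<le> 0" using um[of "?X t"] X[of t] t x by simp
    ultimately show "\<exists>y. ((\<lambda>t. ?X t + m * t) has_real_derivative y) (at t) \<and> y \<le> 0" by (intro exI conjI)
  next
    show "continuous_on {0..T} (\<lambda>t. ?X t + m * t)"
      by (intro continuous_intros continuous_on_subset[OF continuous_on_flow[OF fc]]) auto
  qed
  moreover have "m * T = x + 1" using m by (simp add: T_def)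
  ultimately show False using X(1)[of T] T by (simp add: flow_0[OF fc])
qed

text \<open>
The fluxes at \<open>0\<close> are nonnegative and add up to \<open>0\<close>.
\<close>
lemma left_endpoint_inflow: "inflow 0 = 0"
proof -
  have nn: "0 \<le> flux i 0" if "i \<in> states - {1}" for i
  proof -
    have "flux i 0 = u i 0 * dens i 0" using left_endpoint_inward[OF that] by (intro flux_eq) simp
    then show ?thesis using left_endpoint_inward[OF that] dens_nonneg[of i 0] that by simp
  qed
  have "(\<Sum>i\<in>states. flux i 0) = flux 1 0 + (\<Sum>i\<in>states - {1}. flux i 0)"
    by (rule sum.remove[OF _ one_in_states]) simp
  then have "(\<Sum>i\<in>states - {1}. flux i 0) = 0" using sum_flux[of 0] flux_1_0 by simp
  then have "flux i 0 = 0" if "i \<in> states - {1}" for i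
    using sum_nonneg_eq_0_iff[of "states - {1}" "\<lambda>i. flux i 0"] nn that by auto
  then show ?thesis unfolding inflow_eq_0_iff by (simp add: dens_eq)
qed

text \<open>
If \<open>u 1\<close> were repelling, all fields would point to the right at points close to \<open>0\<close>, and a point of \<open>J\<close>
could not reach the points of \<open>J\<close> to its left.
\<close>
lemma left_endpoint_attracting: "a > 0"
proof (rule ccontr)
  assume "\<not> a > 0"
  then have neg: "a < 0" using a_nonzero by simp
  have "eventually (\<lambda>x. 0 < u 1 x / x) (at_right 0)"
    by (rule order_tendstoD(1)[OF u_1_slope]) (use neg in simp)
  moreover have "eventually (\<lambda>x. \<forall>i\<in>states - {1}. 0 < u i x) (at_right 0)"
  proof (rule eventually_ball_finite, simp, rule ballI)
    fix i assume i: "i \<in> states - {1}"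
    have "isCont (u i) 0" by (rule u_isCont) (use i in blast)
    then have "(u i \<longlongrightarrow> u i 0) (at_right 0)" unfolding isCont_def by (rule filterlim_mono) (auto simp: at_le)
    then show "eventually (\<lambda>x. 0 < u i x) (at_right 0)" by (rule order_tendstoD(1)) (rule left_endpoint_inward[OF i])
  qed
  ultimately have "eventually (\<lambda>x. 0 < u 1 x / x \<and> (\<forall>i\<in>states - {1}. 0 < u i x)) (at_right 0)"
    by eventually_elim simp
  then obtain e where e: "e > 0" "\<And>x. 0 < x \<Longrightarrow> x < e \<Longrightarrow> 0 < u 1 x / x \<and> (\<forall>i\<in>states - {1}. 0 < u i x)"
    unfolding eventually_at_right_field by auto
  obtain x where x: "x \<in> J" "0 < x" "x < e" using left_endpoint_near[OF e(1)] by blast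
  obtain y where y: "y \<in> J" "0 < y" "y < x" using left_endpoint_near[OF x(2)] by blast
  have pos: "0 \<le> u i x" if "i \<in> states" for i
  proof (cases "i = 1")
    case True
    then show ?thesis using e(2)[OF x(2,3)] x(2) by (simp add: zero_less_divide_iff)
  next
    case False
    then have "i \<in> states - {1}" using that by blast
    then show ?thesis using e(2)[OF x(2,3)] less_imp_le by blast
  qed
  obtain ps where ps: "admissible ps" "run ps x = y" by (rule minimal_invariant_set_reach[OF J x(1) y(1)])
  have "x \<le> run ps x" by (rule run_ge[OF ps(1) pos]) auto
  then show False using ps(2) y by simp
qed

end

lemma case_B_witness:
  assumes "case_B N u \<mu>"
  obtains J where "minimal_invariant_set N u J" "measure \<mu> (J \<times> states) > 0" "0 \<in> interior (closure J)"
  using assms unfolding case_B_def support_intervals_def by blast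

lemma case_C_witness:
  assumes "case_C N u \<mu>"
  obtains J where "minimal_invariant_set N u J" "measure \<mu> (J \<times> states) > 0" "0 \<in> closure J" "\<And>x. x \<in> J \<Longrightarrow> 0 \<le> x"
proof -
  obtain J where J: "minimal_invariant_set N u J" "measure \<mu> (J \<times> states) > 0" "0 \<in> closure J" "\<forall>x\<in>closure J. 0 \<le> x"
    using assms unfolding case_C_def support_intervals_def by blast
  have "0 \<le> x" if "x \<in> J" for x using J(4) that closure_subset by blast
  from that[OF J(1-3) this] show ?thesis .
qed

lemma case_B_inflow: "case_B N u \<mu> \<Longrightarrow> inflow 0 > 0"
  by (erule case_B_witness) (rule inflow_positive_inside)

lemma case_C_inflow: "case_C N u \<mu> \<Longrightarrow> inflow 0 = 0"
  by (erule case_C_witness) (rule left_endpoint_inflow)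

lemma case_C_attracting: "case_C N u \<mu> \<Longrightarrow> a > 0"
  by (erule case_C_witness) (rule left_endpoint_attracting)

lemma power_law_near_0:
  assumes l: "rate 1 < a" and cases: "case_B N u \<mu> \<or> case_C N u \<mu>"
  shows "\<exists>c>0. (\<lambda>\<eta>. dens 1 \<eta> - c * \<eta> powr (rate 1 / a - 1)) \<in> o[at_right 0](\<lambda>\<eta>. \<eta> powr (rate 1 / a - 1))"
proof -
  obtain J where J: "minimal_invariant_set N u J" "measure \<mu> (J \<times> states) > 0" "\<And>e. 0 < e \<Longrightarrow> \<exists>x\<in>J. 0 < x \<and> x < e"
    using cases
  proof
    assume "case_B N u \<mu>"
    then obtain J where "minimal_invariant_set N u J" "measure \<mu> (J \<times> states) > 0" "0 \<in> interior (closure J)"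
      by (rule case_B_witness)
    then show ?thesis using that meets_interior_of_closure(1) by blast
  next
    assume "case_C N u \<mu>"
    then obtain J where "minimal_invariant_set N u J" "measure \<mu> (J \<times> states) > 0" "0 \<in> closure J" "\<And>x. x \<in> J \<Longrightarrow> 0 \<le> x"
      by (rule case_C_witness) (rule that)
    then show ?thesis using that left_endpoint_near by blast
  qed
  obtain v' \<delta> C where ode: "boundary_ode (u 1) v' (flux 1) inflow a (rate 1) \<delta> C (inflow 0)"
    by (rule obtain_boundary_ode)
  interpret boundary_ode "u 1" v' "flux 1" inflow a "rate 1" \<delta> C "inflow 0" by (rule ode)
  have "\<exists>x. 0 < x \<and> x < e \<and> (flux 1 x \<noteq> 0 \<or> inflow x \<noteq> 0)" if e: "0 < e" "e \<le> \<delta>" for e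
    by (rule density_positive_near_0[OF J e(1)]) (use v_nz e in auto)
  then obtain c where c: "c > 0" "((\<lambda>x. (flux 1 x / u 1 x) / x powr (rate 1 / a - 1)) \<longlongrightarrow> c) (at_right 0)"
    using power_law[OF l] by blast
  have "(\<lambda>\<eta>. dens 1 \<eta> - c * \<eta> powr (rate 1 / a - 1)) \<in> o[at_right 0](\<lambda>\<eta>. \<eta> powr (rate 1 / a - 1))"
  proof (rule smalloI_tendsto)
    have "((\<lambda>x. (flux 1 x / u 1 x) / x powr (rate 1 / a - 1) - c) \<longlongrightarrow> 0) (at_right 0)"
      using tendsto_diff[OF c(2) tendsto_const[of c]] by simp
    moreover have "eventually (\<lambda>x. (flux 1 x / u 1 x) / x powr (rate 1 / a - 1) - c
        = (dens 1 x - c * x powr (rate 1 / a - 1)) / x powr (rate 1 / a - 1)) (at_right 0)"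
      by (rule eventually_at_right_0_I[of 1]) (simp_all add: dens_eq diff_divide_distrib)
    ultimately show "((\<lambda>x. (dens 1 x - c * x powr (rate 1 / a - 1)) / x powr (rate 1 / a - 1)) \<longlongrightarrow> 0) (at_right 0)"
      by (rule Lim_transform_eventually)
    show "eventually (\<lambda>x. x powr (rate 1 / a - 1) \<noteq> 0) (at_right (0::real))"
      by (rule eventually_at_right_0_I[of 1]) simp_all
  qed
  then show ?thesis using c(1) by blast
qed

lemma finite_limit_near_0:
  assumes "a < rate 1"
  shows "(dens 1 \<longlongrightarrow> inflow 0 / (rate 1 - a)) (at_right 0)"
proof -
  obtain v' \<delta> C where "boundary_ode (u 1) v' (flux 1) inflow a (rate 1) \<delta> C (inflow 0)"
    by (rule obtain_boundary_ode)
  from boundary_ode.finite_limit[OF this assms] show ?thesis by (simp add: dens_eq[abs_def])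
qed

lemma logarithmic_bounds_near_0:
  assumes l: "rate 1 = a"
  shows "\<exists>c>0. eventually (\<lambda>\<eta>. dens 1 \<eta> \<le> - c * ln \<eta>) (at_right 0)"
    and "inflow 0 > 0 \<Longrightarrow> \<exists>c>0. eventually (\<lambda>\<eta>. - c * ln \<eta> \<le> dens 1 \<eta>) (at_right 0)"
proof -
  have a: "a > 0" using rate_pos[OF one_in_states] l by simp
  obtain v' \<delta> C where "boundary_ode (u 1) v' (flux 1) inflow a (rate 1) \<delta> C (inflow 0)"
    by (rule obtain_boundary_ode)
  from boundary_ode.logarithmic_limit[OF this l]
  have lim: "((\<lambda>x. dens 1 x / - ln x) \<longlongrightarrow> inflow 0 / a) (at_right 0)" by (simp add: dens_eq)
  have ln: "eventually (\<lambda>x::real. - ln x > 0) (at_right 0)"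
    by (rule eventually_at_right_0_I[of 1]) simp_all
  have "eventually (\<lambda>x. dens 1 x / - ln x < inflow 0 / a + 1) (at_right 0)"
    by (rule order_tendstoD(2)[OF lim]) simp
  then have "eventually (\<lambda>x. dens 1 x \<le> - (inflow 0 / a + 1) * ln x) (at_right 0)"
    using ln
  proof eventually_elim
    case (elim x)
    then have "dens 1 x < (inflow 0 / a + 1) * - ln x" by (simp only: pos_divide_less_eq)
    then show ?case by (simp only: mult_minus_left mult_minus_right less_imp_le)
  qed
  moreover have "inflow 0 / a + 1 > 0" using inflow_nonneg[of 0] a by (simp add: add_nonneg_pos)
  ultimately show "\<exists>c>0. eventually (\<lambda>\<eta>. dens 1 \<eta> \<le> - c * ln \<eta>) (at_right 0)" by blast
  assume pos: "inflow 0 > 0"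
  obtain c where c: "c > 0" and "c < inflow 0 / a"
    using dense[OF divide_pos_pos[OF pos a]] by blast
  from this(2) have "eventually (\<lambda>x. c < dens 1 x / - ln x) (at_right 0)"
    by (rule order_tendstoD(1)[OF lim])
  then have "eventually (\<lambda>x. - c * ln x \<le> dens 1 x) (at_right 0)"
    using ln
  proof eventually_elim
    case (elim x)
    then have "c * - ln x < dens 1 x" by (simp only: pos_less_divide_eq)
    then show ?case by (simp only: mult_minus_left mult_minus_right less_imp_le)
  qed
  then show "\<exists>c>0. eventually (\<lambda>\<eta>. - c * ln \<eta> \<le> dens 1 \<eta>) (at_right 0)" using c by blast
qed

end

theorem theorem3:
  fixes N :: nat
    and u :: "nat \<Rightarrow> real \<Rightarrow> real"
    and lam :: "nat \<Rightarrow> nat \<Rightarrow> real"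
    and \<mu> :: "(real \<times> nat) measure"
    and \<rho> :: "nat \<Rightarrow> real \<Rightarrow> real"
    and a :: real
  assumes "N \<ge> 2"
    and "\<And>i. i \<in> {1..N} \<Longrightarrow> u i C1_differentiable_on UNIV"
    and "\<And>i. i \<in> {1..N} \<Longrightarrow> forward_complete (u i)"
    and "\<And>i j. i \<in> {1..N} \<Longrightarrow> j \<in> {1..N} \<Longrightarrow> i \<noteq> j \<Longrightarrow> lam i j > 0"
    and "\<And>x. \<not> x islimpt {y. \<exists>i\<in>{1..N}. u i y = 0}"
    and "invariant_measure N u lam \<mu>"
    and "absolutely_continuous (lborel \<Otimes>\<^sub>M count_space {1..N}) \<mu>"
    and "\<And>i. i \<in> {1..N} \<Longrightarrow> invariant_density \<mu> i (\<rho> i)"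
    and "u 1 0 = 0"
    and "\<And>i. i \<in> {1..N} - {1} \<Longrightarrow> u i 0 \<noteq> 0"
    and "a \<noteq> 0"
    and "(\<lambda>\<eta>. u 1 \<eta> - (- a * \<eta>)) \<in> O[at_right 0](\<lambda>\<eta>. \<eta> ^ 2)"
  shows "\<exists>r :: nat \<Rightarrow> real \<Rightarrow> real.
    (\<forall>i\<in>{1..N}. r i \<in> borel_measurable borel \<and> (AE x in lborel. r i x = \<rho> i x) \<and>
                continuous_on {x. u i x \<noteq> 0} (r i)) \<and>
    (exit_rate N lam 1 < a \<longrightarrow> case_B N u \<mu> \<or> case_C N u \<mu> \<longrightarrow>
       (\<exists>c>0. (\<lambda>\<eta>. r 1 \<eta> - c * \<eta> powr (exit_rate N lam 1 / a - 1))
                \<in> o[at_right 0](\<lambda>\<eta>. \<eta> powr (exit_rate N lam 1 / a - 1)))) \<and>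
    (exit_rate N lam 1 > a \<and> a > 0 \<longrightarrow>
       (case_B N u \<mu> \<longrightarrow>
          (r 1 \<longlongrightarrow> rho_bar N lam r 0 / (exit_rate N lam 1 - a)) (at_right 0) \<and>
          rho_bar N lam r 0 / (exit_rate N lam 1 - a) > 0) \<and>
       (case_C N u \<mu> \<longrightarrow>
          (r 1 \<longlongrightarrow> rho_bar N lam r 0 / (exit_rate N lam 1 - a)) (at_right 0) \<and>
          rho_bar N lam r 0 / (exit_rate N lam 1 - a) = 0)) \<and>
    (exit_rate N lam 1 = a \<longrightarrow>
       (case_B N u \<mu> \<longrightarrow>
          (\<exists>c'>0. \<exists>c>0. eventually (\<lambda>\<eta>. - c' * ln \<eta> \<le> r 1 \<eta> \<and> r 1 \<eta> \<le> - c * ln \<eta>) (at_right 0))) \<and>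
       (case_C N u \<mu> \<longrightarrow>
          (\<exists>c>0. eventually (\<lambda>\<eta>. r 1 \<eta> \<le> - c * ln \<eta>) (at_right 0)))) \<and>
    (a < 0 \<longrightarrow>
       (case_B N u \<mu> \<longrightarrow>
          (r 1 \<longlongrightarrow> rho_bar N lam r 0 / (exit_rate N lam 1 - a)) (at_right 0) \<and>
          rho_bar N lam r 0 / (exit_rate N lam 1 - a) > 0) \<and>
       \<not> case_C N u \<mu>)"
proof -
  interpret critical_origin N u lam \<mu> \<rho> a
    by unfold_locales (fact assms)+
  have l: "rate 1 > 0" by (rule rate_pos[OF one_in_states])
  show ?thesis
  \<comment> \<open>The normalised representative of each density is \<open>flux i / u i\<close>.\<close>
  proof (intro exI[of _ dens] conjI ballI impI; (elim conjE)?)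
    fix i assume i: "i \<in> {1..N}"
    show "dens i \<in> borel_measurable borel" by (rule dens_measurable[OF i])
    show "AE x in lborel. dens i x = \<rho> i x" using dens_eq_rho by eventually_elim (use i in auto)
    show "continuous_on {x. u i x \<noteq> 0} (dens i)" by (rule dens_continuous[OF i])
  next
    assume "rate 1 < a" "case_B N u \<mu> \<or> case_C N u \<mu>"
    then show "\<exists>c>0. (\<lambda>\<eta>. dens 1 \<eta> - c * \<eta> powr (rate 1 / a - 1)) \<in> o[at_right 0](\<lambda>\<eta>. \<eta> powr (rate 1 / a - 1))"
      by (rule power_law_near_0)
  next
    assume "a < rate 1" "case_B N u \<mu>"
    then show "(dens 1 \<longlongrightarrow> inflow 0 / (rate 1 - a)) (at_right 0)" "inflow 0 / (rate 1 - a) > 0"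
      using finite_limit_near_0 case_B_inflow by auto
  next
    assume "a < rate 1" "case_C N u \<mu>"
    then show "(dens 1 \<longlongrightarrow> inflow 0 / (rate 1 - a)) (at_right 0)" "inflow 0 / (rate 1 - a) = 0"
      using finite_limit_near_0 case_C_inflow by auto
  next
    assume eq: "rate 1 = a" and B: "case_B N u \<mu>"
    obtain c where c: "c > 0" "eventually (\<lambda>\<eta>. dens 1 \<eta> \<le> - c * ln \<eta>) (at_right 0)"
      using logarithmic_bounds_near_0(1)[OF eq] by blast
    obtain c' where c': "c' > 0" "eventually (\<lambda>\<eta>. - c' * ln \<eta> \<le> dens 1 \<eta>) (at_right 0)"
      using logarithmic_bounds_near_0(2)[OF eq case_B_inflow[OF B]] by blast
    show "\<exists>c'>0. \<exists>c>0. eventually (\<lambda>\<eta>. - c' * ln \<eta> \<le> dens 1 \<eta> \<and> dens 1 \<eta> \<le> - c * ln \<eta>) (at_right 0)"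
      using c(1) c'(1) eventually_conj[OF c'(2) c(2)] by blast
  next
    assume "rate 1 = a"
    then show "\<exists>c>0. eventually (\<lambda>\<eta>. dens 1 \<eta> \<le> - c * ln \<eta>) (at_right 0)"
      by (rule logarithmic_bounds_near_0(1))
  next
    assume "a < 0" "case_B N u \<mu>"
    then show "(dens 1 \<longlongrightarrow> inflow 0 / (rate 1 - a)) (at_right 0)" "inflow 0 / (rate 1 - a) > 0"
      using finite_limit_near_0 case_B_inflow l by auto
  next
    assume "a < 0"
    then show "\<not> case_C N u \<mu>" using case_C_attracting by force
  qed
qed

end
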